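(* Let $\mathcal A$ and $\mathcal B$ be small associative categories. Then an $\mathcal A$-$\mathcal B$ bimodule structure on a small permutative category $\mathcal D$ determines and is determined by a multifunctor $\mathbf B^{\Sigma_*}\to\mathbf P$ sending $M$ to $\mathcal D$, restricting on the single object $A$ to the structure multifunctor $\Sigma_*\to\mathbf P$ for $\mathcal A$ and on the single object $B$ to the structure multifunctor for $\mathcal B$.
   Context: **Multicategories.** A multicategory (symmetric colored operad) has objects, $k$-morphisms $\mathbf M_k(a_1,\dots,a_k;b)$ for $k\ge0$, right symmetric group actions $\sigma^*:\mathbf M_k(a_1,\dots,a_k;b)\to\mathbf M_k(a_{\sigma(1)},\dots,a_{\sigma(k)};b)$, units, and multiproducts $\Gamma$ satisfying the usual operad identities; a multifunctor preserves all this structure. Sets are regarded as discrete categories. **Permutative categories.** A permutative category is a category $\mathcal C$ with a functor $\oplus$, an object $0$ and a natural isomorphism $\gamma:a\oplus b\cong b\oplus a$ such that $\oplus$ is strictly associative, $0$ is a strict unit, $\gamma_{a,0}=\mathrm{id}$, $\gamma_{b,a}\gamma_{a,b}=\mathrm{id}$, $\gamma_{a\oplus b,c}=(\gamma_{a,c}\oplus 1)(1\oplus\gamma_{b,c})$. **The multicategory $\mathbf P$** (enriched over small categories). Objects: small permutative categories. An object of $\mathbf P_k(\mathcal C_1,\dots,\mathcal C_k;\mathcal D)$ (a $k$-linear map) is a functor $f:\mathcal C_1\times\dots\times\mathcal C_k\to\mathcal D$ with $f(c_1,\dots,c_k)=0$ if any of the $c_i$ is $0$, with natural transformations $\delta_i:f(c_i)\oplus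 f(c_i')\to f(c_i\oplus c_i')$ in each variable (fixed variables suppressed), with $\delta_i=\mathrm{id}$ if $c_i$, $c_i'$ or any other $c_j$ is $0$, and $f(\gamma)\delta_i=\delta_i\gamma$; $\delta_i(\delta_i\oplus1)=\delta_i(1\oplus\delta_i)$; for $i\ne j$, $\delta_j(\delta_i\oplus\delta_i)=\delta_i(\delta_j\oplus\delta_j)(1\oplus\gamma\oplus1)$ as maps $f(c_i,c_j)\oplus f(c_i',c_j)\oplus f(c_i,c_j')\oplus f(c_i',c_j')\to f(c_i\oplus c_i',c_j\oplus c_j')$. Morphisms $\phi:f\to g$ are natural transformations with $\phi\,\delta_i^f=\delta_i^g(\phi\oplus\phi)$. $\sigma^*f(c_{\sigma(1)},\dots,c_{\sigma(k)})=f(c_1,\dots,c_k)$; $\Gamma(g;f_1,\dots,f_n)=g\circ(f_1\times\dots\times f_n)$ with distributivity maps $g(\delta_i^{f_j})\circ\delta_j^g$. **Associative category:** a permutative category $\mathcal A$ with a functor $\otimes:\mathcal A\times\mathcal A\to\mathcal A$, strictly associative with strict unit object $1$, and natural distributivity maps $d_l(a,a';b):(a\otimes b)\oplus(a'\otimes b)\to(a\oplus a')\otimes b$ and $d_r(a;b,b'):(a\otimes b)\oplus(a\otimes b')\to a\otimes(b\oplus b')$ such that: (a) $a\otimes0=0\otimes a=0$ for all $a$; (b) $d_l(d_l\oplus1)=d_l(1\oplus d_l)$, and similarly for $d_r$; (c) $(\gamma\otimes1)d_l=d_l\gamma$, $(1\otimes\gamma)d_r=d_r\gamma$; (d) $d_l(a,a';b\otimes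 c)=(d_l(a,a';b)\otimes1_c)d_l(a\otimes b,a'\otimes b;c)$, $d_r(a\otimes b;c,c')=(1_a\otimes d_r(b;c,c'))d_r(a;b\otimes c,b\otimes c')$; (e) $(d_r(a;b,b')\otimes1_c)d_l(a\otimes b,a\otimes b';c)=(1_a\otimes d_l(b,b';c))d_r(a;b\otimes c,b'\otimes c)$; (f) $d_l(a,a';b\oplus b')(d_r(a;b,b')\oplus d_r(a';b,b'))=d_r(a\oplus a';b,b')(d_l(a,a';b)\oplus d_l(a,a';b'))(1\oplus\gamma\oplus1)$. **Modules.** A left $\mathcal A$-module structure on a permutative category $\mathcal D$ is a functor $\otimes:\mathcal A\times\mathcal D\to\mathcal D$, strictly associative and strictly unital, with natural distributivity maps $d_l:(a\otimes d)\oplus(a'\otimes d)\to(a\oplus a')\otimes d$, $d_r:(a\otimes d)\oplus(a\otimes d')\to a\otimes(d\oplus d')$, subject to the commutativity of all the diagrams in the definition of associative category above (conditions (a)–(f), read with the last tensor factor in $\mathcal D$ and the preceding ones in $\mathcal A$). A right $\mathcal B$-module structure is a functor $\otimes:\mathcal D\times\mathcal B\to\mathcal D$, strictly associative and unital in the analogous sense, with distributivity maps defined analogously and satisfying the corresponding diagrams (first tensor factor in $\mathcal D$, the others in $\mathcal B$). **$\mathcal A$-$\mathcal B$ bimodule structure** on $\mathcal D$: a left $\mathcal A$-module structure and a right $\mathcal B$-module structure such that $(a\otimes d)\otimes b=a\otimes(d\otimes b)$ (as functors $\mathcal A\times\mathcal D\times\mathcal B\to\mathcal D$), and diagrams (e)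 and (f) commute in all situations in which the maps are defined. **Operad $\Sigma_*$:** $k$-th set $\Sigma_k$ with right multiplication action, $\Gamma(\sigma;\phi_1,\dots,\phi_k)=\sigma\langle j_1,\dots,j_k\rangle\circ(\phi_1\amalg\dots\amalg\phi_k)$ for $\phi_i\in\Sigma_{j_i}$, where $\sigma\langle j_1,\dots,j_k\rangle$ permutes blocks $j_1\amalg\dots\amalg j_k\to j_{\sigma^{-1}(1)}\amalg\dots\amalg j_{\sigma^{-1}(k)}$. The structure multifunctor $\Sigma_*\to\mathbf P$ of an associative category sends $\sigma$ to $(a_1,\dots,a_k)\mapsto a_{\sigma^{-1}(1)}\otimes\dots\otimes a_{\sigma^{-1}(k)}$ with distributivity maps composed from $d_l,d_r$. **$\mathbf B^{\Sigma_*}$** has objects $A,B,M$. The $k$-morphism set is $\Sigma_k$ if all inputs and the output are $A$, or all inputs and the output are $B$. If $M$ is the output and appears exactly once among the inputs $C_1,\dots,C_k$, say $C_j=M$ (all other inputs being $A$ or $B$), then $\mathbf B^{\Sigma_*}_k(C_1,\dots,C_k;M)=\{\sigma\in\Sigma_k:\sigma(i)<\sigma(j)\Leftrightarrow C_i=A\}$. All other sets are empty. Actions and multiproduct are as in $\Sigma_*$. Restricting to the object $A$ or to the object $B$ gives multifunctors $\Sigma_*\to\mathbf B^{\Sigma_*}$. The correspondence: the two action pairings with their distributivity maps are the images of the single elements of $\mathbf B^{\Sigma_*}_2(A,M;M)$ and $\mathbf B^{\Sigma_*}_2(M,B;M)$.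
   Formalization: Added, as the claim fails otherwise: in associative categories and modules, distributivity maps are identities when an object is 0, as are d_l(x,x';1) and d_r(1;y,y'); and a bimodule must also satisfy diagrams (d) for a⊗d⊗b, not only (e) and (f). *)

theory Defs
  imports "HOL-Library.FuncSet" "HOL-Combinatorics.Permutations"
begin

section \<open>Small categories and functors\<close>

text \<open>
  Small categories are given by carrier sets inside a type of objects and a type of arrows.
  Since the types are arbitrary, any set of small categories fits into one pair of types
  (use a disjoint sum), so that fixing these types only fixes a universe of small sets.
  \<open>Cmp C g f\<close> is "g after f".
\<close>

record ('o, 'a) cat =
  Obj :: "'o set"
  Arr :: "'a set"
  Dom :: "'a \<Rightarrow> 'o"
  Cod :: "'a \<Rightarrow> 'o"
  Idt :: "'o \<Rightarrow> 'a"
  Cmp :: "'a \<Rightarrow> 'a \<Rightarrow> 'a"  (infixl "\<cdot>\<index>" 55)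

definition hom :: "('o, 'a, 'z) cat_scheme \<Rightarrow> 'o \<Rightarrow> 'o \<Rightarrow> 'a set" where
  "hom C x y = {f \<in> Arr C. Dom C f = x \<and> Cod C f = y}"

locale category =
  fixes C :: "('o, 'a, 'z) cat_scheme" (structure)
  assumes dom_closed: "f \<in> Arr C \<Longrightarrow> Dom C f \<in> Obj C"
    and cod_closed: "f \<in> Arr C \<Longrightarrow> Cod C f \<in> Obj C"
    and id_hom: "x \<in> Obj C \<Longrightarrow> Idt C x \<in> hom C x x"
    and cmp_hom: "f \<in> hom C x y \<Longrightarrow> g \<in> hom C y z \<Longrightarrow> g \<cdot> f \<in> hom C x z"
    and cmp_id: "f \<in> hom C x y \<Longrightarrow> f \<cdot> Idt C x = f"
    and id_cmp: "f \<in> hom C x y \<Longrightarrow> Idt C y \<cdot> f = f"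
    and cmp_assoc: "f \<in> hom C w x \<Longrightarrow> g \<in> hom C x y \<Longrightarrow> h \<in> hom C y z
                      \<Longrightarrow> (h \<cdot> g) \<cdot> f = h \<cdot> (g \<cdot> f)"

definition discrete_cat :: "'m set \<Rightarrow> ('m, 'm) cat" where
  "discrete_cat S = \<lparr>Obj = S, Arr = S, Dom = \<lambda>x. x, Cod = \<lambda>x. x, Idt = \<lambda>x. x, Cmp = \<lambda>x y. x\<rparr>"

definition pair_cat ::
    "('o, 'a, 'y) cat_scheme \<Rightarrow> ('p, 'b, 'z) cat_scheme \<Rightarrow> ('o \<times> 'p, 'a \<times> 'b) cat" where
  "pair_cat C D =
    \<lparr>Obj = Obj C \<times> Obj D, Arr = Arr C \<times> Arr D,
     Dom = map_prod (Dom C) (Dom D), Cod = map_prod (Cod C) (Cod D),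
     Idt = map_prod (Idt C) (Idt D),
     Cmp = \<lambda>(g, g') (f, f'). (Cmp C g f, Cmp D g' f')\<rparr>"

definition prod_cat :: "('o, 'a, 'z) cat_scheme list \<Rightarrow> ('o list, 'a list) cat" where
  "prod_cat Cs =
    \<lparr>Obj = {xs. list_all2 (\<lambda>C x. x \<in> Obj C) Cs xs},
     Arr = {fs. list_all2 (\<lambda>C f. f \<in> Arr C) Cs fs},
     Dom = map2 Dom Cs, Cod = map2 Cod Cs, Idt = map2 Idt Cs,
     Cmp = \<lambda>gs fs. map2 (\<lambda>C (g, f). Cmp C g f) Cs (zip gs fs)\<rparr>"

locale cfunctor =
  fixes C :: "('o, 'a, 'y) cat_scheme" and D :: "('p, 'b, 'z) cat_scheme"
    and Fo :: "'o \<Rightarrow> 'p" and Fa :: "'a \<Rightarrow> 'b"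
  assumes obj: "x \<in> Obj C \<Longrightarrow> Fo x \<in> Obj D"
    and arr: "f \<in> Arr C \<Longrightarrow> Fa f \<in> hom D (Fo (Dom C f)) (Fo (Cod C f))"
    and ident: "x \<in> Obj C \<Longrightarrow> Fa (Idt C x) = Idt D (Fo x)"
    and comp: "f \<in> Arr C \<Longrightarrow> g \<in> Arr C \<Longrightarrow> Cod C f = Dom C g
                 \<Longrightarrow> Fa (Cmp C g f) = Cmp D (Fa g) (Fa f)"


section \<open>Permutative categories\<close>

text \<open>The sum of objects is written \<open>\<oplus>\<close>, the sum of arrows \<open>\<boxplus>\<close>.\<close>

record ('o, 'a) permcat = "('o, 'a) cat" +
  zero :: 'o  ("\<zero>\<index>")
  osum :: "'o \<Rightarrow> 'o \<Rightarrow> 'o"  (infixl "\<oplus>\<index>" 65)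
  asum :: "'a \<Rightarrow> 'a \<Rightarrow> 'a"  (infixl "\<boxplus>\<index>" 65)
  sym :: "'o \<Rightarrow> 'o \<Rightarrow> 'a"  ("\<gamma>\<index>")

locale permutative = category C for C :: "('o, 'a) permcat" (structure) +
  assumes sum_functor: "cfunctor (pair_cat C C) C (\<lambda>(x, y). x \<oplus> y) (\<lambda>(f, g). f \<boxplus> g)"
    and zero_obj: "\<zero> \<in> Obj C"
    and osum_assoc: "x \<in> Obj C \<Longrightarrow> y \<in> Obj C \<Longrightarrow> z \<in> Obj C \<Longrightarrow> (x \<oplus> y) \<oplus> z = x \<oplus> (y \<oplus> z)"
    and asum_assoc: "f \<in> Arr C \<Longrightarrow> g \<in> Arr C \<Longrightarrow> h \<in> Arr C \<Longrightarrow> (f \<boxplus> g) \<boxplus> h = f \<boxplus> (g \<boxplus> h)"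
    and osum_zero: "x \<in> Obj C \<Longrightarrow> x \<oplus> \<zero> = x" "x \<in> Obj C \<Longrightarrow> \<zero> \<oplus> x = x"
    and asum_zero: "f \<in> Arr C \<Longrightarrow> f \<boxplus> Idt C \<zero> = f" "f \<in> Arr C \<Longrightarrow> Idt C \<zero> \<boxplus> f = f"
    and sym_hom: "x \<in> Obj C \<Longrightarrow> y \<in> Obj C \<Longrightarrow> \<gamma> x y \<in> hom C (x \<oplus> y) (y \<oplus> x)"
    and sym_natural: "f \<in> hom C x x' \<Longrightarrow> g \<in> hom C y y'
                        \<Longrightarrow> \<gamma> x' y' \<cdot> (f \<boxplus> g) = (g \<boxplus> f) \<cdot> \<gamma> x y"
    and sym_zero: "x \<in> Obj C \<Longrightarrow> \<gamma> x \<zero> = Idt C x"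
    and sym_sym: "x \<in> Obj C \<Longrightarrow> y \<in> Obj C \<Longrightarrow> \<gamma> y x \<cdot> \<gamma> x y = Idt C (x \<oplus> y)"
    and sym_osum: "x \<in> Obj C \<Longrightarrow> y \<in> Obj C \<Longrightarrow> z \<in> Obj C
                     \<Longrightarrow> \<gamma> (x \<oplus> y) z = (\<gamma> x z \<boxplus> Idt C y) \<cdot> (Idt C x \<boxplus> \<gamma> y z)"


section \<open>Multicategories enriched over small categories, and multifunctors\<close>

text \<open>
  \<open>MHom M [a\<^sub>1,\<dots>,a\<^sub>k] b\<close> is the category of \<open>k\<close>-morphisms; \<open>MAct\<close>, \<open>MAct2\<close> are the object and
  arrow parts of the symmetric group action, \<open>MComp\<close>, \<open>MComp2\<close> those of the multiproduct.
  Positions are counted from 0, and \<open>\<Sigma>\<^sub>k\<close> is the set of permutations of \<open>{..<k}\<close>.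
  The operations carry profiles as arguments because different \<open>MHom\<close> may overlap:
    \<open>MAct M as b \<sigma> : MHom M as b \<rightarrow> MHom M (permute_list \<sigma> as) b\<close>, where
    \<open>permute_list \<sigma> [a\<^sub>1,\<dots>,a\<^sub>k] = [a\<^sub>\<sigma>\<^sub>(\<^sub>1\<^sub>),\<dots>,a\<^sub>\<sigma>\<^sub>(\<^sub>k\<^sub>)]\<close>, and
    \<open>MComp M [as\<^sub>1,\<dots>,as\<^sub>n] [b\<^sub>1,\<dots>,b\<^sub>n] c : MHom M [b\<^sub>1,\<dots>,b\<^sub>n] c \<times> \<Prod>\<^sub>j MHom M as\<^sub>j b\<^sub>j
       \<rightarrow> MHom M (as\<^sub>1 @ \<dots> @ as\<^sub>n) c\<close>.
  The record holds the structure on which multifunctors are defined; the identities satisfied by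
  it do not enter the notion of a multifunctor.
\<close>

record ('x, 'm, 't) multicat =
  MOb :: "'x set"
  MHom :: "'x list \<Rightarrow> 'x \<Rightarrow> ('m, 't) cat"
  MUnit :: "'x \<Rightarrow> 'm"
  MAct :: "'x list \<Rightarrow> 'x \<Rightarrow> (nat \<Rightarrow> nat) \<Rightarrow> 'm \<Rightarrow> 'm"
  MAct2 :: "'x list \<Rightarrow> 'x \<Rightarrow> (nat \<Rightarrow> nat) \<Rightarrow> 't \<Rightarrow> 't"
  MComp :: "'x list list \<Rightarrow> 'x list \<Rightarrow> 'x \<Rightarrow> 'm \<Rightarrow> 'm list \<Rightarrow> 'm"
  MComp2 :: "'x list list \<Rightarrow> 'x list \<Rightarrow> 'x \<Rightarrow> 't \<Rightarrow> 't list \<Rightarrow> 't"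

record ('x, 'm, 't, 'y, 'n, 'u) mfun =
  FOb :: "'x \<Rightarrow> 'y"
  FMor :: "'x list \<Rightarrow> 'x \<Rightarrow> 'm \<Rightarrow> 'n"
  FCell :: "'x list \<Rightarrow> 'x \<Rightarrow> 't \<Rightarrow> 'u"

text \<open>
  The conditions \<open>ob_ext\<close>, \<open>mor_ext\<close>, \<open>cell_ext\<close> fix the values outside the domains, so that
  equality in the type \<open>mfun\<close> is equality of multifunctors.
\<close>

locale multifunctor =
  fixes M :: "('x, 'm, 't) multicat" and N :: "('y, 'n, 'u) multicat"
    and F :: "('x, 'm, 't, 'y, 'n, 'u) mfun"
  assumes ob: "x \<in> MOb M \<Longrightarrow> FOb F x \<in> MOb N"
    and hom: "set as \<subseteq> MOb M \<Longrightarrow> b \<in> MOb M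
      \<Longrightarrow> cfunctor (MHom M as b) (MHom N (map (FOb F) as) (FOb F b)) (FMor F as b) (FCell F as b)"
    and unit: "x \<in> MOb M \<Longrightarrow> FMor F [x] x (MUnit M x) = MUnit N (FOb F x)"
    and act: "set as \<subseteq> MOb M \<Longrightarrow> b \<in> MOb M \<Longrightarrow> \<sigma> permutes {..<length as}
      \<Longrightarrow> f \<in> Obj (MHom M as b)
      \<Longrightarrow> FMor F (permute_list \<sigma> as) b (MAct M as b \<sigma> f)
            = MAct N (map (FOb F) as) (FOb F b) \<sigma> (FMor F as b f)"
    and act2: "set as \<subseteq> MOb M \<Longrightarrow> b \<in> MOb M \<Longrightarrow> \<sigma> permutes {..<length as}
      \<Longrightarrow> u \<in> Arr (MHom M as b)
      \<Longrightarrow> FCell F (permute_list \<sigma> as) b (MAct2 M as b \<sigma> u)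
            = MAct2 N (map (FOb F) as) (FOb F b) \<sigma> (FCell F as b u)"
    and comp: "set bs \<subseteq> MOb M \<Longrightarrow> c \<in> MOb M \<Longrightarrow> length ass = length bs \<Longrightarrow> length fs = length bs
      \<Longrightarrow> (\<And>j. j < length bs \<Longrightarrow> set (ass ! j) \<subseteq> MOb M \<and> fs ! j \<in> Obj (MHom M (ass ! j) (bs ! j)))
      \<Longrightarrow> g \<in> Obj (MHom M bs c)
      \<Longrightarrow> FMor F (concat ass) c (MComp M ass bs c g fs)
            = MComp N (map (map (FOb F)) ass) (map (FOb F) bs) (FOb F c) (FMor F bs c g)
                (map (\<lambda>j. FMor F (ass ! j) (bs ! j) (fs ! j)) [0..<length bs])"
    and comp2: "set bs \<subseteq> MOb M \<Longrightarrow> c \<in> MOb M \<Longrightarrow> length ass = length bs \<Longrightarrow> length us = length bs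
      \<Longrightarrow> (\<And>j. j < length bs \<Longrightarrow> set (ass ! j) \<subseteq> MOb M \<and> us ! j \<in> Arr (MHom M (ass ! j) (bs ! j)))
      \<Longrightarrow> v \<in> Arr (MHom M bs c)
      \<Longrightarrow> FCell F (concat ass) c (MComp2 M ass bs c v us)
            = MComp2 N (map (map (FOb F)) ass) (map (FOb F) bs) (FOb F c) (FCell F bs c v)
                (map (\<lambda>j. FCell F (ass ! j) (bs ! j) (us ! j)) [0..<length bs])"
    and ob_ext: "FOb F \<in> extensional (MOb M)"
    and mor_ext: "\<not> (set as \<subseteq> MOb M \<and> b \<in> MOb M \<and> f \<in> Obj (MHom M as b))
      \<Longrightarrow> FMor F as b f = undefined"
    and cell_ext: "\<not> (set as \<subseteq> MOb M \<and> b \<in> MOb M \<and> u \<in> Arr (MHom M as b))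
      \<Longrightarrow> FCell F as b u = undefined"

text \<open>\<open>mfun_comp L G F\<close> is the composite of \<open>F : L \<rightarrow> M\<close> and \<open>G : M \<rightarrow> N\<close>.\<close>

definition mfun_comp :: "('w, 'l, 's) multicat \<Rightarrow> ('x, 'm, 't, 'y, 'n, 'u) mfun
    \<Rightarrow> ('w, 'l, 's, 'x, 'm, 't) mfun \<Rightarrow> ('w, 'l, 's, 'y, 'n, 'u) mfun" where
  "mfun_comp L G F =
    \<lparr>FOb = (\<lambda>x \<in> MOb L. FOb G (FOb F x)),
     FMor = (\<lambda>as b f. if set as \<subseteq> MOb L \<and> b \<in> MOb L \<and> f \<in> Obj (MHom L as b)
               then FMor G (map (FOb F) as) (FOb F b) (FMor F as b f) else undefined),
     FCell = (\<lambda>as b u. if set as \<subseteq> MOb L \<and> b \<in> MOb L \<and> u \<in> Arr (MHom L as b)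
               then FCell G (map (FOb F) as) (FOb F b) (FCell F as b u) else undefined)\<rparr>"


section \<open>The multicategory of permutative categories\<close>

text \<open>
  \<open>kdist f i cs c'\<close> is the distributivity map \<open>\<delta>\<^sub>i : f(cs) \<oplus> f(cs[i := c']) \<rightarrow> f(cs[i := cs ! i \<oplus> c'])\<close>;
  thus the list \<open>cs\<close> supplies \<open>c\<^sub>i\<close> together with the suppressed variables.
\<close>

record ('o, 'a) klin =
  kob :: "'o list \<Rightarrow> 'o"
  kar :: "'a list \<Rightarrow> 'a"
  kdist :: "nat \<Rightarrow> 'o list \<Rightarrow> 'o \<Rightarrow> 'a"

locale klinear =
  fixes Cs :: "('o, 'a) permcat list" and D :: "('o, 'a) permcat" (structure)
    and f :: "('o, 'a) klin"
  assumes functorial: "cfunctor (prod_cat Cs) D (kob f) (kar f)"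
    and ob_zero: "cs \<in> Obj (prod_cat Cs) \<Longrightarrow> i < length Cs \<Longrightarrow> cs ! i = zero (Cs ! i)
      \<Longrightarrow> kob f cs = \<zero>"
    and dist_hom: "cs \<in> Obj (prod_cat Cs) \<Longrightarrow> i < length Cs \<Longrightarrow> c' \<in> Obj (Cs ! i)
      \<Longrightarrow> kdist f i cs c' \<in> hom D (kob f cs \<oplus> kob f (cs[i := c']))
                                (kob f (cs[i := osum (Cs ! i) (cs ! i) c']))"
    and dist_natural: "us \<in> hom (prod_cat Cs) cs es \<Longrightarrow> i < length Cs \<Longrightarrow> u' \<in> hom (Cs ! i) c' e'
      \<Longrightarrow> kar f (us[i := asum (Cs ! i) (us ! i) u']) \<cdot> kdist f i cs c'
            = kdist f i es e' \<cdot> (kar f us \<boxplus> kar f (us[i := u']))"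
    and dist_zero: "cs \<in> Obj (prod_cat Cs) \<Longrightarrow> i < length Cs \<Longrightarrow> c' \<in> Obj (Cs ! i)
      \<Longrightarrow> c' = zero (Cs ! i) \<or> (\<exists>j < length Cs. cs ! j = zero (Cs ! j))
      \<Longrightarrow> kdist f i cs c' = Idt D (kob f (cs[i := osum (Cs ! i) (cs ! i) c']))"
    and dist_sym: "cs \<in> Obj (prod_cat Cs) \<Longrightarrow> i < length Cs \<Longrightarrow> c' \<in> Obj (Cs ! i)
      \<Longrightarrow> kar f ((Idt (prod_cat Cs) cs)[i := sym (Cs ! i) (cs ! i) c']) \<cdot> kdist f i cs c'
            = kdist f i (cs[i := c']) (cs ! i) \<cdot> \<gamma> (kob f cs) (kob f (cs[i := c']))"
    and dist_assoc: "cs \<in> Obj (prod_cat Cs) \<Longrightarrow> i < length Cs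
      \<Longrightarrow> c' \<in> Obj (Cs ! i) \<Longrightarrow> c'' \<in> Obj (Cs ! i)
      \<Longrightarrow> kdist f i (cs[i := osum (Cs ! i) (cs ! i) c']) c''
              \<cdot> (kdist f i cs c' \<boxplus> Idt D (kob f (cs[i := c''])))
            = kdist f i cs (osum (Cs ! i) c' c'')
              \<cdot> (Idt D (kob f cs) \<boxplus> kdist f i (cs[i := c']) c'')"
    and dist_interchange: "cs \<in> Obj (prod_cat Cs) \<Longrightarrow> i < length Cs \<Longrightarrow> j < length Cs \<Longrightarrow> i \<noteq> j
      \<Longrightarrow> ci' \<in> Obj (Cs ! i) \<Longrightarrow> cj' \<in> Obj (Cs ! j)
      \<Longrightarrow> kdist f j (cs[i := osum (Cs ! i) (cs ! i) ci']) cj'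
              \<cdot> (kdist f i cs ci' \<boxplus> kdist f i (cs[j := cj']) ci')
            = kdist f i (cs[j := osum (Cs ! j) (cs ! j) cj']) ci'
              \<cdot> (kdist f j cs cj' \<boxplus> kdist f j (cs[i := ci']) cj')
              \<cdot> (Idt D (kob f cs) \<boxplus> \<gamma> (kob f (cs[i := ci'])) (kob f (cs[j := cj']))
                   \<boxplus> Idt D (kob f (cs[i := ci', j := cj'])))"
    and ob_ext: "kob f \<in> extensional (Obj (prod_cat Cs))"
    and ar_ext: "kar f \<in> extensional (Arr (prod_cat Cs))"
    and dist_ext: "\<not> (i < length Cs \<and> cs \<in> Obj (prod_cat Cs) \<and> c' \<in> Obj (Cs ! i))
      \<Longrightarrow> kdist f i cs c' = undefined"

locale klin_trans =
  fixes Cs :: "('o, 'a) permcat list" and D :: "('o, 'a) permcat" (structure)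
    and f g :: "('o, 'a) klin" and \<phi> :: "'o list \<Rightarrow> 'a"
  assumes source: "klinear Cs D f"
    and target: "klinear Cs D g"
    and component: "cs \<in> Obj (prod_cat Cs) \<Longrightarrow> \<phi> cs \<in> hom D (kob f cs) (kob g cs)"
    and natural: "us \<in> hom (prod_cat Cs) cs es \<Longrightarrow> \<phi> es \<cdot> kar f us = kar g us \<cdot> \<phi> cs"
    and dist: "cs \<in> Obj (prod_cat Cs) \<Longrightarrow> i < length Cs \<Longrightarrow> c' \<in> Obj (Cs ! i)
      \<Longrightarrow> \<phi> (cs[i := osum (Cs ! i) (cs ! i) c']) \<cdot> kdist f i cs c'
            = kdist g i cs c' \<cdot> (\<phi> cs \<boxplus> \<phi> (cs[i := c']))"
    and ext: "\<phi> \<in> extensional (Obj (prod_cat Cs))"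

type_synonym ('o, 'a) kcell = "('o, 'a) klin \<times> ('o, 'a) klin \<times> ('o list \<Rightarrow> 'a)"

definition klin_cat :: "('o, 'a) permcat list \<Rightarrow> ('o, 'a) permcat
    \<Rightarrow> (('o, 'a) klin, ('o, 'a) kcell) cat" where
  "klin_cat Cs D =
    \<lparr>Obj = {f. klinear Cs D f},
     Arr = {(f, g, \<phi>). klin_trans Cs D f g \<phi>},
     Dom = (\<lambda>(f, g, \<phi>). f), Cod = (\<lambda>(f, g, \<phi>). g),
     Idt = (\<lambda>f. (f, f, \<lambda>cs \<in> Obj (prod_cat Cs). Idt D (kob f cs))),
     Cmp = (\<lambda>(g, h, \<psi>) (f, g', \<phi>). (f, h, \<lambda>cs \<in> Obj (prod_cat Cs). Cmp D (\<psi> cs) (\<phi> cs)))\<rparr>"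

definition klin_id :: "('o, 'a) permcat \<Rightarrow> ('o, 'a) klin" where
  "klin_id C =
    \<lparr>kob = (\<lambda>cs \<in> Obj (prod_cat [C]). cs ! 0),
     kar = (\<lambda>us \<in> Arr (prod_cat [C]). us ! 0),
     kdist = (\<lambda>i cs c'. if i = 0 \<and> cs \<in> Obj (prod_cat [C]) \<and> c' \<in> Obj C
                then Idt C (osum C (cs ! 0) c') else undefined)\<rparr>"

text \<open>
  From \<open>(\<sigma>\<^sup>*f)(c\<^sub>\<sigma>\<^sub>(\<^sub>1\<^sub>),\<dots>,c\<^sub>\<sigma>\<^sub>(\<^sub>k\<^sub>)) = f(c\<^sub>1,\<dots>,c\<^sub>k)\<close>: the argument list of \<open>f\<close> is recovered by
  permuting with the inverse of \<open>\<sigma>\<close>, and variable \<open>i\<close> of \<open>\<sigma>\<^sup>*f\<close> is variable \<open>\<sigma>(i)\<close> of \<open>f\<close>.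
\<close>

definition klin_act :: "('o, 'a) permcat list \<Rightarrow> (nat \<Rightarrow> nat) \<Rightarrow> ('o, 'a) klin \<Rightarrow> ('o, 'a) klin" where
  "klin_act Cs \<sigma> f = (let Cs' = permute_list \<sigma> Cs in
    \<lparr>kob = (\<lambda>xs \<in> Obj (prod_cat Cs'). kob f (permute_list (inv \<sigma>) xs)),
     kar = (\<lambda>us \<in> Arr (prod_cat Cs'). kar f (permute_list (inv \<sigma>) us)),
     kdist = (\<lambda>i xs x'. if i < length Cs' \<and> xs \<in> Obj (prod_cat Cs') \<and> x' \<in> Obj (Cs' ! i)
                then kdist f (\<sigma> i) (permute_list (inv \<sigma>) xs) x' else undefined)\<rparr>)"

definition kcell_act :: "('o, 'a) permcat list \<Rightarrow> (nat \<Rightarrow> nat) \<Rightarrow> ('o, 'a) kcell \<Rightarrow> ('o, 'a) kcell" where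
  "kcell_act Cs \<sigma> = (\<lambda>(f, g, \<phi>). (klin_act Cs \<sigma> f, klin_act Cs \<sigma> g,
     \<lambda>xs \<in> Obj (prod_cat (permute_list \<sigma> Cs)). \<phi> (permute_list (inv \<sigma>) xs)))"

text \<open>
  \<open>blocks\<close> cuts a list into consecutive blocks of the given lengths; \<open>block_pos js m = (i, p)\<close>
  if \<open>m\<close> is position \<open>p\<close> of block \<open>i\<close>.
\<close>

fun blocks :: "nat list \<Rightarrow> 'b list \<Rightarrow> 'b list list" where
  "blocks [] xs = []"
| "blocks (j # js) xs = take j xs # blocks js (drop j xs)"

fun block_pos :: "nat list \<Rightarrow> nat \<Rightarrow> nat \<times> nat" where
  "block_pos [] m = (0, m)"
| "block_pos (j # js) m =
    (if m < j then (0, m) else (let (i, p) = block_pos js (m - j) in (Suc i, p)))"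

definition klin_comp :: "('o, 'a) permcat list list \<Rightarrow> ('o, 'a) permcat list \<Rightarrow> ('o, 'a) permcat
    \<Rightarrow> ('o, 'a) klin \<Rightarrow> ('o, 'a) klin list \<Rightarrow> ('o, 'a) klin" where
  "klin_comp Ass Bs C g fs =
    (let As = concat Ass; js = map length Ass; ap = (\<lambda>xs. map2 kob fs (blocks js xs)) in
    \<lparr>kob = (\<lambda>xs \<in> Obj (prod_cat As). kob g (ap xs)),
     kar = (\<lambda>us \<in> Arr (prod_cat As). kar g (map2 kar fs (blocks js us))),
     kdist = (\<lambda>m xs x'. if m < length As \<and> xs \<in> Obj (prod_cat As) \<and> x' \<in> Obj (As ! m)
                then (let (j, p) = block_pos js m in
                  Cmp C (kar g ((Idt (prod_cat Bs) (ap xs))[j := kdist (fs ! j) p (blocks js xs ! j) x']))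
                        (kdist g j (ap xs) (ap (xs[m := x']) ! j)))
                else undefined)\<rparr>)"

definition kcell_comp :: "('o, 'a) permcat list list \<Rightarrow> ('o, 'a) permcat list \<Rightarrow> ('o, 'a) permcat
    \<Rightarrow> ('o, 'a) kcell \<Rightarrow> ('o, 'a) kcell list \<Rightarrow> ('o, 'a) kcell" where
  "kcell_comp Ass Bs C = (\<lambda>(g, g', \<psi>) us.
    (let js = map length Ass; fs = map fst us; fs' = map (fst \<circ> snd) us; \<phi>s = map (snd \<circ> snd) us in
     (klin_comp Ass Bs C g fs, klin_comp Ass Bs C g' fs',
      \<lambda>xs \<in> Obj (prod_cat (concat Ass)).
        Cmp C (\<psi> (map2 kob fs' (blocks js xs)))
              (kar g (map2 (\<lambda>\<phi> ys. \<phi> ys) \<phi>s (blocks js xs))))))"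

definition Perm :: "(('o, 'a) permcat, ('o, 'a) klin, ('o, 'a) kcell) multicat" where
  "Perm =
    \<lparr>MOb = {C. permutative C},
     MHom = klin_cat,
     MUnit = klin_id,
     MAct = (\<lambda>Cs D. klin_act Cs),
     MAct2 = (\<lambda>Cs D. kcell_act Cs),
     MComp = klin_comp,
     MComp2 = kcell_comp\<rparr>"


section \<open>Pairings with distributivity maps\<close>

text \<open>
  Data of a functor \<open>\<otimes> : X \<times> Y \<rightarrow> Z\<close> (\<open>\<otimes>\<close> on objects, \<open>\<boxtimes>\<close> on arrows) with
    \<open>pdl t x x' y = d\<^sub>l(x,x';y) : (x \<otimes> y) \<oplus> (x' \<otimes> y) \<rightarrow> (x \<oplus> x') \<otimes> y\<close> and
    \<open>pdr t x y y' = d\<^sub>r(x;y,y') : (x \<otimes> y) \<oplus> (x \<otimes> y') \<rightarrow> x \<otimes> (y \<oplus> y')\<close>.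
\<close>

record ('o, 'a) pairing =
  pob :: "'o \<Rightarrow> 'o \<Rightarrow> 'o"  (infixl "\<otimes>\<index>" 70)
  par :: "'a \<Rightarrow> 'a \<Rightarrow> 'a"  (infixl "\<boxtimes>\<index>" 70)
  pdl :: "'o \<Rightarrow> 'o \<Rightarrow> 'o \<Rightarrow> 'a"
  pdr :: "'o \<Rightarrow> 'o \<Rightarrow> 'o \<Rightarrow> 'a"

text \<open>
  The conditions on a single pairing. \<open>dl_zero\<close> and \<open>dr_zero\<close> are the normalization that is part
  of the definition of \<open>k\<close>-linear maps: distributivity maps are identities when one of the
  objects is zero.
\<close>

locale distributive_pairing =
  fixes X Y Z :: "('o, 'a) permcat" and t :: "('o, 'a) pairing" (structure)
  assumes functorial: "cfunctor (pair_cat X Y) Z (\<lambda>(x, y). x \<otimes> y) (\<lambda>(f, g). f \<boxtimes> g)"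
    and zero_left: "y \<in> Obj Y \<Longrightarrow> zero X \<otimes> y = zero Z"
    and zero_right: "x \<in> Obj X \<Longrightarrow> x \<otimes> zero Y = zero Z"
    and dl_hom: "x \<in> Obj X \<Longrightarrow> x' \<in> Obj X \<Longrightarrow> y \<in> Obj Y
      \<Longrightarrow> pdl t x x' y \<in> hom Z ((x \<otimes> y) \<oplus>\<^bsub>Z\<^esub> (x' \<otimes> y)) ((x \<oplus>\<^bsub>X\<^esub> x') \<otimes> y)"
    and dr_hom: "x \<in> Obj X \<Longrightarrow> y \<in> Obj Y \<Longrightarrow> y' \<in> Obj Y
      \<Longrightarrow> pdr t x y y' \<in> hom Z ((x \<otimes> y) \<oplus>\<^bsub>Z\<^esub> (x \<otimes> y')) (x \<otimes> (y \<oplus>\<^bsub>Y\<^esub> y'))"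
    and dl_natural: "f \<in> hom X x w \<Longrightarrow> f' \<in> hom X x' w' \<Longrightarrow> g \<in> hom Y y z
      \<Longrightarrow> ((f \<boxplus>\<^bsub>X\<^esub> f') \<boxtimes> g) \<cdot>\<^bsub>Z\<^esub> pdl t x x' y = pdl t w w' z \<cdot>\<^bsub>Z\<^esub> ((f \<boxtimes> g) \<boxplus>\<^bsub>Z\<^esub> (f' \<boxtimes> g))"
    and dr_natural: "f \<in> hom X x w \<Longrightarrow> g \<in> hom Y y z \<Longrightarrow> g' \<in> hom Y y' z'
      \<Longrightarrow> (f \<boxtimes> (g \<boxplus>\<^bsub>Y\<^esub> g')) \<cdot>\<^bsub>Z\<^esub> pdr t x y y' = pdr t w z z' \<cdot>\<^bsub>Z\<^esub> ((f \<boxtimes> g) \<boxplus>\<^bsub>Z\<^esub> (f \<boxtimes> g'))"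
    and dl_zero: "x \<in> Obj X \<Longrightarrow> x' \<in> Obj X \<Longrightarrow> y \<in> Obj Y \<Longrightarrow> x = zero X \<or> x' = zero X \<or> y = zero Y
      \<Longrightarrow> pdl t x x' y = Idt Z ((x \<oplus>\<^bsub>X\<^esub> x') \<otimes> y)"
    and dr_zero: "x \<in> Obj X \<Longrightarrow> y \<in> Obj Y \<Longrightarrow> y' \<in> Obj Y \<Longrightarrow> x = zero X \<or> y = zero Y \<or> y' = zero Y
      \<Longrightarrow> pdr t x y y' = Idt Z (x \<otimes> (y \<oplus>\<^bsub>Y\<^esub> y'))"
    and dl_assoc: "x \<in> Obj X \<Longrightarrow> x' \<in> Obj X \<Longrightarrow> x'' \<in> Obj X \<Longrightarrow> y \<in> Obj Y
      \<Longrightarrow> pdl t (x \<oplus>\<^bsub>X\<^esub> x') x'' y \<cdot>\<^bsub>Z\<^esub> (pdl t x x' y \<boxplus>\<^bsub>Z\<^esub> Idt Z (x'' \<otimes> y))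
          = pdl t x (x' \<oplus>\<^bsub>X\<^esub> x'') y \<cdot>\<^bsub>Z\<^esub> (Idt Z (x \<otimes> y) \<boxplus>\<^bsub>Z\<^esub> pdl t x' x'' y)"
    and dr_assoc: "x \<in> Obj X \<Longrightarrow> y \<in> Obj Y \<Longrightarrow> y' \<in> Obj Y \<Longrightarrow> y'' \<in> Obj Y
      \<Longrightarrow> pdr t x (y \<oplus>\<^bsub>Y\<^esub> y') y'' \<cdot>\<^bsub>Z\<^esub> (pdr t x y y' \<boxplus>\<^bsub>Z\<^esub> Idt Z (x \<otimes> y''))
          = pdr t x y (y' \<oplus>\<^bsub>Y\<^esub> y'') \<cdot>\<^bsub>Z\<^esub> (Idt Z (x \<otimes> y) \<boxplus>\<^bsub>Z\<^esub> pdr t x y' y'')"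
    and dl_sym: "x \<in> Obj X \<Longrightarrow> x' \<in> Obj X \<Longrightarrow> y \<in> Obj Y
      \<Longrightarrow> (\<gamma>\<^bsub>X\<^esub> x x' \<boxtimes> Idt Y y) \<cdot>\<^bsub>Z\<^esub> pdl t x x' y = pdl t x' x y \<cdot>\<^bsub>Z\<^esub> \<gamma>\<^bsub>Z\<^esub> (x \<otimes> y) (x' \<otimes> y)"
    and dr_sym: "x \<in> Obj X \<Longrightarrow> y \<in> Obj Y \<Longrightarrow> y' \<in> Obj Y
      \<Longrightarrow> (Idt X x \<boxtimes> \<gamma>\<^bsub>Y\<^esub> y y') \<cdot>\<^bsub>Z\<^esub> pdr t x y y' = pdr t x y' y \<cdot>\<^bsub>Z\<^esub> \<gamma>\<^bsub>Z\<^esub> (x \<otimes> y) (x \<otimes> y')"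
    and interchange: "x \<in> Obj X \<Longrightarrow> x' \<in> Obj X \<Longrightarrow> y \<in> Obj Y \<Longrightarrow> y' \<in> Obj Y
      \<Longrightarrow> pdl t x x' (y \<oplus>\<^bsub>Y\<^esub> y') \<cdot>\<^bsub>Z\<^esub> (pdr t x y y' \<boxplus>\<^bsub>Z\<^esub> pdr t x' y y')
          = pdr t (x \<oplus>\<^bsub>X\<^esub> x') y y' \<cdot>\<^bsub>Z\<^esub> (pdl t x x' y \<boxplus>\<^bsub>Z\<^esub> pdl t x x' y')
              \<cdot>\<^bsub>Z\<^esub> (Idt Z (x \<otimes> y) \<boxplus>\<^bsub>Z\<^esub> \<gamma>\<^bsub>Z\<^esub> (x \<otimes> y') (x' \<otimes> y) \<boxplus>\<^bsub>Z\<^esub> Idt Z (x' \<otimes> y'))"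

text \<open>
  Compatibility of the two ways of forming a triple product \<open>X \<times> Y \<times> Z \<rightarrow> W\<close>, where
  \<open>p : X \<times> Y \<rightarrow> V\<close>, \<open>q : V \<times> Z \<rightarrow> W\<close> and \<open>r : Y \<times> Z \<rightarrow> U\<close>, \<open>s : X \<times> U \<rightarrow> W\<close>: strict
  associativity, and agreement of the distributivity maps in the first (\<open>dl_dl\<close>), third
  (\<open>dr_dr\<close>) and second (\<open>dr_dl\<close>) variable.
\<close>

locale associative_pairings =
  fixes X Y Z W :: "('o, 'a) permcat" and p q r s :: "('o, 'a) pairing"
  assumes ob_assoc: "x \<in> Obj X \<Longrightarrow> y \<in> Obj Y \<Longrightarrow> z \<in> Obj Z
      \<Longrightarrow> (x \<otimes>\<^bsub>p\<^esub> y) \<otimes>\<^bsub>q\<^esub> z = x \<otimes>\<^bsub>s\<^esub> (y \<otimes>\<^bsub>r\<^esub> z)"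
    and ar_assoc: "f \<in> Arr X \<Longrightarrow> g \<in> Arr Y \<Longrightarrow> h \<in> Arr Z
      \<Longrightarrow> (f \<boxtimes>\<^bsub>p\<^esub> g) \<boxtimes>\<^bsub>q\<^esub> h = f \<boxtimes>\<^bsub>s\<^esub> (g \<boxtimes>\<^bsub>r\<^esub> h)"
    and dl_dl: "x \<in> Obj X \<Longrightarrow> x' \<in> Obj X \<Longrightarrow> y \<in> Obj Y \<Longrightarrow> z \<in> Obj Z
      \<Longrightarrow> pdl s x x' (y \<otimes>\<^bsub>r\<^esub> z)
          = (pdl p x x' y \<boxtimes>\<^bsub>q\<^esub> Idt Z z) \<cdot>\<^bsub>W\<^esub> pdl q (x \<otimes>\<^bsub>p\<^esub> y) (x' \<otimes>\<^bsub>p\<^esub> y) z"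
    and dr_dr: "x \<in> Obj X \<Longrightarrow> y \<in> Obj Y \<Longrightarrow> z \<in> Obj Z \<Longrightarrow> z' \<in> Obj Z
      \<Longrightarrow> pdr q (x \<otimes>\<^bsub>p\<^esub> y) z z'
          = (Idt X x \<boxtimes>\<^bsub>s\<^esub> pdr r y z z') \<cdot>\<^bsub>W\<^esub> pdr s x (y \<otimes>\<^bsub>r\<^esub> z) (y \<otimes>\<^bsub>r\<^esub> z')"
    and dr_dl: "x \<in> Obj X \<Longrightarrow> y \<in> Obj Y \<Longrightarrow> y' \<in> Obj Y \<Longrightarrow> z \<in> Obj Z
      \<Longrightarrow> (pdr p x y y' \<boxtimes>\<^bsub>q\<^esub> Idt Z z) \<cdot>\<^bsub>W\<^esub> pdl q (x \<otimes>\<^bsub>p\<^esub> y) (x \<otimes>\<^bsub>p\<^esub> y') z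
          = (Idt X x \<boxtimes>\<^bsub>s\<^esub> pdl r y y' z) \<cdot>\<^bsub>W\<^esub> pdr s x (y \<otimes>\<^bsub>r\<^esub> z) (y' \<otimes>\<^bsub>r\<^esub> z)"

text \<open>
  Strict unitality includes that distributivity over the unit object is the identity. This is
  independent of the other conditions, and it is forced by the correspondence with multifunctors:
  \<open>x \<mapsto> x \<otimes> 1\<close> has to be the unit of the multicategory of permutative categories, whose
  distributivity map is the identity.
\<close>

locale left_unital =
  fixes X Y :: "('o, 'a) permcat" and t :: "('o, 'a) pairing" (structure) and e :: 'o
  assumes ob_unit: "y \<in> Obj Y \<Longrightarrow> e \<otimes> y = y"
    and ar_unit: "g \<in> Arr Y \<Longrightarrow> Idt X e \<boxtimes> g = g"
    and dr_unit: "y \<in> Obj Y \<Longrightarrow> y' \<in> Obj Y \<Longrightarrow> pdr t e y y' = Idt Y (y \<oplus>\<^bsub>Y\<^esub> y')"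

locale right_unital =
  fixes X Y :: "('o, 'a) permcat" and t :: "('o, 'a) pairing" (structure) and e :: 'o
  assumes ob_unit: "x \<in> Obj X \<Longrightarrow> x \<otimes> e = x"
    and ar_unit: "f \<in> Arr X \<Longrightarrow> f \<boxtimes> Idt Y e = f"
    and dl_unit: "x \<in> Obj X \<Longrightarrow> x' \<in> Obj X \<Longrightarrow> pdl t x x' e = Idt X (x \<oplus>\<^bsub>X\<^esub> x')"


section \<open>Associative categories and bimodules\<close>

record ('o, 'a) assoccat =
  perm :: "('o, 'a) permcat"
  tens :: "('o, 'a) pairing"
  unit :: 'o

locale associative_category =
  fixes A :: "('o, 'a) assoccat"
  assumes permutative: "permutative (perm A)"
    and tensor: "distributive_pairing (perm A) (perm A) (perm A) (tens A)"
    and associative: "associative_pairings (perm A) (perm A) (perm A) (perm A)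
                        (tens A) (tens A) (tens A) (tens A)"
    and unit_obj: "unit A \<in> Obj (perm A)"
    and left_unital: "left_unital (perm A) (perm A) (tens A) (unit A)"
    and right_unital: "right_unital (perm A) (perm A) (tens A) (unit A)"

locale left_module =
  fixes A :: "('o, 'a) assoccat" and D :: "('o, 'a) permcat" and l :: "('o, 'a) pairing"
  assumes left_action: "distributive_pairing (perm A) D D l"
    and left_associative: "associative_pairings (perm A) (perm A) D D (tens A) l l l"
    and left_unital: "left_unital (perm A) D l (unit A)"

locale right_module =
  fixes B :: "('o, 'a) assoccat" and D :: "('o, 'a) permcat" and r :: "('o, 'a) pairing"
  assumes right_action: "distributive_pairing D (perm B) D r"
    and right_associative: "associative_pairings D (perm B) (perm B) D r r (tens B) r"
    and right_unital: "right_unital D (perm B) r (unit B)"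

text \<open>
  The condition \<open>bi_associative\<close> contains, besides \<open>(a \<otimes> d) \<otimes> b = a \<otimes> (d \<otimes> b)\<close>, the compatibility of
  the distributivity maps in each of the three variables \<open>a\<close>, \<open>d\<close>, \<open>b\<close>. The parts for \<open>a\<close> and
  \<open>b\<close> do not follow from the one for \<open>d\<close>; all three hold for the 3-linear map
  \<open>(a, d, b) \<mapsto> a \<otimes> d \<otimes> b\<close> that belongs to a multifunctor. The interchange of \<open>d\<^sub>l\<close> and \<open>d\<^sub>r\<close> is part
  of both actions being distributive pairings.
\<close>

locale bimodule = left_module A D l + right_module B D r
  for A B :: "('o, 'a) assoccat" and D :: "('o, 'a) permcat" and l r :: "('o, 'a) pairing" +
  assumes bi_associative: "associative_pairings (perm A) D (perm B) D l r r l"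

definition pairing_ext :: "('o, 'a) permcat \<Rightarrow> ('o, 'a) permcat \<Rightarrow> ('o, 'a) pairing \<Rightarrow> bool" where
  "pairing_ext X Y t \<longleftrightarrow>
     (\<forall>x y. \<not> (x \<in> Obj X \<and> y \<in> Obj Y) \<longrightarrow> pob t x y = undefined) \<and>
     (\<forall>f g. \<not> (f \<in> Arr X \<and> g \<in> Arr Y) \<longrightarrow> par t f g = undefined) \<and>
     (\<forall>x x' y. \<not> (x \<in> Obj X \<and> x' \<in> Obj X \<and> y \<in> Obj Y) \<longrightarrow> pdl t x x' y = undefined) \<and>
     (\<forall>x y y'. \<not> (x \<in> Obj X \<and> y \<in> Obj Y \<and> y' \<in> Obj Y) \<longrightarrow> pdr t x y y' = undefined)"

definition bimodule_structures :: "('o, 'a) assoccat \<Rightarrow> ('o, 'a) assoccat \<Rightarrow> ('o, 'a) permcat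
    \<Rightarrow> (('o, 'a) pairing \<times> ('o, 'a) pairing) set" where
  "bimodule_structures A B D =
     {(l, r). bimodule A B D l r \<and> pairing_ext (perm A) D l \<and> pairing_ext D (perm B) r}"


section \<open>The operad of symmetric groups and its bimodule version\<close>

definition Sym_set :: "nat \<Rightarrow> (nat \<Rightarrow> nat) set" where
  "Sym_set k = {\<sigma>. \<sigma> permutes {..<k}}"

text \<open>
  \<open>perm_sum js \<phi>s\<close> is \<open>\<phi>\<^sub>1 \<amalg> \<dots> \<amalg> \<phi>\<^sub>k\<close>, and \<open>block_perm \<sigma> js\<close> is \<open>\<sigma>\<langle>j\<^sub>1,\<dots>,j\<^sub>k\<rangle>\<close>, which moves
  the \<open>i\<close>-th block to place \<open>\<sigma>(i)\<close>, behind all blocks \<open>i'\<close> with \<open>\<sigma>(i') < \<sigma>(i)\<close>.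
\<close>

definition perm_sum :: "nat list \<Rightarrow> (nat \<Rightarrow> nat) list \<Rightarrow> nat \<Rightarrow> nat" where
  "perm_sum js \<phi>s m = (if m < sum_list js
     then (let (i, p) = block_pos js m in sum_list (take i js) + (\<phi>s ! i) p) else m)"

definition block_perm :: "(nat \<Rightarrow> nat) \<Rightarrow> nat list \<Rightarrow> nat \<Rightarrow> nat" where
  "block_perm \<sigma> js m = (if m < sum_list js
     then (let (i, p) = block_pos js m in (\<Sum>i' | i' < length js \<and> \<sigma> i' < \<sigma> i. js ! i') + p) else m)"

definition Sym_comp :: "nat list \<Rightarrow> (nat \<Rightarrow> nat) \<Rightarrow> (nat \<Rightarrow> nat) list \<Rightarrow> nat \<Rightarrow> nat" where
  "Sym_comp js \<sigma> \<phi>s = block_perm \<sigma> js \<circ> perm_sum js \<phi>s"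

text \<open>
  A multicategory whose sets of \<open>k\<close>-morphisms are subsets of \<open>\<Sigma>\<^sub>k\<close>, regarded as discrete categories,
  with the operations of the operad \<open>\<Sigma>\<^sub>*\<close>.
\<close>

definition Sym_multicat :: "('x list \<Rightarrow> 'x \<Rightarrow> (nat \<Rightarrow> nat) set)
    \<Rightarrow> ('x, nat \<Rightarrow> nat, nat \<Rightarrow> nat) multicat" where
  "Sym_multicat H =
    \<lparr>MOb = UNIV,
     MHom = (\<lambda>as b. discrete_cat (H as b)),
     MUnit = (\<lambda>x. id),
     MAct = (\<lambda>as b \<tau> \<sigma>. \<sigma> \<circ> \<tau>),
     MAct2 = (\<lambda>as b \<tau> \<sigma>. \<sigma> \<circ> \<tau>),
     MComp = (\<lambda>ass bs c. Sym_comp (map length ass)),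
     MComp2 = (\<lambda>ass bs c. Sym_comp (map length ass))\<rparr>"

definition Sigma_op :: "(unit, nat \<Rightarrow> nat, nat \<Rightarrow> nat) multicat" where
  "Sigma_op = Sym_multicat (\<lambda>as b. Sym_set (length as))"

datatype bim_ob = ObA | ObB | ObM

definition bim_hom :: "bim_ob list \<Rightarrow> bim_ob \<Rightarrow> (nat \<Rightarrow> nat) set" where
  "bim_hom Cs c =
    (if (c = ObA \<or> c = ObB) \<and> set Cs \<subseteq> {c} then Sym_set (length Cs)
     else if c = ObM \<and> count_list Cs ObM = 1 then
       {\<sigma> \<in> Sym_set (length Cs). \<forall>i < length Cs. \<forall>j < length Cs.
          Cs ! j = ObM \<longrightarrow> (\<sigma> i < \<sigma> j \<longleftrightarrow> Cs ! i = ObA)}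
     else {})"

definition BSigma :: "(bim_ob, nat \<Rightarrow> nat, nat \<Rightarrow> nat) multicat" where
  "BSigma = Sym_multicat bim_hom"

lemma Sym_set_two: "Sym_set 2 = {id, Transposition.transpose 0 1}"
proof -
  have e: "{..<2::nat} = {0, 1}" by auto
  show ?thesis unfolding Sym_set_def e permutes_doubleton_iff by blast
qed

lemma all_two: "(\<forall>i<2::nat. P i) \<longleftrightarrow> P 0 \<and> P 1"
  using less_2_cases_iff by auto

lemma bim_hom_AM: "bim_hom [ObA, ObM] ObM = {id}"
proof -
  have l: "length [ObA, ObM] = 2" by simp
  have c: "count_list [ObA, ObM] ObM = 1" by simp
  have "bim_hom [ObA, ObM] ObM = {\<sigma> \<in> Sym_set 2. \<sigma> 0 < \<sigma> 1}"
    unfolding bim_hom_def l c all_two by auto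
  also have "\<dots> = {id}"
    unfolding Sym_set_two by (auto simp: transpose_def)
  finally show ?thesis .
qed

lemma bim_hom_MB: "bim_hom [ObM, ObB] ObM = {id}"
proof -
  have l: "length [ObM, ObB] = 2" by simp
  have c: "count_list [ObM, ObB] ObM = 1" by simp
  have "bim_hom [ObM, ObB] ObM = {\<sigma> \<in> Sym_set 2. \<not> \<sigma> 1 < \<sigma> 0}"
    unfolding bim_hom_def l c all_two by auto
  also have "\<dots> = {id}"
    unfolding Sym_set_two by (auto simp: transpose_def)
  finally show ?thesis .
qed

text \<open>The inclusion of \<open>\<Sigma>\<^sub>*\<close> at an object \<open>c\<close>, used for \<open>ObA\<close> and \<open>ObB\<close>.\<close>

definition Sigma_incl :: "bim_ob
    \<Rightarrow> (unit, nat \<Rightarrow> nat, nat \<Rightarrow> nat, bim_ob, nat \<Rightarrow> nat, nat \<Rightarrow> nat) mfun" where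
  "Sigma_incl c =
    \<lparr>FOb = (\<lambda>_. c),
     FMor = (\<lambda>as b. \<lambda>\<sigma> \<in> Sym_set (length as). \<sigma>),
     FCell = (\<lambda>as b. \<lambda>\<sigma> \<in> Sym_set (length as). \<sigma>)\<rparr>"


section \<open>The structure multifunctor of an associative category\<close>

text \<open>
  The list \<open>permute_list (inv \<sigma>) [a\<^sub>1,\<dots>,a\<^sub>k]\<close> is the word whose \<open>j\<close>-th letter is \<open>a\<close> with index
  \<open>\<sigma>\<^sup>-\<^sup>1(j)\<close>, so variable \<open>i\<close> occurs at position \<open>\<sigma>(i)\<close>. With \<open>x\<close> and \<open>y\<close> the products of the
  letters before and after it, the distributivity map is
    \<open>(x \<otimes> a \<otimes> y) \<oplus> (x \<otimes> a' \<otimes> y) \<rightarrow> ((x \<otimes> a) \<oplus> (x \<otimes> a')) \<otimes> y \<rightarrow> x \<otimes> (a \<oplus> a') \<otimes> y\<close>.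
\<close>

definition tens_obs :: "('o, 'a) assoccat \<Rightarrow> 'o list \<Rightarrow> 'o" where
  "tens_obs A xs = foldr (pob (tens A)) xs (unit A)"

definition tens_ars :: "('o, 'a) assoccat \<Rightarrow> 'a list \<Rightarrow> 'a" where
  "tens_ars A us = foldr (par (tens A)) us (Idt (perm A) (unit A))"

definition tens_klin :: "('o, 'a) assoccat \<Rightarrow> nat \<Rightarrow> (nat \<Rightarrow> nat) \<Rightarrow> ('o, 'a) klin" where
  "tens_klin A k \<sigma> = (let C = perm A; t = tens A; P = prod_cat (replicate k C) in
    \<lparr>kob = (\<lambda>as \<in> Obj P. tens_obs A (permute_list (inv \<sigma>) as)),
     kar = (\<lambda>us \<in> Arr P. tens_ars A (permute_list (inv \<sigma>) us)),
     kdist = (\<lambda>i as a'. if i < k \<and> as \<in> Obj P \<and> a' \<in> Obj C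
        then (let w = permute_list (inv \<sigma>) as; a = as ! i;
                  x = tens_obs A (take (\<sigma> i) w); y = tens_obs A (drop (Suc (\<sigma> i)) w)
              in (pdr t x a a' \<boxtimes>\<^bsub>t\<^esub> Idt C y) \<cdot>\<^bsub>C\<^esub> pdl t (x \<otimes>\<^bsub>t\<^esub> a) (x \<otimes>\<^bsub>t\<^esub> a') y)
        else undefined)\<rparr>)"

definition structure_mfun :: "('o, 'a) assoccat
    \<Rightarrow> (unit, nat \<Rightarrow> nat, nat \<Rightarrow> nat, ('o, 'a) permcat, ('o, 'a) klin, ('o, 'a) kcell) mfun" where
  "structure_mfun A =
    \<lparr>FOb = (\<lambda>_. perm A),
     FMor = (\<lambda>as b. \<lambda>\<sigma> \<in> Sym_set (length as). tens_klin A (length as) \<sigma>),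
     FCell = (\<lambda>as b. \<lambda>\<sigma> \<in> Sym_set (length as).
       Idt (klin_cat (replicate (length as) (perm A)) (perm A)) (tens_klin A (length as) \<sigma>))\<rparr>"


section \<open>From multifunctors to bimodule structures\<close>

definition pairing_of :: "('o, 'a) klin \<Rightarrow> ('o, 'a) pairing" where
  "pairing_of f =
    \<lparr>pob = (\<lambda>x y. kob f [x, y]), par = (\<lambda>u v. kar f [u, v]),
     pdl = (\<lambda>x x' y. kdist f 0 [x, y] x'), pdr = (\<lambda>x y y'. kdist f 1 [x, y] y')\<rparr>"

type_synonym ('o, 'a) bim_mfun =
  "(bim_ob, nat \<Rightarrow> nat, nat \<Rightarrow> nat, ('o, 'a) permcat, ('o, 'a) klin, ('o, 'a) kcell) mfun"

definition bimodule_mfuns :: "('o, 'a) assoccat \<Rightarrow> ('o, 'a) assoccat \<Rightarrow> ('o, 'a) permcat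
    \<Rightarrow> ('o, 'a) bim_mfun set" where
  "bimodule_mfuns A B D =
    {F. multifunctor BSigma Perm F \<and> FOb F ObM = D \<and>
        mfun_comp Sigma_op F (Sigma_incl ObA) = structure_mfun A \<and>
        mfun_comp Sigma_op F (Sigma_incl ObB) = structure_mfun B}"

definition bimodule_of_mfun :: "('o, 'a) bim_mfun \<Rightarrow> ('o, 'a) pairing \<times> ('o, 'a) pairing" where
  "bimodule_of_mfun F =
    (pairing_of (FMor F [ObA, ObM] ObM (the_elem (bim_hom [ObA, ObM] ObM))),
     pairing_of (FMor F [ObM, ObB] ObM (the_elem (bim_hom [ObM, ObB] ObM))))"

end

theory Submission
  imports Defs
begin

text \<open>
  Picture \<open>A\<close>, \<open>M\<close> and \<open>B\<close> as edges \<open>0 \<rightarrow> 0\<close>, \<open>0 \<rightarrow> 1\<close> and \<open>1 \<rightarrow> 1\<close> between two vertices. The condition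
  that defines \<open>\<^bold>B\<^sup>\<Sigma>\<^sup>*\<close> then says that a permutation \<open>\<sigma>\<close> is a multimorphism exactly if putting input
  \<open>i\<close> in place \<open>\<sigma>(i)\<close> turns the list of inputs into a path with the same ends as the output
  (\<open>bim_hom_eq_path_hom\<close>); the operad \<open>\<Sigma>\<^sub>*\<close> is the same construction for a single loop. On the
  other side, the data of two associative categories and a bimodule are permutative categories
  \<open>K u v\<close> for vertices \<open>u \<le> v\<close>, pairings \<open>K u v \<times> K v w \<rightarrow> K u w\<close> for \<open>u \<le> v \<le> w\<close>, and units in the
  \<open>K v v\<close>. All the associativity and distributivity conditions, for the two tensor products, for the
  two actions and between the actions, become the one condition that this composition is associative
  in a way compatible with \<open>d\<^sub>l\<close> and \<open>d\<^sub>r\<close>. This is the locale \<open>tensor_system\<close>, and treating \<open>A\<close>,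
  \<open>B\<close> and \<open>M\<close> uniformly in it removes all case distinctions from the construction.

  From a bimodule to a multifunctor: a path gives the iterated tensor product of its letters, a
  multilinear map whose distributivity maps are composed from \<open>d\<^sub>l\<close> and \<open>d\<^sub>r\<close> (\<open>multilinear_word\<close>), and
  \<open>\<sigma>\<close> is sent to this map with its variables permuted. That multiproducts are preserved means that
  a word substituted into a word is the concatenated word. On objects and arrows this is strict
  associativity; for the distributivity maps it is what \<open>dl_dl\<close>, \<open>dr_dr\<close> and \<open>dr_dl\<close> express
  (\<open>word_dist_append_left\<close>, \<open>word_dist_append_right\<close>, \<open>word_dist_concat\<close>). The multiproduct of
  \<open>\<Sigma>\<^sub>*\<close> is made so that the arguments are rearranged in the same way on both sides
  (\<open>permute_Sym_comp\<close>). The result is \<open>multifunctor_word_mfun\<close>.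

  From a multifunctor to a bimodule: the images of the single elements of \<open>\<^bold>B\<^sup>\<Sigma>\<^sup>*(A, M; M)\<close> and
  \<open>\<^bold>B\<^sup>\<Sigma>\<^sup>*(M, B; M)\<close> are bilinear maps, which are the same thing as distributive pairings. The words
  \<open>A A M\<close>, \<open>A M B\<close> and \<open>M B B\<close> can each be composed from shorter ones in two ways, and applying the
  multifunctor to the two decompositions yields associativity in all three variables
  (\<open>associative_pairings_of\<close>); the empty words of \<open>A\<close> and \<open>B\<close> yield the units.

  Finally, a multifunctor is determined by its bimodule: every multimorphism is a translate of the
  identity permutation of some path, and every path from \<open>0\<close> to \<open>1\<close> is composed from \<open>A M\<close>, \<open>M B\<close> and
  words in \<open>A\<close> or \<open>B\<close> alone, on which the multifunctor is prescribed (\<open>bimodule_of_mfun_inj\<close>).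
\<close>

section \<open>Typing rules\<close>

lemma hom_iff: "f \<in> hom C x y \<longleftrightarrow> f \<in> Arr C \<and> Dom C f = x \<and> Cod C f = y"
  by (simp add: hom_def)

lemma homI: "f \<in> Arr C \<Longrightarrow> Dom C f = x \<Longrightarrow> Cod C f = y \<Longrightarrow> f \<in> hom C x y"
  by (simp add: hom_def)

text \<open>
  The rules below speak of \<open>Arr\<close>, \<open>Dom\<close> and \<open>Cod\<close> rather than of hom-sets, so that the simplifier can
  check composability by computing domains and codomains; with hom-sets it would have to guess the
  intermediate objects.
\<close>

context category
begin

declare dom_closed [simp] cod_closed [simp]

lemma Idt_typing [simp]:
  "x \<in> Obj C \<Longrightarrow> Idt C x \<in> Arr C" "x \<in> Obj C \<Longrightarrow> Dom C (Idt C x) = x"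
  "x \<in> Obj C \<Longrightarrow> Cod C (Idt C x) = x"
  using id_hom by (auto simp: hom_iff)

lemma Cmp_typing [simp]:
  assumes "f \<in> Arr C" "g \<in> Arr C" "Cod C f = Dom C g"
  shows "g \<cdot> f \<in> Arr C" "Dom C (g \<cdot> f) = Dom C f" "Cod C (g \<cdot> f) = Cod C g"
  using cmp_hom[of f "Dom C f" "Cod C f" g "Cod C g"] assms by (auto simp: hom_iff)

lemma Cmp_Idt [simp]: "f \<in> Arr C \<Longrightarrow> Dom C f = x \<Longrightarrow> f \<cdot> Idt C x = f"
  using cmp_id[of f x "Cod C f"] by (auto simp: hom_iff)

lemma Idt_Cmp [simp]: "f \<in> Arr C \<Longrightarrow> Cod C f = x \<Longrightarrow> Idt C x \<cdot> f = f"
  using id_cmp[of f "Dom C f" x] by (auto simp: hom_iff)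

lemma Cmp_assoc [simp]:
  "f \<in> Arr C \<Longrightarrow> g \<in> Arr C \<Longrightarrow> h \<in> Arr C \<Longrightarrow> Cod C f = Dom C g \<Longrightarrow> Cod C g = Dom C h
    \<Longrightarrow> (h \<cdot> g) \<cdot> f = h \<cdot> (g \<cdot> f)"
  using cmp_assoc[of f "Dom C f" "Cod C f" g "Cod C g" h "Cod C h"] by (auto simp: hom_iff)

end

context permutative
begin

declare zero_obj [simp] osum_zero [simp] asum_zero [simp] osum_assoc [simp] asum_assoc [simp]

lemma osum_closed [simp]: "x \<in> Obj C \<Longrightarrow> y \<in> Obj C \<Longrightarrow> x \<oplus> y \<in> Obj C"
  using cfunctor.obj[OF sum_functor, of "(x, y)"] by (simp add: pair_cat_def)

lemma asum_typing [simp]: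
  assumes "f \<in> Arr C" "g \<in> Arr C"
  shows "f \<boxplus> g \<in> Arr C" "Dom C (f \<boxplus> g) = Dom C f \<oplus> Dom C g" "Cod C (f \<boxplus> g) = Cod C f \<oplus> Cod C g"
  using cfunctor.arr[OF sum_functor, of "(f, g)"] assms by (auto simp: pair_cat_def hom_iff)

lemma asum_Idt [simp]: "x \<in> Obj C \<Longrightarrow> y \<in> Obj C \<Longrightarrow> Idt C x \<boxplus> Idt C y = Idt C (x \<oplus> y)"
  using cfunctor.ident[OF sum_functor, of "(x, y)"] by (simp add: pair_cat_def)

lemma asum_Cmp:
  assumes "f \<in> Arr C" "g \<in> Arr C" "Cod C f = Dom C g" "f' \<in> Arr C" "g' \<in> Arr C" "Cod C f' = Dom C g'"
  shows "(g \<boxplus> g') \<cdot> (f \<boxplus> f') = (g \<cdot> f) \<boxplus> (g' \<cdot> f')"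
  using cfunctor.comp[OF sum_functor, of "(f, f')" "(g, g')"] assms by (simp add: pair_cat_def)

lemma sym_typing [simp]:
  assumes "x \<in> Obj C" "y \<in> Obj C"
  shows "\<gamma> x y \<in> Arr C" "Dom C (\<gamma> x y) = x \<oplus> y" "Cod C (\<gamma> x y) = y \<oplus> x"
  using sym_hom[OF assms] by (auto simp: hom_iff)

text \<open>The map \<open>1 \<oplus> \<gamma> \<oplus> 1\<close> of the interchange law.\<close>

definition mid :: "'o \<Rightarrow> 'o \<Rightarrow> 'o \<Rightarrow> 'o \<Rightarrow> 'a" where
  "mid x y z w = Idt C x \<boxplus> \<gamma> y z \<boxplus> Idt C w"

lemma mid_typing [simp]:
  assumes "x \<in> Obj C" "y \<in> Obj C" "z \<in> Obj C" "w \<in> Obj C"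
  shows "mid x y z w \<in> Arr C" "Dom C (mid x y z w) = x \<oplus> (y \<oplus> (z \<oplus> w))"
    "Cod C (mid x y z w) = x \<oplus> (z \<oplus> (y \<oplus> w))"
  using assms by (simp_all add: mid_def)

lemma mid_mid [simp]:
  assumes "x \<in> Obj C" "y \<in> Obj C" "z \<in> Obj C" "w \<in> Obj C"
  shows "mid x z y w \<cdot> mid x y z w = Idt C (x \<oplus> (y \<oplus> (z \<oplus> w)))"
  using assms by (simp add: mid_def asum_Cmp sym_sym)

end

locale pairing_functor = distributive_pairing X Y Z t + X: permutative X + Y: permutative Y +
    Z: permutative Z
  for X Y Z :: "('o, 'a) permcat" and t :: "('o, 'a) pairing" (structure)
begin

abbreviation cmpZ :: "'a \<Rightarrow> 'a \<Rightarrow> 'a" (infixl "\<bullet>" 55) where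
  "g \<bullet> f \<equiv> g \<cdot>\<^bsub>Z\<^esub> f"

abbreviation sumZ :: "'a \<Rightarrow> 'a \<Rightarrow> 'a" (infixl "\<uplus>" 65) where
  "f \<uplus> g \<equiv> f \<boxplus>\<^bsub>Z\<^esub> g"

lemma pob_closed [simp]: "x \<in> Obj X \<Longrightarrow> y \<in> Obj Y \<Longrightarrow> x \<otimes> y \<in> Obj Z"
  using cfunctor.obj[OF functorial, of "(x, y)"] by (simp add: pair_cat_def)

lemma par_typing [simp]:
  assumes "f \<in> Arr X" "g \<in> Arr Y"
  shows "f \<boxtimes> g \<in> Arr Z" "Dom Z (f \<boxtimes> g) = Dom X f \<otimes> Dom Y g" "Cod Z (f \<boxtimes> g) = Cod X f \<otimes> Cod Y g"
  using cfunctor.arr[OF functorial, of "(f, g)"] assms by (auto simp: pair_cat_def hom_iff)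

lemma par_Idt [simp]: "x \<in> Obj X \<Longrightarrow> y \<in> Obj Y \<Longrightarrow> Idt X x \<boxtimes> Idt Y y = Idt Z (x \<otimes> y)"
  using cfunctor.ident[OF functorial, of "(x, y)"] by (simp add: pair_cat_def)

lemma par_Cmp:
  assumes "f \<in> Arr X" "g \<in> Arr X" "Cod X f = Dom X g" "f' \<in> Arr Y" "g' \<in> Arr Y" "Cod Y f' = Dom Y g'"
  shows "(g \<boxtimes> g') \<bullet> (f \<boxtimes> f') = (g \<cdot>\<^bsub>X\<^esub> f) \<boxtimes> (g' \<cdot>\<^bsub>Y\<^esub> f')"
  using cfunctor.comp[OF functorial, of "(f, f')" "(g, g')"] assms by (simp add: pair_cat_def)

lemma par_Cmp_right:
  assumes "x \<in> Obj X" "f \<in> Arr Y" "g \<in> Arr Y" "Cod Y f = Dom Y g"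
  shows "Idt X x \<boxtimes> (g \<cdot>\<^bsub>Y\<^esub> f) = (Idt X x \<boxtimes> g) \<bullet> (Idt X x \<boxtimes> f)"
  using assms by (simp add: par_Cmp)

lemma par_Cmp_left:
  assumes "y \<in> Obj Y" "f \<in> Arr X" "g \<in> Arr X" "Cod X f = Dom X g"
  shows "(g \<cdot>\<^bsub>X\<^esub> f) \<boxtimes> Idt Y y = (g \<boxtimes> Idt Y y) \<bullet> (f \<boxtimes> Idt Y y)"
  using assms by (simp add: par_Cmp)

lemma pdl_typing [simp]:
  assumes "x \<in> Obj X" "x' \<in> Obj X" "y \<in> Obj Y"
  shows "pdl t x x' y \<in> Arr Z" "Dom Z (pdl t x x' y) = (x \<otimes> y) \<oplus>\<^bsub>Z\<^esub> (x' \<otimes> y)"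
    "Cod Z (pdl t x x' y) = (x \<oplus>\<^bsub>X\<^esub> x') \<otimes> y"
  using dl_hom[OF assms] by (auto simp: hom_iff)

lemma pdr_typing [simp]:
  assumes "x \<in> Obj X" "y \<in> Obj Y" "y' \<in> Obj Y"
  shows "pdr t x y y' \<in> Arr Z" "Dom Z (pdr t x y y') = (x \<otimes> y) \<oplus>\<^bsub>Z\<^esub> (x \<otimes> y')"
    "Cod Z (pdr t x y y') = x \<otimes> (y \<oplus>\<^bsub>Y\<^esub> y')"
  using dr_hom[OF assms] by (auto simp: hom_iff)

lemma pdl_natural:
  assumes "f \<in> Arr X" "f' \<in> Arr X" "g \<in> Arr Y"
    "Dom X f = x" "Dom X f' = x'" "Dom Y g = y"
  shows "((f \<boxplus>\<^bsub>X\<^esub> f') \<boxtimes> g) \<bullet> pdl t x x' y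
    = pdl t (Cod X f) (Cod X f') (Cod Y g) \<bullet> ((f \<boxtimes> g) \<uplus> (f' \<boxtimes> g))"
  using assms by (intro dl_natural homI) auto

lemma pdr_natural:
  assumes "f \<in> Arr X" "g \<in> Arr Y" "g' \<in> Arr Y"
    "Dom X f = x" "Dom Y g = y" "Dom Y g' = y'"
  shows "(f \<boxtimes> (g \<boxplus>\<^bsub>Y\<^esub> g')) \<bullet> pdr t x y y'
    = pdr t (Cod X f) (Cod Y g) (Cod Y g') \<bullet> ((f \<boxtimes> g) \<uplus> (f \<boxtimes> g'))"
  using assms by (intro dr_natural homI) auto

end

text \<open>
  The product of categories is given by lists. Rules for the empty list and for \<open>C # Cs\<close> serve the
  inductions over words, rules for positions serve the permutation of variables.
\<close>

lemma prod_cat_simps: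
  "xs \<in> Obj (prod_cat Cs) \<longleftrightarrow> list_all2 (\<lambda>C x. x \<in> Obj C) Cs xs"
  "us \<in> Arr (prod_cat Cs) \<longleftrightarrow> list_all2 (\<lambda>C u. u \<in> Arr C) Cs us"
  "Dom (prod_cat Cs) us = map2 Dom Cs us" "Cod (prod_cat Cs) us = map2 Cod Cs us"
  "Idt (prod_cat Cs) xs = map2 Idt Cs xs"
  "Cmp (prod_cat Cs) vs us = map2 (\<lambda>C (g, f). Cmp C g f) Cs (zip vs us)"
  by (simp_all add: prod_cat_def)

lemma prod_cat_Nil [simp]:
  "xs \<in> Obj (prod_cat []) \<longleftrightarrow> xs = []" "us \<in> Arr (prod_cat []) \<longleftrightarrow> us = []"
  "Dom (prod_cat []) us = []" "Cod (prod_cat []) us = []" "Idt (prod_cat []) xs = []"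
  "Cmp (prod_cat []) vs us = []"
  by (simp_all add: prod_cat_simps)

lemma prod_cat_Cons [simp]:
  "x # xs \<in> Obj (prod_cat (C # Cs)) \<longleftrightarrow> x \<in> Obj C \<and> xs \<in> Obj (prod_cat Cs)"
  "u # us \<in> Arr (prod_cat (C # Cs)) \<longleftrightarrow> u \<in> Arr C \<and> us \<in> Arr (prod_cat Cs)"
  "[] \<notin> Obj (prod_cat (C # Cs))" "[] \<notin> Arr (prod_cat (C # Cs))"
  "Dom (prod_cat (C # Cs)) (u # us) = Dom C u # Dom (prod_cat Cs) us"
  "Cod (prod_cat (C # Cs)) (u # us) = Cod C u # Cod (prod_cat Cs) us"
  "Idt (prod_cat (C # Cs)) (x # xs) = Idt C x # Idt (prod_cat Cs) xs"
  "Cmp (prod_cat (C # Cs)) (v # vs) (u # us) = Cmp C v u # Cmp (prod_cat Cs) vs us"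
  by (simp_all add: prod_cat_simps)

lemma prod_cat_ConsE:
  assumes "xs \<in> Obj (prod_cat (C # Cs))"
  obtains y ys where "xs = y # ys" "y \<in> Obj C" "ys \<in> Obj (prod_cat Cs)"
  using assms by (auto simp: prod_cat_simps list_all2_Cons1)

lemma prod_cat_Arr_ConsE:
  assumes "us \<in> Arr (prod_cat (C # Cs))"
  obtains v vs where "us = v # vs" "v \<in> Arr C" "vs \<in> Arr (prod_cat Cs)"
  using assms by (auto simp: prod_cat_simps list_all2_Cons1)

lemma prod_cat_length: "xs \<in> Obj (prod_cat Cs) \<Longrightarrow> length xs = length Cs"
  by (auto simp: prod_cat_simps dest: list_all2_lengthD)

lemma prod_cat_Arr_length: "us \<in> Arr (prod_cat Cs) \<Longrightarrow> length us = length Cs"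
  by (auto simp: prod_cat_simps dest: list_all2_lengthD)

lemma prod_cat_nth: "xs \<in> Obj (prod_cat Cs) \<Longrightarrow> i < length Cs \<Longrightarrow> xs ! i \<in> Obj (Cs ! i)"
  by (auto simp: prod_cat_simps list_all2_conv_all_nth)

lemma prod_cat_Arr_nth: "us \<in> Arr (prod_cat Cs) \<Longrightarrow> i < length Cs \<Longrightarrow> us ! i \<in> Arr (Cs ! i)"
  by (auto simp: prod_cat_simps list_all2_conv_all_nth)

lemma prod_cat_update [simp]:
  assumes "xs \<in> Obj (prod_cat Cs)" "i < length Cs \<Longrightarrow> x \<in> Obj (Cs ! i)"
  shows "xs[i := x] \<in> Obj (prod_cat Cs)"
  using assms by (cases "i < length Cs") (auto simp: prod_cat_simps list_all2_conv_all_nth nth_list_update)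

lemma prod_cat_Arr_update [simp]:
  assumes "us \<in> Arr (prod_cat Cs)" "i < length Cs \<Longrightarrow> u \<in> Arr (Cs ! i)"
  shows "us[i := u] \<in> Arr (prod_cat Cs)"
  using assms by (cases "i < length Cs") (auto simp: prod_cat_simps list_all2_conv_all_nth nth_list_update)

lemma prod_cat_Dom_update:
  "us \<in> Arr (prod_cat Cs) \<Longrightarrow> Dom (prod_cat Cs) (us[i := u]) = (Dom (prod_cat Cs) us)[i := Dom (Cs ! i) u]"
  "us \<in> Arr (prod_cat Cs) \<Longrightarrow> Cod (prod_cat Cs) (us[i := u]) = (Cod (prod_cat Cs) us)[i := Cod (Cs ! i) u]"
  by (cases "i < length Cs";
      auto simp: prod_cat_simps list_all2_conv_all_nth nth_list_update intro!: nth_equalityI)+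

lemma category_prod_cat:
  assumes "\<And>C. C \<in> set Cs \<Longrightarrow> category C"
  shows "category (prod_cat Cs)"
proof -
  have c: "category (Cs ! i)" if "i < length Cs" for i using assms that by simp
  note ty = category.dom_closed[OF c] category.cod_closed[OF c] category.Idt_typing[OF c]
    category.Cmp_typing[OF c] category.Cmp_Idt[OF c] category.Idt_Cmp[OF c]
  show ?thesis
  proof
    fix f assume "f \<in> Arr (prod_cat Cs)"
    then show "Dom (prod_cat Cs) f \<in> Obj (prod_cat Cs)" "Cod (prod_cat Cs) f \<in> Obj (prod_cat Cs)"
      by (auto simp: prod_cat_simps list_all2_conv_all_nth ty)
  next
    fix x assume "x \<in> Obj (prod_cat Cs)"
    then show "Idt (prod_cat Cs) x \<in> hom (prod_cat Cs) x x"
      by (auto simp: prod_cat_simps list_all2_conv_all_nth ty hom_iff intro!: nth_equalityI)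
  next
    fix f g x y z assume "f \<in> hom (prod_cat Cs) x y" "g \<in> hom (prod_cat Cs) y z"
    then have a: "f \<in> Arr (prod_cat Cs)" "g \<in> Arr (prod_cat Cs)" "map2 Cod Cs f = map2 Dom Cs g"
      "x = map2 Dom Cs f" "z = map2 Cod Cs g"
      by (auto simp: hom_iff prod_cat_simps)
    have "Cod (Cs ! i) (f ! i) = Dom (Cs ! i) (g ! i)" if "i < length Cs" for i
      using arg_cong[OF a(3), of "\<lambda>l. l ! i"] a(1,2) that
      by (auto simp: prod_cat_simps list_all2_conv_all_nth)
    with a show "Cmp (prod_cat Cs) g f \<in> hom (prod_cat Cs) x z"
      by (auto simp: prod_cat_simps list_all2_conv_all_nth ty hom_iff intro!: nth_equalityI)
  next
    fix f x y assume "f \<in> hom (prod_cat Cs) x y"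
    then show "Cmp (prod_cat Cs) f (Idt (prod_cat Cs) x) = f" "Cmp (prod_cat Cs) (Idt (prod_cat Cs) y) f = f"
      by (auto simp: prod_cat_simps list_all2_conv_all_nth ty hom_iff intro!: nth_equalityI)
  next
    fix f g h w x y z
    assume "f \<in> hom (prod_cat Cs) w x" "g \<in> hom (prod_cat Cs) x y" "h \<in> hom (prod_cat Cs) y z"
    then have a: "f \<in> Arr (prod_cat Cs)" "g \<in> Arr (prod_cat Cs)" "h \<in> Arr (prod_cat Cs)"
      "map2 Cod Cs f = map2 Dom Cs g" "map2 Cod Cs g = map2 Dom Cs h"
      by (auto simp: hom_iff prod_cat_simps)
    have "Cod (Cs ! i) (f ! i) = Dom (Cs ! i) (g ! i)" "Cod (Cs ! i) (g ! i) = Dom (Cs ! i) (h ! i)"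
      if "i < length Cs" for i
      using arg_cong[OF a(4), of "\<lambda>l. l ! i"] arg_cong[OF a(5), of "\<lambda>l. l ! i"] a(1-3) that
      by (auto simp: prod_cat_simps list_all2_conv_all_nth)
    with a(1-3) show "Cmp (prod_cat Cs) (Cmp (prod_cat Cs) h g) f
        = Cmp (prod_cat Cs) h (Cmp (prod_cat Cs) g f)"
      by (auto simp: prod_cat_simps list_all2_conv_all_nth category.Cmp_assoc[OF c] intro!: nth_equalityI)
  qed
qed

text \<open>A \<open>k\<close>-linear map together with the fact that all categories involved are permutative.\<close>

locale multilinear = klinear Cs D f + D: permutative D
  for Cs :: "('o, 'a) permcat list" and D :: "('o, 'a) permcat" and f :: "('o, 'a) klin" +
  assumes inputs: "C \<in> set Cs \<Longrightarrow> permutative C"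
begin

lemma permutative_nth: "i < length Cs \<Longrightarrow> permutative (Cs ! i)"
  by (simp add: inputs)

sublocale P: category "prod_cat Cs"
  using inputs by (intro category_prod_cat) (auto simp: permutative_def)

lemma kob_closed [simp]: "cs \<in> Obj (prod_cat Cs) \<Longrightarrow> kob f cs \<in> Obj D"
  using cfunctor.obj[OF functorial] .

lemma kar_typing [simp]:
  assumes "us \<in> Arr (prod_cat Cs)"
  shows "kar f us \<in> Arr D" "Dom D (kar f us) = kob f (Dom (prod_cat Cs) us)"
    "Cod D (kar f us) = kob f (Cod (prod_cat Cs) us)"
  using cfunctor.arr[OF functorial, OF assms] by (auto simp: hom_iff)

lemma kar_Idt [simp]: "cs \<in> Obj (prod_cat Cs) \<Longrightarrow> kar f (Idt (prod_cat Cs) cs) = Idt D (kob f cs)"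
  using cfunctor.ident[OF functorial] .

lemma kar_Cmp:
  assumes "us \<in> Arr (prod_cat Cs)" "vs \<in> Arr (prod_cat Cs)" "Cod (prod_cat Cs) us = Dom (prod_cat Cs) vs"
  shows "kar f (Cmp (prod_cat Cs) vs us) = Cmp D (kar f vs) (kar f us)"
  using cfunctor.comp[OF functorial] assms by simp

lemma osum_nth_closed [simp]:
  "i < length Cs \<Longrightarrow> x \<in> Obj (Cs ! i) \<Longrightarrow> y \<in> Obj (Cs ! i) \<Longrightarrow> osum (Cs ! i) x y \<in> Obj (Cs ! i)"
  using permutative.osum_closed[OF permutative_nth] by blast

lemma kdist_typing [simp]:
  assumes "cs \<in> Obj (prod_cat Cs)" "i < length Cs" "c' \<in> Obj (Cs ! i)"
  shows "kdist f i cs c' \<in> Arr D"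
    "Dom D (kdist f i cs c') = osum D (kob f cs) (kob f (cs[i := c']))"
    "Cod D (kdist f i cs c') = kob f (cs[i := osum (Cs ! i) (cs ! i) c'])"
  using dist_hom[OF assms] by (auto simp: hom_iff)

end

section \<open>Adjoining a tensor factor to a multilinear map\<close>

context pairing_functor
begin

text \<open>
  Associativity of \<open>d\<^sub>r\<close> allows the sum of four terms to be collected from the middle. This form
  isolates the two inner terms, which the symmetry of the interchange law exchanges.
\<close>

lemma pdr_fourfold:
  assumes "x \<in> Obj X" "P \<in> Obj Y" "Q \<in> Obj Y" "R \<in> Obj Y" "S \<in> Obj Y"
  shows "pdr t x (P \<oplus>\<^bsub>Y\<^esub> Q) (R \<oplus>\<^bsub>Y\<^esub> S) \<bullet> (pdr t x P Q \<uplus> pdr t x R S)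
    = pdr t x P (Q \<oplus>\<^bsub>Y\<^esub> (R \<oplus>\<^bsub>Y\<^esub> S)) \<bullet>
        (Idt Z (x \<otimes> P) \<uplus> (pdr t x (Q \<oplus>\<^bsub>Y\<^esub> R) S \<bullet> (pdr t x Q R \<uplus> Idt Z (x \<otimes> S))))"
    (is "?l = ?r")
proof -
  let ?id = "Idt Z" and ?RS = "pdr t x R S"
  have "pdr t x P Q \<uplus> ?RS = (pdr t x P Q \<uplus> ?id (x \<otimes> (R \<oplus>\<^bsub>Y\<^esub> S))) \<bullet>
      (?id (x \<otimes> P \<oplus>\<^bsub>Z\<^esub> x \<otimes> Q) \<uplus> ?RS)"
    using assms by (simp add: Z.asum_Cmp)
  then have "?l = (pdr t x (P \<oplus>\<^bsub>Y\<^esub> Q) (R \<oplus>\<^bsub>Y\<^esub> S) \<bullet>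
      (pdr t x P Q \<uplus> ?id (x \<otimes> (R \<oplus>\<^bsub>Y\<^esub> S)))) \<bullet> (?id (x \<otimes> P \<oplus>\<^bsub>Z\<^esub> x \<otimes> Q) \<uplus> ?RS)"
    using assms by simp
  also have "\<dots> = (pdr t x P (Q \<oplus>\<^bsub>Y\<^esub> (R \<oplus>\<^bsub>Y\<^esub> S)) \<bullet>
      (?id (x \<otimes> P) \<uplus> pdr t x Q (R \<oplus>\<^bsub>Y\<^esub> S))) \<bullet> (?id (x \<otimes> P) \<uplus> (?id (x \<otimes> Q) \<uplus> ?RS))"
    using assms by (subst dr_assoc) (simp_all flip: Z.asum_assoc)
  also have "\<dots> = pdr t x P (Q \<oplus>\<^bsub>Y\<^esub> (R \<oplus>\<^bsub>Y\<^esub> S)) \<bullet>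
      (?id (x \<otimes> P) \<uplus> (pdr t x Q (R \<oplus>\<^bsub>Y\<^esub> S) \<bullet> (?id (x \<otimes> Q) \<uplus> ?RS)))"
    using assms by (simp add: Z.asum_Cmp)
  also have "\<dots> = ?r"
    using assms by (simp flip: dr_assoc)
  finally show ?thesis .
qed

text \<open>
  The exchange of the two middle terms passes through \<open>d\<^sub>r\<close>: once they are collected first, the
  symmetry axiom of \<open>d\<^sub>r\<close> applies to them, and naturality takes care of the outer terms.
\<close>

lemma pdr_mid:
  assumes "x \<in> Obj X" "P \<in> Obj Y" "Q \<in> Obj Y" "R \<in> Obj Y" "S \<in> Obj Y"
  shows "(Idt X x \<boxtimes> Y.mid P Q R S) \<bullet>
      (pdr t x (P \<oplus>\<^bsub>Y\<^esub> Q) (R \<oplus>\<^bsub>Y\<^esub> S) \<bullet> (pdr t x P Q \<uplus> pdr t x R S))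
    = (pdr t x (P \<oplus>\<^bsub>Y\<^esub> R) (Q \<oplus>\<^bsub>Y\<^esub> S) \<bullet> (pdr t x P R \<uplus> pdr t x Q S))
        \<bullet> Z.mid (x \<otimes> P) (x \<otimes> Q) (x \<otimes> R) (x \<otimes> S)"
    (is "?l = ?r")
proof -
  let ?i = "Idt X x" and ?id = "Idt Z"
  let ?g = "\<gamma>\<^bsub>Y\<^esub> Q R" and ?gz = "\<gamma>\<^bsub>Z\<^esub> (x \<otimes> Q) (x \<otimes> R)"
  let ?in = "pdr t x (Q \<oplus>\<^bsub>Y\<^esub> R) S \<bullet> (pdr t x Q R \<uplus> ?id (x \<otimes> S))"
  let ?in' = "pdr t x (R \<oplus>\<^bsub>Y\<^esub> Q) S \<bullet> (pdr t x R Q \<uplus> ?id (x \<otimes> S))"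
  have "(?i \<boxtimes> (?g \<boxplus>\<^bsub>Y\<^esub> Idt Y S)) \<bullet> ?in
      = ((?i \<boxtimes> (?g \<boxplus>\<^bsub>Y\<^esub> Idt Y S)) \<bullet> pdr t x (Q \<oplus>\<^bsub>Y\<^esub> R) S) \<bullet> (pdr t x Q R \<uplus> ?id (x \<otimes> S))"
    using assms by simp
  also have "\<dots> = (pdr t x (R \<oplus>\<^bsub>Y\<^esub> Q) S \<bullet> ((?i \<boxtimes> ?g) \<uplus> ?id (x \<otimes> S))) \<bullet> (pdr t x Q R \<uplus> ?id (x \<otimes> S))"
    using assms by (subst pdr_natural) simp_all
  also have "\<dots> = pdr t x (R \<oplus>\<^bsub>Y\<^esub> Q) S \<bullet> (((?i \<boxtimes> ?g) \<bullet> pdr t x Q R) \<uplus> ?id (x \<otimes> S))"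
    using assms by (simp add: Z.asum_Cmp)
  also have "\<dots> = pdr t x (R \<oplus>\<^bsub>Y\<^esub> Q) S \<bullet> ((pdr t x R Q \<bullet> ?gz) \<uplus> ?id (x \<otimes> S))"
    using assms by (simp add: dr_sym)
  also have "\<dots> = ?in' \<bullet> (?gz \<uplus> ?id (x \<otimes> S))"
    using assms by (simp add: Z.asum_Cmp)
  finally have inner: "(?i \<boxtimes> (?g \<boxplus>\<^bsub>Y\<^esub> Idt Y S)) \<bullet> ?in = ?in' \<bullet> (?gz \<uplus> ?id (x \<otimes> S))" .
  have "?l = ((?i \<boxtimes> (Idt Y P \<boxplus>\<^bsub>Y\<^esub> (?g \<boxplus>\<^bsub>Y\<^esub> Idt Y S))) \<bullet> pdr t x P (Q \<oplus>\<^bsub>Y\<^esub> (R \<oplus>\<^bsub>Y\<^esub> S)))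
       \<bullet> (?id (x \<otimes> P) \<uplus> ?in)"
    using assms by (simp add: pdr_fourfold Y.mid_def)
  also have "\<dots> = (pdr t x P (R \<oplus>\<^bsub>Y\<^esub> (Q \<oplus>\<^bsub>Y\<^esub> S)) \<bullet> (?id (x \<otimes> P) \<uplus> (?i \<boxtimes> (?g \<boxplus>\<^bsub>Y\<^esub> Idt Y S))))
       \<bullet> (?id (x \<otimes> P) \<uplus> ?in)"
    using assms by (subst pdr_natural) simp_all
  also have "\<dots> = pdr t x P (R \<oplus>\<^bsub>Y\<^esub> (Q \<oplus>\<^bsub>Y\<^esub> S)) \<bullet> (?id (x \<otimes> P) \<uplus> ((?i \<boxtimes> (?g \<boxplus>\<^bsub>Y\<^esub> Idt Y S)) \<bullet> ?in))"
    using assms by (simp add: Z.asum_Cmp)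
  also have "\<dots> = pdr t x P (R \<oplus>\<^bsub>Y\<^esub> (Q \<oplus>\<^bsub>Y\<^esub> S)) \<bullet> (?id (x \<otimes> P) \<uplus> (?in' \<bullet> (?gz \<uplus> ?id (x \<otimes> S))))"
    unfolding inner ..
  also have "\<dots> = (pdr t x P (R \<oplus>\<^bsub>Y\<^esub> (Q \<oplus>\<^bsub>Y\<^esub> S)) \<bullet> (?id (x \<otimes> P) \<uplus> ?in'))
      \<bullet> (?id (x \<otimes> P) \<uplus> (?gz \<uplus> ?id (x \<otimes> S)))"
    using assms by (simp add: Z.asum_Cmp)
  also have "\<dots> = ?r"
    using assms by (simp add: pdr_fourfold Z.mid_def)
  finally show ?thesis .
qed

end

text \<open>
  The map \<open>(x, y\<^sub>1, \<dots>, y\<^sub>k) \<mapsto> x \<otimes> f(y\<^sub>1, \<dots>, y\<^sub>k)\<close>. Its distributivity maps are those of the multiproduct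
  of the bilinear map \<open>\<otimes>\<close> with the identity of \<open>X\<close> and \<open>f\<close>.
\<close>

definition klin_cons :: "('o, 'a) permcat \<Rightarrow> ('o, 'a) permcat list \<Rightarrow> ('o, 'a) permcat
    \<Rightarrow> ('o, 'a) pairing \<Rightarrow> ('o, 'a) klin \<Rightarrow> ('o, 'a) klin" where
  "klin_cons X Ys Z t f =
    \<lparr>kob = (\<lambda>cs \<in> Obj (prod_cat (X # Ys)). pob t (hd cs) (kob f (tl cs))),
     kar = (\<lambda>us \<in> Arr (prod_cat (X # Ys)). par t (hd us) (kar f (tl us))),
     kdist = (\<lambda>i cs c'. if i < length (X # Ys) \<and> cs \<in> Obj (prod_cat (X # Ys)) \<and> c' \<in> Obj ((X # Ys) ! i)
        then (case i of 0 \<Rightarrow> pdl t (hd cs) c' (kob f (tl cs))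
          | Suc j \<Rightarrow> Cmp Z (par t (Idt X (hd cs)) (kdist f j (tl cs) c'))
                           (pdr t (hd cs) (kob f (tl cs)) (kob f ((tl cs)[j := c']))))
        else undefined)\<rparr>"

lemma klin_cons_simps [simp]:
  "x \<in> Obj X \<Longrightarrow> ys \<in> Obj (prod_cat Ys) \<Longrightarrow> kob (klin_cons X Ys Z t f) (x # ys) = pob t x (kob f ys)"
  "u \<in> Arr X \<Longrightarrow> us \<in> Arr (prod_cat Ys) \<Longrightarrow> kar (klin_cons X Ys Z t f) (u # us) = par t u (kar f us)"
  "x \<in> Obj X \<Longrightarrow> ys \<in> Obj (prod_cat Ys) \<Longrightarrow> x' \<in> Obj X
    \<Longrightarrow> kdist (klin_cons X Ys Z t f) 0 (x # ys) x' = pdl t x x' (kob f ys)"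
  "x \<in> Obj X \<Longrightarrow> ys \<in> Obj (prod_cat Ys) \<Longrightarrow> i < length Ys \<Longrightarrow> y' \<in> Obj (Ys ! i)
    \<Longrightarrow> kdist (klin_cons X Ys Z t f) (Suc i) (x # ys) y'
      = Cmp Z (par t (Idt X x) (kdist f i ys y')) (pdr t x (kob f ys) (kob f (ys[i := y'])))"
  by (simp_all add: klin_cons_def)

text \<open>
  As \<open>1 \<oplus> \<gamma> \<oplus> 1\<close> is its own inverse up to exchanging the middle objects, the interchange law for a
  pair of variables in one order implies the law for the other order.
\<close>

lemma (in permutative) interchange_flip:
  assumes "\<beta> \<cdot> (\<alpha> \<boxplus> \<alpha>') = \<beta>' \<cdot> (\<delta> \<boxplus> \<delta>') \<cdot> mid p q r s"
    and "\<beta> \<in> Arr C" "\<alpha> \<in> Arr C" "\<alpha>' \<in> Arr C" "\<beta>' \<in> Arr C" "\<delta> \<in> Arr C" "\<delta>' \<in> Arr C"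
    and "p \<in> Obj C" "q \<in> Obj C" "r \<in> Obj C" "s \<in> Obj C"
    and "Dom C \<alpha> = p \<oplus> q" "Dom C \<alpha>' = r \<oplus> s" "Dom C \<delta> = p \<oplus> r" "Dom C \<delta>' = q \<oplus> s"
    and "Dom C \<beta> = Cod C \<alpha> \<oplus> Cod C \<alpha>'" "Dom C \<beta>' = Cod C \<delta> \<oplus> Cod C \<delta>'"
  shows "\<beta>' \<cdot> (\<delta> \<boxplus> \<delta>') = \<beta> \<cdot> (\<alpha> \<boxplus> \<alpha>') \<cdot> mid p r q s"
proof -
  have "\<beta> \<cdot> (\<alpha> \<boxplus> \<alpha>') \<cdot> mid p r q s = \<beta>' \<cdot> (\<delta> \<boxplus> \<delta>') \<cdot> mid p q r s \<cdot> mid p r q s"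
    using assms(1) by simp
  also have "\<dots> = \<beta>' \<cdot> (\<delta> \<boxplus> \<delta>')"
    using assms(2-) by simp
  finally show ?thesis ..
qed

text \<open>
  When \<open>x = 0\<close>, the distributivity maps of \<open>x \<otimes> f(ys)\<close> have to be identities, but the axioms only say
  that \<open>0 \<otimes> y = 0\<close> for objects; on an arrow \<open>v\<close>, the value \<open>id\<^sub>0 \<otimes> v\<close> is some endomorphism of \<open>0\<close>.
  Hence \<open>zero_dist\<close> is assumed here. For iterated tensor products it follows from the compatibility
  of the distributivity maps with associativity.
\<close>

locale cons_setup = pairing_functor X Y Z t + f: multilinear Ys Y f
  for X Y Z :: "('o, 'a) permcat" and t :: "('o, 'a) pairing" (structure)
    and Ys :: "('o, 'a) permcat list" and f :: "('o, 'a) klin" +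
  assumes zero_dist: "\<lbrakk>i < length Ys; ys \<in> Obj (prod_cat Ys); y' \<in> Obj (Ys ! i)\<rbrakk>
    \<Longrightarrow> Idt X (zero X) \<boxtimes> kdist f i ys y' = Idt Z (zero Z)"
begin

abbreviation "g \<equiv> klin_cons X Ys Z t f"

lemma cfunctor_cons: "cfunctor (prod_cat (X # Ys)) Z (kob g) (kar g)"
proof
  fix cs assume "cs \<in> Obj (prod_cat (X # Ys))"
  then obtain x ys where cs: "cs = x # ys" "x \<in> Obj X" "ys \<in> Obj (prod_cat Ys)"
    by (rule prod_cat_ConsE)
  then show "kob g cs \<in> Obj Z" "kar g (Idt (prod_cat (X # Ys)) cs) = Idt Z (kob g cs)"
    by simp_all
next
  fix us assume "us \<in> Arr (prod_cat (X # Ys))"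
  then obtain v vs where us: "us = v # vs" "v \<in> Arr X" "vs \<in> Arr (prod_cat Ys)"
    by (rule prod_cat_Arr_ConsE)
  then show "kar g us \<in> hom Z (kob g (Dom (prod_cat (X # Ys)) us)) (kob g (Cod (prod_cat (X # Ys)) us))"
    by (auto intro!: homI)
next
  fix us us' assume "us \<in> Arr (prod_cat (X # Ys))" "us' \<in> Arr (prod_cat (X # Ys))"
    and c: "Cod (prod_cat (X # Ys)) us = Dom (prod_cat (X # Ys)) us'"
  then obtain v vs v' vs' where us: "us = v # vs" "v \<in> Arr X" "vs \<in> Arr (prod_cat Ys)"
      "us' = v' # vs'" "v' \<in> Arr X" "vs' \<in> Arr (prod_cat Ys)"
    by (metis prod_cat_Arr_ConsE)
  with c show "kar g (Cmp (prod_cat (X # Ys)) us' us) = Cmp Z (kar g us') (kar g us)"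
    by (simp add: f.kar_Cmp par_Cmp)
qed

lemma dist_cons_typing:
  assumes "cs \<in> Obj (prod_cat (X # Ys))" "i < length (X # Ys)" "c' \<in> Obj ((X # Ys) ! i)"
  shows "kdist g i cs c' \<in> Arr Z \<and> Dom Z (kdist g i cs c') = osum Z (kob g cs) (kob g (cs[i := c']))
    \<and> Cod Z (kdist g i cs c') = kob g (cs[i := osum ((X # Ys) ! i) (cs ! i) c'])"
proof -
  obtain x ys where cs: "cs = x # ys" "x \<in> Obj X" "ys \<in> Obj (prod_cat Ys)"
    using assms(1) by (rule prod_cat_ConsE)
  with assms show ?thesis
    by (cases i) (auto simp: prod_cat_nth)
qed

lemma natural_cons:
  assumes "us \<in> hom (prod_cat (X # Ys)) cs es" "i < length (X # Ys)" "u' \<in> hom ((X # Ys) ! i) c' e'"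
  shows "Cmp Z (kar g (us[i := asum ((X # Ys) ! i) (us ! i) u'])) (kdist g i cs c')
    = Cmp Z (kdist g i es e') (asum Z (kar g us) (kar g (us[i := u'])))"
proof -
  obtain v vs where us: "us = v # vs" "v \<in> Arr X" "vs \<in> Arr (prod_cat Ys)"
    using assms(1) by (auto simp: hom_iff elim: prod_cat_Arr_ConsE)
  then have ce: "cs = Dom X v # Dom (prod_cat Ys) vs" "es = Cod X v # Cod (prod_cat Ys) vs"
    using assms(1) by (auto simp: hom_iff)
  show ?thesis
  proof (cases i)
    case 0
    with assms us ce show ?thesis
      by (auto simp: hom_iff pdl_natural)
  next
    case (Suc j)
    then have j: "j < length Ys" "u' \<in> Arr (Ys ! j)" "c' = Dom (Ys ! j) u'" "e' = Cod (Ys ! j) u'"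
      using assms by (auto simp: hom_iff)
    interpret Yj: permutative "Ys ! j" using j by (intro f.permutative_nth)
    define vs' where "vs' = vs[j := asum (Ys ! j) (vs ! j) u']"
    have vj: "vs ! j \<in> Arr (Ys ! j)" using us j by (simp add: prod_cat_Arr_nth)
    have l: "length vs = length Ys" using us by (simp add: prod_cat_Arr_length)
    have dv: "Dom (prod_cat Ys) vs ! j = Dom (Ys ! j) (vs ! j)" "Cod (prod_cat Ys) vs ! j = Cod (Ys ! j) (vs ! j)"
      using j l by (simp_all add: prod_cat_simps)
    have vs': "vs' \<in> Arr (prod_cat Ys)" using us j vj by (simp add: vs'_def)
    have dvs': "Dom (prod_cat Ys) vs' = (Dom (prod_cat Ys) vs)[j := Dom (Ys ! j) (vs ! j) \<oplus>\<^bsub>Ys ! j\<^esub> c']"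
       "Cod (prod_cat Ys) vs' = (Cod (prod_cat Ys) vs)[j := Cod (Ys ! j) (vs ! j) \<oplus>\<^bsub>Ys ! j\<^esub> e']"
      using us j vj by (simp_all add: vs'_def prod_cat_Dom_update)
    let ?cs = "Dom (prod_cat Ys) vs" and ?es = "Cod (prod_cat Ys) vs"
    have nat: "kar f vs' \<cdot>\<^bsub>Y\<^esub> kdist f j ?cs c' = kdist f j ?es e' \<cdot>\<^bsub>Y\<^esub> (kar f vs \<boxplus>\<^bsub>Y\<^esub> kar f (vs[j := u']))"
      unfolding vs'_def using us j by (intro f.dist_natural) (auto simp: hom_iff)
    \<comment> \<open>Naturality of the distributivity map of \<open>f\<close> under \<open>v \<otimes> -\<close>, then naturality of \<open>d\<^sub>r\<close>.\<close>
    have "Cmp Z (kar g (us[i := asum ((X # Ys) ! i) (us ! i) u'])) (kdist g i cs c')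
        = ((v \<boxtimes> kar f vs') \<bullet> (Idt X (Dom X v) \<boxtimes> kdist f j ?cs c'))
            \<bullet> pdr t (Dom X v) (kob f ?cs) (kob f (?cs[j := c']))"
      using us ce j vs' by (simp add: Suc dvs' dv vs'_def[symmetric])
    also have "\<dots> = ((v \<boxtimes> (kar f vs' \<cdot>\<^bsub>Y\<^esub> kdist f j ?cs c')))
            \<bullet> pdr t (Dom X v) (kob f ?cs) (kob f (?cs[j := c']))"
      using us ce j vs' by (subst par_Cmp) (simp_all add: dvs' dv)
    also have "\<dots> = ((Idt X (Cod X v) \<boxtimes> kdist f j ?es e') \<bullet> (v \<boxtimes> (kar f vs \<boxplus>\<^bsub>Y\<^esub> kar f (vs[j := u']))))
            \<bullet> pdr t (Dom X v) (kob f ?cs) (kob f (?cs[j := c']))"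
      unfolding nat using us ce j by (subst par_Cmp) (simp_all add: prod_cat_Dom_update)
    also have "\<dots> = (Idt X (Cod X v) \<boxtimes> kdist f j ?es e') \<bullet> ((v \<boxtimes> (kar f vs \<boxplus>\<^bsub>Y\<^esub> kar f (vs[j := u'])))
            \<bullet> pdr t (Dom X v) (kob f ?cs) (kob f (?cs[j := c'])))"
      using us ce j by (simp add: prod_cat_Dom_update)
    also have "\<dots> = (Idt X (Cod X v) \<boxtimes> kdist f j ?es e') \<bullet> (pdr t (Cod X v) (kob f ?es) (kob f (?es[j := e']))
          \<bullet> ((v \<boxtimes> kar f vs) \<uplus> (v \<boxtimes> kar f (vs[j := u']))))"
      using us ce j by (subst pdr_natural) (simp_all add: prod_cat_Dom_update)
    also have "\<dots> = Cmp Z (kdist g i es e') (asum Z (kar g us) (kar g (us[i := u'])))"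
      using us ce j by (simp add: Suc prod_cat_Dom_update)
    finally show ?thesis .
  qed
qed

lemma dist_cons_zero:
  assumes "cs \<in> Obj (prod_cat (X # Ys))" "i < length (X # Ys)" "c' \<in> Obj ((X # Ys) ! i)"
    and z: "c' = zero ((X # Ys) ! i) \<or> (\<exists>j < length (X # Ys). cs ! j = zero ((X # Ys) ! j))"
  shows "kdist g i cs c' = Idt Z (kob g (cs[i := osum ((X # Ys) ! i) (cs ! i) c']))"
proof -
  obtain x ys where cs: "cs = x # ys" "x \<in> Obj X" "ys \<in> Obj (prod_cat Ys)"
    using assms(1) by (rule prod_cat_ConsE)
  have z': "c' = zero ((X # Ys) ! i) \<or> x = zero X \<or> (\<exists>j < length Ys. ys ! j = zero (Ys ! j))"
    using z cs by (auto simp: nth_Cons split: nat.splits)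
  have fz: "kob f ys = zero Y" if "\<exists>j < length Ys. ys ! j = zero (Ys ! j)"
    using that f.ob_zero cs by blast
  show ?thesis
  proof (cases i)
    case 0
    then show ?thesis using assms(3) cs z' fz by (simp, intro dl_zero) auto
  next
    case (Suc k)
    then have k: "k < length Ys" "c' \<in> Obj (Ys ! k)" using assms by auto
    interpret Yk: permutative "Ys ! k" using k by (intro f.permutative_nth)
    have l: "length ys = length Ys" using cs by (simp add: prod_cat_length)
    show ?thesis
    proof (cases "x = zero X")
      case True
      with k cs show ?thesis
        by (simp add: Suc zero_dist dr_zero zero_left prod_cat_nth)
    next
      case False
      then have z'': "c' = zero (Ys ! k) \<or> (\<exists>j < length Ys. ys ! j = zero (Ys ! j))"
        using z' Suc by simp
      then have d: "kdist f k ys c' = Idt Y (kob f (ys[k := osum (Ys ! k) (ys ! k) c']))"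
        using k cs by (intro f.dist_zero)
      have "kob f ys = zero Y \<or> kob f (ys[k := c']) = zero Y"
        using z'' fz k cs l f.ob_zero[of "ys[k := c']" k] by auto
      then have p: "pdr t x (kob f ys) (kob f (ys[k := c'])) = Idt Z (x \<otimes> (kob f ys \<oplus>\<^bsub>Y\<^esub> kob f (ys[k := c'])))"
        using k cs by (intro dr_zero) auto
      \<comment> \<open>Here \<open>\<delta>\<close> is an identity, so its domain and its codomain coincide.\<close>
      have "kob f (ys[k := osum (Ys ! k) (ys ! k) c']) = kob f ys \<oplus>\<^bsub>Y\<^esub> kob f (ys[k := c'])"
        using f.kdist_typing(2)[of ys k c'] d k cs by (simp add: prod_cat_nth)
      with d p show ?thesis
        using k cs by (simp add: Suc prod_cat_nth)
    qed
  qed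
qed

lemma sym_cons:
  assumes "cs \<in> Obj (prod_cat (X # Ys))" "i < length (X # Ys)" "c' \<in> Obj ((X # Ys) ! i)"
  shows "Cmp Z (kar g ((Idt (prod_cat (X # Ys)) cs)[i := sym ((X # Ys) ! i) (cs ! i) c'])) (kdist g i cs c')
    = Cmp Z (kdist g i (cs[i := c']) (cs ! i)) (sym Z (kob g cs) (kob g (cs[i := c'])))"
proof -
  obtain x ys where cs: "cs = x # ys" "x \<in> Obj X" "ys \<in> Obj (prod_cat Ys)"
    using assms(1) by (rule prod_cat_ConsE)
  show ?thesis
  proof (cases i)
    case 0
    with assms(3) cs show ?thesis by (simp add: dl_sym)
  next
    case (Suc k)
    then have k: "k < length Ys" "c' \<in> Obj (Ys ! k)" using assms by auto
    interpret Yk: permutative "Ys ! k" using k by (intro f.permutative_nth)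
    have yk: "ys ! k \<in> Obj (Ys ! k)" using cs k by (simp add: prod_cat_nth)
    have l: "length ys = length Ys" using cs by (simp add: prod_cat_length)
    let ?s = "(Idt (prod_cat Ys) ys)[k := sym (Ys ! k) (ys ! k) c']"
    let ?F = "kob f ys" and ?F' = "kob f (ys[k := c'])"
    have s: "?s \<in> Arr (prod_cat Ys)" "Dom (prod_cat Ys) ?s = ys[k := ys ! k \<oplus>\<^bsub>Ys ! k\<^esub> c']"
      "Cod (prod_cat Ys) ?s = ys[k := c' \<oplus>\<^bsub>Ys ! k\<^esub> ys ! k]"
      using cs k yk by (simp_all add: prod_cat_Dom_update)
    have "Cmp Z (kar g ((Idt (prod_cat (X # Ys)) cs)[i := sym ((X # Ys) ! i) (cs ! i) c'])) (kdist g i cs c')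
      = ((Idt X x \<boxtimes> kar f ?s) \<bullet> (Idt X x \<boxtimes> kdist f k ys c')) \<bullet> pdr t x ?F ?F'"
      using cs k yk s by (simp add: Suc)
    also have "\<dots> = (Idt X x \<boxtimes> (kar f ?s \<cdot>\<^bsub>Y\<^esub> kdist f k ys c')) \<bullet> pdr t x ?F ?F'"
      using cs k yk s by (subst par_Cmp) simp_all
    also have "\<dots> = (Idt X x \<boxtimes> (kdist f k (ys[k := c']) (ys ! k) \<cdot>\<^bsub>Y\<^esub> \<gamma>\<^bsub>Y\<^esub> ?F ?F')) \<bullet> pdr t x ?F ?F'"
      using f.dist_sym[of ys k c'] cs k by simp
    also have "\<dots> = (Idt X x \<boxtimes> kdist f k (ys[k := c']) (ys ! k)) \<bullet> ((Idt X x \<boxtimes> \<gamma>\<^bsub>Y\<^esub> ?F ?F') \<bullet> pdr t x ?F ?F')"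
      using cs k yk l by (subst par_Cmp_right) simp_all
    also have "\<dots> = Cmp Z (kdist g i (cs[i := c']) (cs ! i)) (sym Z (kob g cs) (kob g (cs[i := c'])))"
      using cs k yk l by (simp add: Suc dr_sym)
    finally show ?thesis .
  qed
qed

lemma assoc_cons:
  assumes "cs \<in> Obj (prod_cat (X # Ys))" "i < length (X # Ys)"
    "c' \<in> Obj ((X # Ys) ! i)" "c'' \<in> Obj ((X # Ys) ! i)"
  shows "Cmp Z (kdist g i (cs[i := osum ((X # Ys) ! i) (cs ! i) c']) c'')
      (asum Z (kdist g i cs c') (Idt Z (kob g (cs[i := c'']))))
    = Cmp Z (kdist g i cs (osum ((X # Ys) ! i) c' c''))
      (asum Z (Idt Z (kob g cs)) (kdist g i (cs[i := c']) c''))"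
proof -
  obtain x ys where cs: "cs = x # ys" "x \<in> Obj X" "ys \<in> Obj (prod_cat Ys)"
    using assms(1) by (rule prod_cat_ConsE)
  show ?thesis
  proof (cases i)
    case 0
    with assms cs show ?thesis by (simp add: dl_assoc)
  next
    case (Suc k)
    then have k: "k < length Ys" "c' \<in> Obj (Ys ! k)" "c'' \<in> Obj (Ys ! k)" using assms by auto
    interpret Yk: permutative "Ys ! k" using k by (intro f.permutative_nth)
    have yk: "ys ! k \<in> Obj (Ys ! k)" using cs k by (simp add: prod_cat_nth)
    have l: "length ys = length Ys" using cs by (simp add: prod_cat_length)
    let ?F = "kob f ys" and ?F' = "kob f (ys[k := c'])" and ?F'' = "kob f (ys[k := c''])"
    let ?i = "Idt X x"
    let ?y1 = "ys[k := ys ! k \<oplus>\<^bsub>Ys ! k\<^esub> c']" and ?y2 = "ys[k := c' \<oplus>\<^bsub>Ys ! k\<^esub> c'']"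
    let ?d1 = "kdist f k ?y1 c''" and ?d2 = "kdist f k ys c'"
    let ?e1 = "kdist f k ys (c' \<oplus>\<^bsub>Ys ! k\<^esub> c'')" and ?e2 = "kdist f k (ys[k := c']) c''"
    have ax: "?d1 \<cdot>\<^bsub>Y\<^esub> (?d2 \<boxplus>\<^bsub>Y\<^esub> Idt Y ?F'') = ?e1 \<cdot>\<^bsub>Y\<^esub> (Idt Y ?F \<boxplus>\<^bsub>Y\<^esub> ?e2)"
      using f.dist_assoc[of ys k c' c''] cs k by simp
    have "Cmp Z (kdist g i (cs[i := osum ((X # Ys) ! i) (cs ! i) c']) c'')
      (asum Z (kdist g i cs c') (Idt Z (kob g (cs[i := c'']))))
      = ((?i \<boxtimes> ?d1) \<bullet> pdr t x (kob f ?y1) ?F'') \<bullet>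
          (((?i \<boxtimes> ?d2) \<uplus> (?i \<boxtimes> Idt Y ?F'')) \<bullet> (pdr t x ?F ?F' \<uplus> Idt Z (x \<otimes> ?F'')))"
      using cs k yk l by (simp add: Suc Z.asum_Cmp)
    also have "\<dots> = (?i \<boxtimes> ?d1) \<bullet> (pdr t x (kob f ?y1) ?F'' \<bullet> ((?i \<boxtimes> ?d2) \<uplus> (?i \<boxtimes> Idt Y ?F'')))
         \<bullet> (pdr t x ?F ?F' \<uplus> Idt Z (x \<otimes> ?F''))"
      using cs k yk l by simp
    also have "pdr t x (kob f ?y1) ?F'' \<bullet> ((?i \<boxtimes> ?d2) \<uplus> (?i \<boxtimes> Idt Y ?F''))
        = (?i \<boxtimes> (?d2 \<boxplus>\<^bsub>Y\<^esub> Idt Y ?F'')) \<bullet> pdr t x (?F \<oplus>\<^bsub>Y\<^esub> ?F') ?F''"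
      using cs k yk l by (subst pdr_natural) simp_all
    also have "(?i \<boxtimes> ?d1) \<bullet> \<dots> \<bullet> (pdr t x ?F ?F' \<uplus> Idt Z (x \<otimes> ?F''))
        = ((?i \<boxtimes> ?d1) \<bullet> (?i \<boxtimes> (?d2 \<boxplus>\<^bsub>Y\<^esub> Idt Y ?F''))) \<bullet>
           (pdr t x (?F \<oplus>\<^bsub>Y\<^esub> ?F') ?F'' \<bullet> (pdr t x ?F ?F' \<uplus> Idt Z (x \<otimes> ?F'')))"
      using cs k yk l by simp
    also have "\<dots> = ((?i \<boxtimes> ?e1) \<bullet> (?i \<boxtimes> (Idt Y ?F \<boxplus>\<^bsub>Y\<^esub> ?e2))) \<bullet>
           (pdr t x ?F (?F' \<oplus>\<^bsub>Y\<^esub> ?F'') \<bullet> (Idt Z (x \<otimes> ?F) \<uplus> pdr t x ?F' ?F''))"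
      using cs k yk l by (simp add: par_Cmp ax dr_assoc)
    also have "\<dots> = (?i \<boxtimes> ?e1) \<bullet> ((?i \<boxtimes> (Idt Y ?F \<boxplus>\<^bsub>Y\<^esub> ?e2)) \<bullet> pdr t x ?F (?F' \<oplus>\<^bsub>Y\<^esub> ?F''))
         \<bullet> (Idt Z (x \<otimes> ?F) \<uplus> pdr t x ?F' ?F'')"
      using cs k yk l by simp
    also have "(?i \<boxtimes> (Idt Y ?F \<boxplus>\<^bsub>Y\<^esub> ?e2)) \<bullet> pdr t x ?F (?F' \<oplus>\<^bsub>Y\<^esub> ?F'')
       = pdr t x ?F (kob f ?y2) \<bullet> ((?i \<boxtimes> Idt Y ?F) \<uplus> (?i \<boxtimes> ?e2))"
      using cs k yk l by (subst pdr_natural) simp_all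
    also have "(?i \<boxtimes> ?e1) \<bullet> \<dots> \<bullet> (Idt Z (x \<otimes> ?F) \<uplus> pdr t x ?F' ?F'')
       = (?i \<boxtimes> ?e1) \<bullet> pdr t x ?F (kob f ?y2) \<bullet>
          (((?i \<boxtimes> Idt Y ?F) \<uplus> (?i \<boxtimes> ?e2)) \<bullet> (Idt Z (x \<otimes> ?F) \<uplus> pdr t x ?F' ?F''))"
      using cs k yk l by simp
    also have "\<dots> = Cmp Z (kdist g i cs (osum ((X # Ys) ! i) c' c''))
      (asum Z (Idt Z (kob g cs)) (kdist g i (cs[i := c']) c''))"
      using cs k yk l by (simp add: Suc Z.asum_Cmp)
    finally show ?thesis .
  qed
qed

text \<open>
  One of the two variables is the new factor. Naturality of \<open>d\<^sub>l\<close> moves the distributivity map of \<open>f\<close>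
  to the left, and what remains is the interchange law of the pairing.
\<close>

lemma interchange_head:
  assumes "x \<in> Obj X" "ys \<in> Obj (prod_cat Ys)" "x' \<in> Obj X" "k < length Ys" "y' \<in> Obj (Ys ! k)"
  shows "Cmp Z (kdist g 0 (x # ys[k := osum (Ys ! k) (ys ! k) y']) x')
      (asum Z (kdist g (Suc k) (x # ys) y') (kdist g (Suc k) (x' # ys) y'))
    = kdist g (Suc k) ((x \<oplus>\<^bsub>X\<^esub> x') # ys) y' \<bullet>
        (kdist g 0 (x # ys) x' \<uplus> kdist g 0 (x # ys[k := y']) x')
        \<bullet> Z.mid (kob g (x # ys)) (kob g (x # ys[k := y'])) (kob g (x' # ys)) (kob g (x' # ys[k := y']))"
    (is "?l = ?r")
proof -
  interpret Yk: permutative "Ys ! k" using assms by (intro f.permutative_nth)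
  have yk: "ys ! k \<in> Obj (Ys ! k)" using assms by (simp add: prod_cat_nth)
  have l: "length ys = length Ys" using assms by (simp add: prod_cat_length)
  let ?F = "kob f ys" and ?F' = "kob f (ys[k := y'])" and ?d = "kdist f k ys y'"
  let ?G = "kob f (ys[k := osum (Ys ! k) (ys ! k) y'])"
  have "?l = pdl t x x' ?G \<bullet> (((Idt X x \<boxtimes> ?d) \<uplus> (Idt X x' \<boxtimes> ?d)) \<bullet> (pdr t x ?F ?F' \<uplus> pdr t x' ?F ?F'))"
    using assms yk l by (simp add: Z.asum_Cmp)
  also have "\<dots> = (pdl t x x' ?G \<bullet> ((Idt X x \<boxtimes> ?d) \<uplus> (Idt X x' \<boxtimes> ?d))) \<bullet> (pdr t x ?F ?F' \<uplus> pdr t x' ?F ?F')"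
    using assms yk l by simp
  also have "pdl t x x' ?G \<bullet> ((Idt X x \<boxtimes> ?d) \<uplus> (Idt X x' \<boxtimes> ?d))
      = ((Idt X x \<boxplus>\<^bsub>X\<^esub> Idt X x') \<boxtimes> ?d) \<bullet> pdl t x x' (?F \<oplus>\<^bsub>Y\<^esub> ?F')"
    using assms yk l by (subst pdl_natural) simp_all
  also have "\<dots> \<bullet> (pdr t x ?F ?F' \<uplus> pdr t x' ?F ?F')
     = (Idt X (x \<oplus>\<^bsub>X\<^esub> x') \<boxtimes> ?d) \<bullet> (pdl t x x' (?F \<oplus>\<^bsub>Y\<^esub> ?F') \<bullet> (pdr t x ?F ?F' \<uplus> pdr t x' ?F ?F'))"
    using assms yk l by simp
  also have "\<dots> = ?r"
    using assms yk l by (subst interchange) (simp_all flip: Z.mid_def)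
  finally show ?thesis .
qed

text \<open>
  Both variables belong to \<open>f\<close>: its interchange law holds under \<open>x \<otimes> -\<close>, and \<open>pdr_mid\<close> carries the
  symmetry occurring in it from \<open>Y\<close> to \<open>Z\<close>.
\<close>

lemma interchange_tail:
  assumes "x \<in> Obj X" "ys \<in> Obj (prod_cat Ys)" "i < length Ys" "a \<in> Obj (Ys ! i)"
    "j < length Ys" "b \<in> Obj (Ys ! j)" "i \<noteq> j"
  shows "Cmp Z (kdist g (Suc j) (x # ys[i := osum (Ys ! i) (ys ! i) a]) b)
      (asum Z (kdist g (Suc i) (x # ys) a) (kdist g (Suc i) (x # ys[j := b]) a))
    = kdist g (Suc i) (x # ys[j := osum (Ys ! j) (ys ! j) b]) a \<bullet>
        (kdist g (Suc j) (x # ys) b \<uplus> kdist g (Suc j) (x # ys[i := a]) b)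
        \<bullet> Z.mid (kob g (x # ys)) (kob g (x # ys[i := a])) (kob g (x # ys[j := b])) (kob g (x # ys[i := a, j := b]))"
    (is "?l = ?r")
proof -
  interpret Yi: permutative "Ys ! i" using assms by (intro f.permutative_nth)
  interpret Yj: permutative "Ys ! j" using assms by (intro f.permutative_nth)
  have yk: "ys ! i \<in> Obj (Ys ! i)" "ys ! j \<in> Obj (Ys ! j)" using assms by (simp_all add: prod_cat_nth)
  have l: "length ys = length Ys" using assms by (simp add: prod_cat_length)
  let ?yi = "ys[i := osum (Ys ! i) (ys ! i) a]" and ?yj = "ys[j := osum (Ys ! j) (ys ! j) b]"
  let ?i = "Idt X x"
  let ?P = "kob f ys" and ?Q = "kob f (ys[i := a])" and ?R = "kob f (ys[j := b])"
    and ?S = "kob f (ys[i := a, j := b])"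
  let ?d = "kdist f j ?yi b" and ?d1 = "kdist f i ys a" and ?d2 = "kdist f i (ys[j := b]) a"
  let ?e = "kdist f i ?yj a" and ?e1 = "kdist f j ys b" and ?e2 = "kdist f j (ys[i := a]) b"
  have sw: "ys[j := b, i := c] = ys[i := c, j := b]" "ys[i := a, j := c'] = ys[j := c', i := a]" for c c'
    using assms(7) by (simp_all add: list_update_swap)
  have nth: "ys[j := b] ! i = ys ! i" "ys[i := a] ! j = ys ! j" "?yi ! j = ys ! j" "?yj ! i = ys ! i"
    using assms(7) by simp_all
  note ty = assms yk l nth
  have ax: "?d \<cdot>\<^bsub>Y\<^esub> (?d1 \<boxplus>\<^bsub>Y\<^esub> ?d2) = ?e \<cdot>\<^bsub>Y\<^esub> (?e1 \<boxplus>\<^bsub>Y\<^esub> ?e2) \<cdot>\<^bsub>Y\<^esub> Y.mid ?P ?Q ?R ?S"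
    using f.dist_interchange[of ys i j a b] assms by (simp add: Y.mid_def)
  \<comment> \<open>Both sides of the interchange law have this shape; naturality collects the maps from \<open>f\<close> on the left.\<close>
  have step: "(?i \<boxtimes> d) \<bullet> pdr t x (Cod Y d1) (Cod Y d2) \<bullet>
       (((?i \<boxtimes> d1) \<bullet> pdr t x p q) \<uplus> ((?i \<boxtimes> d2) \<bullet> pdr t x r s))
     = (?i \<boxtimes> (d \<cdot>\<^bsub>Y\<^esub> (d1 \<boxplus>\<^bsub>Y\<^esub> d2))) \<bullet> (pdr t x (p \<oplus>\<^bsub>Y\<^esub> q) (r \<oplus>\<^bsub>Y\<^esub> s) \<bullet> (pdr t x p q \<uplus> pdr t x r s))"
    if "d \<in> Arr Y" "d1 \<in> Arr Y" "d2 \<in> Arr Y" "p \<in> Obj Y" "q \<in> Obj Y" "r \<in> Obj Y" "s \<in> Obj Y"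
      "Dom Y d1 = p \<oplus>\<^bsub>Y\<^esub> q" "Dom Y d2 = r \<oplus>\<^bsub>Y\<^esub> s" "Dom Y d = Cod Y d1 \<oplus>\<^bsub>Y\<^esub> Cod Y d2"
    for d d1 d2 p q r s
  proof -
    have "(?i \<boxtimes> d) \<bullet> pdr t x (Cod Y d1) (Cod Y d2) \<bullet>
       (((?i \<boxtimes> d1) \<bullet> pdr t x p q) \<uplus> ((?i \<boxtimes> d2) \<bullet> pdr t x r s))
      = (?i \<boxtimes> d) \<bullet> (pdr t x (Cod Y d1) (Cod Y d2) \<bullet> ((?i \<boxtimes> d1) \<uplus> (?i \<boxtimes> d2))) \<bullet> (pdr t x p q \<uplus> pdr t x r s)"
      using assms(1) that by (simp flip: Z.asum_Cmp)
    also have "pdr t x (Cod Y d1) (Cod Y d2) \<bullet> ((?i \<boxtimes> d1) \<uplus> (?i \<boxtimes> d2))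
       = (?i \<boxtimes> (d1 \<boxplus>\<^bsub>Y\<^esub> d2)) \<bullet> pdr t x (p \<oplus>\<^bsub>Y\<^esub> q) (r \<oplus>\<^bsub>Y\<^esub> s)"
      using assms(1) that by (subst pdr_natural) simp_all
    finally show ?thesis using assms(1) that by (simp add: par_Cmp_right)
  qed
  have "?l = (?i \<boxtimes> (?d \<cdot>\<^bsub>Y\<^esub> (?d1 \<boxplus>\<^bsub>Y\<^esub> ?d2))) \<bullet>
      (pdr t x (?P \<oplus>\<^bsub>Y\<^esub> ?Q) (?R \<oplus>\<^bsub>Y\<^esub> ?S) \<bullet> (pdr t x ?P ?Q \<uplus> pdr t x ?R ?S))"
    using step[of ?d ?d1 ?d2 ?P ?Q ?R ?S] ty by (simp add: sw(1))
  also have "\<dots> = ((?i \<boxtimes> (?e \<cdot>\<^bsub>Y\<^esub> (?e1 \<boxplus>\<^bsub>Y\<^esub> ?e2))) \<bullet> (?i \<boxtimes> Y.mid ?P ?Q ?R ?S)) \<bullet>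
      (pdr t x (?P \<oplus>\<^bsub>Y\<^esub> ?Q) (?R \<oplus>\<^bsub>Y\<^esub> ?S) \<bullet> (pdr t x ?P ?Q \<uplus> pdr t x ?R ?S))"
    unfolding ax using ty by (subst par_Cmp_right) (simp_all add: sw(2))
  also have "\<dots> = (?i \<boxtimes> (?e \<cdot>\<^bsub>Y\<^esub> (?e1 \<boxplus>\<^bsub>Y\<^esub> ?e2))) \<bullet> ((?i \<boxtimes> Y.mid ?P ?Q ?R ?S) \<bullet>
      (pdr t x (?P \<oplus>\<^bsub>Y\<^esub> ?Q) (?R \<oplus>\<^bsub>Y\<^esub> ?S) \<bullet> (pdr t x ?P ?Q \<uplus> pdr t x ?R ?S)))"
    using ty by (simp add: sw(2))
  also have "\<dots> = ((?i \<boxtimes> (?e \<cdot>\<^bsub>Y\<^esub> (?e1 \<boxplus>\<^bsub>Y\<^esub> ?e2))) \<bullet>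
      (pdr t x (?P \<oplus>\<^bsub>Y\<^esub> ?R) (?Q \<oplus>\<^bsub>Y\<^esub> ?S) \<bullet> (pdr t x ?P ?R \<uplus> pdr t x ?Q ?S)))
       \<bullet> Z.mid (x \<otimes> ?P) (x \<otimes> ?Q) (x \<otimes> ?R) (x \<otimes> ?S)"
    using ty by (subst pdr_mid) (simp_all add: sw(2))
  also have "\<dots> = ?r"
    using step[of ?e ?e1 ?e2 ?P ?R ?Q ?S] ty by (simp add: sw(2))
  finally show ?thesis .
qed

lemma interchange_cons:
  assumes "cs \<in> Obj (prod_cat (X # Ys))" "i < length (X # Ys)" "j < length (X # Ys)" "i \<noteq> j"
    "a \<in> Obj ((X # Ys) ! i)" "b \<in> Obj ((X # Ys) ! j)"
  shows "Cmp Z (kdist g j (cs[i := osum ((X # Ys) ! i) (cs ! i) a]) b)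
      (asum Z (kdist g i cs a) (kdist g i (cs[j := b]) a))
    = kdist g i (cs[j := osum ((X # Ys) ! j) (cs ! j) b]) a \<bullet>
        (kdist g j cs b \<uplus> kdist g j (cs[i := a]) b)
        \<bullet> Z.mid (kob g cs) (kob g (cs[i := a])) (kob g (cs[j := b])) (kob g (cs[i := a, j := b]))"
proof -
  obtain x ys where cs: "cs = x # ys" "x \<in> Obj X" "ys \<in> Obj (prod_cat Ys)"
    using assms(1) by (rule prod_cat_ConsE)
  consider k where "i = Suc k" "j = 0" | k where "i = 0" "j = Suc k" | k l where "i = Suc k" "j = Suc l"
    using assms(4) by (metis not0_implies_Suc)
  then show ?thesis
  proof cases
    case 1
    then show ?thesis using interchange_head[of x ys b k a] assms cs by simp
  next
    case 2
    have k: "k < length Ys" "b \<in> Obj (Ys ! k)" "a \<in> Obj X" using assms 2 by simp_all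
    interpret Yk: permutative "Ys ! k" using k by (intro f.permutative_nth)
    have yk: "ys ! k \<in> Obj (Ys ! k)" "length ys = length Ys"
      using cs k by (simp_all add: prod_cat_nth prod_cat_length)
    show ?thesis
      using Z.interchange_flip[OF interchange_head[of x ys a k b]] cs k yk by (simp add: 2)
  next
    case 3
    then show ?thesis using interchange_tail[of x ys k a l b] assms cs by simp
  qed
qed

lemma klinear_cons: "klinear (X # Ys) Z g"
proof (rule klinear.intro)
  show "cfunctor (prod_cat (X # Ys)) Z (kob g) (kar g)" by (rule cfunctor_cons)
next
  fix cs i assume cs: "cs \<in> Obj (prod_cat (X # Ys))" and i: "i < length (X # Ys)"
  show "kob g cs = zero Z" if "cs ! i = zero ((X # Ys) ! i)"
  proof -
    obtain x ys where "cs = x # ys" "x \<in> Obj X" "ys \<in> Obj (prod_cat Ys)"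
      using cs by (rule prod_cat_ConsE)
    with i that show ?thesis
      by (cases i) (simp_all add: zero_left zero_right f.ob_zero)
  qed
  fix c' assume c': "c' \<in> Obj ((X # Ys) ! i)"
  show "kdist g i cs c' \<in> hom Z (osum Z (kob g cs) (kob g (cs[i := c'])))
      (kob g (cs[i := osum ((X # Ys) ! i) (cs ! i) c']))"
    using dist_cons_typing[OF cs i c'] by (simp add: hom_iff)
next
  show "kob g \<in> extensional (Obj (prod_cat (X # Ys)))" "kar g \<in> extensional (Arr (prod_cat (X # Ys)))"
    by (simp_all add: klin_cons_def)
next
  show "kdist g i cs c' = undefined"
    if "\<not> (i < length (X # Ys) \<and> cs \<in> Obj (prod_cat (X # Ys)) \<and> c' \<in> Obj ((X # Ys) ! i))" for i cs c'
    unfolding klin_cons_def using that by (simp only: klin.simps if_False)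
qed (fact natural_cons dist_cons_zero sym_cons assoc_cons interchange_cons[unfolded Z.mid_def])+

end

section \<open>Permuting the variables of a multilinear map\<close>

lemma permute_list_inv_nth:
  assumes "\<sigma> permutes {..<length xs}" "i < length xs"
  shows "permute_list (inv \<sigma>) xs ! (\<sigma> i) = xs ! i"
proof -
  have "\<sigma> i < length xs" using assms permutes_in_image[OF assms(1), of i] by simp
  then show ?thesis
    using assms by (simp add: permute_list_nth permutes_inv permutes_inverses)
qed

lemma permute_list_update:
  assumes "\<sigma> permutes {..<length xs}" "i < length xs"
  shows "permute_list (inv \<sigma>) (xs[i := v]) = (permute_list (inv \<sigma>) xs)[\<sigma> i := v]"
proof (rule nth_equalityI)
  fix k assume "k < length (permute_list (inv \<sigma>) (xs[i := v]))"
  then have k: "k < length xs" by simp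
  have "inv \<sigma> k < length xs"
    using permutes_in_image[OF permutes_inv[OF assms(1)], of k] k by simp
  moreover have "inv \<sigma> k = i \<longleftrightarrow> k = \<sigma> i"
    using assms(1) by (metis permutes_inverses)
  ultimately show "permute_list (inv \<sigma>) (xs[i := v]) ! k = (permute_list (inv \<sigma>) xs)[\<sigma> i := v] ! k"
    using assms k by (auto simp: permute_list_nth permutes_inv nth_list_update)
qed simp

lemma list_all2_permute:
  assumes "list_all2 P as xs" "\<phi> permutes {..<length as}"
  shows "list_all2 P (permute_list \<phi> as) (permute_list \<phi> xs)"
  using assms permutes_in_image[OF assms(2)]
  by (simp add: list_all2_conv_all_nth permute_list_nth)

context
  fixes Cs :: "('o, 'a) permcat list" and \<sigma> :: "nat \<Rightarrow> nat"
  assumes \<sigma>: "\<sigma> permutes {..<length Cs}"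
begin

private lemma inv_less: "k < length Cs \<Longrightarrow> inv \<sigma> k < length Cs"
  using permutes_in_image[OF permutes_inv[OF \<sigma>], of k] by simp

private lemma less: "k < length Cs \<Longrightarrow> \<sigma> k < length Cs"
  using permutes_in_image[OF \<sigma>, of k] by simp

private lemma list_all2_permute_inv:
  assumes "list_all2 P (permute_list \<sigma> Cs) xs"
  shows "list_all2 P Cs (permute_list (inv \<sigma>) xs)"
  using list_all2_permute[OF assms, of "inv \<sigma>"] \<sigma>
  by (simp add: permutes_inv permutes_inv_o flip: permute_list_compose)

lemma permute_prod_cat_Obj:
  "xs \<in> Obj (prod_cat (permute_list \<sigma> Cs)) \<Longrightarrow> permute_list (inv \<sigma>) xs \<in> Obj (prod_cat Cs)"
  by (simp add: prod_cat_simps list_all2_permute_inv)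

lemma permute_prod_cat_Arr:
  "us \<in> Arr (prod_cat (permute_list \<sigma> Cs)) \<Longrightarrow> permute_list (inv \<sigma>) us \<in> Arr (prod_cat Cs)"
  by (simp add: prod_cat_simps list_all2_permute_inv)

lemma permute_map2:
  assumes "length us = length Cs"
  shows "permute_list (inv \<sigma>) (map2 h (permute_list \<sigma> Cs) us) = map2 h Cs (permute_list (inv \<sigma>) us)"
  using assms \<sigma> by (auto intro!: nth_equalityI simp: permute_list_nth permutes_inv inv_less permutes_inverses)

lemma permute_prod_cat_Dom:
  assumes "us \<in> Arr (prod_cat (permute_list \<sigma> Cs))"
  shows "Dom (prod_cat Cs) (permute_list (inv \<sigma>) us) = permute_list (inv \<sigma>) (Dom (prod_cat (permute_list \<sigma> Cs)) us)"
    "Cod (prod_cat Cs) (permute_list (inv \<sigma>) us) = permute_list (inv \<sigma>) (Cod (prod_cat (permute_list \<sigma> Cs)) us)"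
  using prod_cat_Arr_length[OF assms] by (simp_all add: prod_cat_simps permute_map2)

lemma permute_prod_cat_Idt:
  assumes "xs \<in> Obj (prod_cat (permute_list \<sigma> Cs))"
  shows "permute_list (inv \<sigma>) (Idt (prod_cat (permute_list \<sigma> Cs)) xs) = Idt (prod_cat Cs) (permute_list (inv \<sigma>) xs)"
  using prod_cat_length[OF assms] by (simp_all add: prod_cat_simps permute_map2)

lemma permute_prod_cat_Cmp:
  assumes "us \<in> Arr (prod_cat (permute_list \<sigma> Cs))" "vs \<in> Arr (prod_cat (permute_list \<sigma> Cs))"
  shows "permute_list (inv \<sigma>) (Cmp (prod_cat (permute_list \<sigma> Cs)) vs us)
    = Cmp (prod_cat Cs) (permute_list (inv \<sigma>) vs) (permute_list (inv \<sigma>) us)"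
proof -
  have "permute_list (inv \<sigma>) (zip vs us) = zip (permute_list (inv \<sigma>) vs) (permute_list (inv \<sigma>) us)"
    using assms[THEN prod_cat_Arr_length] \<sigma> by (intro permute_list_zip) (auto simp: permutes_inv)
  with permute_map2[of "zip vs us"] show ?thesis
    using assms[THEN prod_cat_Arr_length] by (simp add: prod_cat_simps)
qed

end

lemma klin_act_simps:
  "xs \<in> Obj (prod_cat (permute_list \<sigma> Cs)) \<Longrightarrow> kob (klin_act Cs \<sigma> f) xs = kob f (permute_list (inv \<sigma>) xs)"
  "us \<in> Arr (prod_cat (permute_list \<sigma> Cs)) \<Longrightarrow> kar (klin_act Cs \<sigma> f) us = kar f (permute_list (inv \<sigma>) us)"
  "i < length Cs \<Longrightarrow> xs \<in> Obj (prod_cat (permute_list \<sigma> Cs)) \<Longrightarrow> x' \<in> Obj (permute_list \<sigma> Cs ! i)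
    \<Longrightarrow> kdist (klin_act Cs \<sigma> f) i xs x' = kdist f (\<sigma> i) (permute_list (inv \<sigma>) xs) x'"
  by (simp_all add: klin_act_def Let_def)

text \<open>
  Each axiom of \<open>\<sigma>\<^sup>*f\<close> for variable \<open>i\<close> is the same axiom of \<open>f\<close> for variable \<open>\<sigma>(i)\<close>, since updating
  an argument list in place \<open>i\<close> and then permuting it updates the permuted list in place \<open>\<sigma>(i)\<close>.
\<close>

lemma klinear_act:
  assumes "multilinear Cs D f" "\<sigma> permutes {..<length Cs}"
  shows "klinear (permute_list \<sigma> Cs) D (klin_act Cs \<sigma> f)"
proof -
  interpret f: multilinear Cs D f by fact
  let ?Cs = "permute_list \<sigma> Cs" and ?g = "klin_act Cs \<sigma> f" and ?p = "permute_list (inv \<sigma>)"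
  note ob = permute_prod_cat_Obj[OF assms(2)] and ar = permute_prod_cat_Arr[OF assms(2)]
    and dom = permute_prod_cat_Dom[OF assms(2)]
  have less: "\<sigma> i < length Cs" if "i < length Cs" for i
    using permutes_in_image[OF assms(2), of i] that by simp
  have nthC: "?Cs ! i = Cs ! \<sigma> i" if "i < length Cs" for i
    using that assms(2) by (simp add: permute_list_nth)
  have nth: "?p xs ! \<sigma> i = xs ! i" if "i < length Cs" "length xs = length Cs" for i and xs :: "'z list"
    using that assms(2) by (simp add: permute_list_inv_nth)
  have upd: "?p (xs[i := v]) = (?p xs)[\<sigma> i := v]" if "i < length Cs" "length xs = length Cs"
    for i v and xs :: "'z list"
    using that assms(2) by (simp add: permute_list_update)
  have inO: "xs ! i \<in> Obj (Cs ! \<sigma> i)" if "xs \<in> Obj (prod_cat ?Cs)" "i < length Cs" for xs i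
    using prod_cat_nth[of xs ?Cs i] that nthC by simp
  have inA: "us ! i \<in> Arr (Cs ! \<sigma> i)" if "us \<in> Arr (prod_cat ?Cs)" "i < length Cs" for us i
    using prod_cat_Arr_nth[of us ?Cs i] that nthC by simp
  have len: "length xs = length Cs" if "xs \<in> Obj (prod_cat ?Cs)" for xs
    using prod_cat_length[OF that] by simp
  have lenA: "length xs = length Cs" if "xs \<in> Arr (prod_cat ?Cs)" for xs
    using prod_cat_Arr_length[OF that] by simp
  note simps = klin_act_simps ob ar less nthC nth upd inO inA dom len lenA
  note perm = f.permutative_nth[OF less]
  have P: "category (prod_cat ?Cs)"
    using f.inputs assms(2) by (intro category_prod_cat) (auto simp: permutative_def)
  show ?thesis
  proof (rule klinear.intro)
    show "cfunctor (prod_cat ?Cs) D (kob ?g) (kar ?g)"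
    proof
      fix xs assume "xs \<in> Obj (prod_cat ?Cs)"
      moreover from this have "Idt (prod_cat ?Cs) xs \<in> Arr (prod_cat ?Cs)"
        by (rule category.Idt_typing[OF P])
      ultimately show "kob ?g xs \<in> Obj D" "kar ?g (Idt (prod_cat ?Cs) xs) = Idt D (kob ?g xs)"
        by (simp_all add: simps permute_prod_cat_Idt[OF assms(2)])
    next
      {
        fix us assume us: "us \<in> Arr (prod_cat ?Cs)"
        then show "kar ?g us \<in> hom D (kob ?g (Dom (prod_cat ?Cs) us)) (kob ?g (Cod (prod_cat ?Cs) us))"
          using category.dom_closed[OF P us] category.cod_closed[OF P us]
          by (intro homI) (simp_all add: simps)
        fix vs assume vs: "vs \<in> Arr (prod_cat ?Cs)" "Cod (prod_cat ?Cs) us = Dom (prod_cat ?Cs) vs"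
        then show "kar ?g (Cmp (prod_cat ?Cs) vs us) = Cmp D (kar ?g vs) (kar ?g us)"
          using us category.Cmp_typing(1)[OF P us vs]
          by (simp add: simps permute_prod_cat_Cmp[OF assms(2)] f.kar_Cmp)
      }
    qed
  next
    fix cs i assume cs: "cs \<in> Obj (prod_cat ?Cs)" and "i < length ?Cs"
    then have i: "i < length Cs" by simp
    show "kob ?g cs = zero D" if "cs ! i = zero (?Cs ! i)"
      using cs i that f.ob_zero[of "?p cs" "\<sigma> i"] by (simp add: simps)
    have cat: "Idt (prod_cat ?Cs) cs \<in> Arr (prod_cat ?Cs)"
      using category.Idt_typing[OF P cs] by simp
    interpret Ci: permutative "Cs ! \<sigma> i" using i by (intro perm)
    fix c' assume "c' \<in> Obj (?Cs ! i)"
    then have c': "c' \<in> Obj (Cs ! \<sigma> i)" using i nthC by simp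
    show "kdist ?g i cs c' \<in> hom D (osum D (kob ?g cs) (kob ?g (cs[i := c'])))
        (kob ?g (cs[i := osum (?Cs ! i) (cs ! i) c']))"
      using f.dist_hom[of "?p cs" "\<sigma> i" c'] cs i c' by (simp add: simps)
    show "kdist ?g i cs c' = Idt D (kob ?g (cs[i := osum (?Cs ! i) (cs ! i) c']))"
      if z: "c' = zero (?Cs ! i) \<or> (\<exists>j < length ?Cs. cs ! j = zero (?Cs ! j))"
    proof -
      from z have "c' = zero (Cs ! \<sigma> i) \<or> (\<exists>j < length Cs. ?p cs ! j = zero (Cs ! j))"
      proof
        assume "\<exists>j < length ?Cs. cs ! j = zero (?Cs ! j)"
        then obtain j where "j < length Cs" "cs ! j = zero (?Cs ! j)" by auto
        then have "\<sigma> j < length Cs" "?p cs ! \<sigma> j = zero (Cs ! \<sigma> j)" using cs by (simp_all add: simps)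
        then show ?thesis by blast
      qed (use i nthC in simp)
      from f.dist_zero[OF ob[OF cs] less[OF i] c' this] show ?thesis
        using cs i c' by (simp add: simps)
    qed
    show "Cmp D (kar ?g ((Idt (prod_cat ?Cs) cs)[i := sym (?Cs ! i) (cs ! i) c'])) (kdist ?g i cs c')
        = Cmp D (kdist ?g i (cs[i := c']) (cs ! i)) (sym D (kob ?g cs) (kob ?g (cs[i := c'])))"
      using f.dist_sym[of "?p cs" "\<sigma> i" c'] cs i c' cat
      by (simp add: simps permute_prod_cat_Idt[OF assms(2)])
    {
      fix c'' assume "c'' \<in> Obj (?Cs ! i)"
      then have c'': "c'' \<in> Obj (Cs ! \<sigma> i)" using i nthC by simp
      show "Cmp D (kdist ?g i (cs[i := osum (?Cs ! i) (cs ! i) c']) c'')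
          (asum D (kdist ?g i cs c') (Idt D (kob ?g (cs[i := c'']))))
        = Cmp D (kdist ?g i cs (osum (?Cs ! i) c' c''))
          (asum D (Idt D (kob ?g cs)) (kdist ?g i (cs[i := c']) c''))"
        using f.dist_assoc[of "?p cs" "\<sigma> i" c' c''] cs i c' c'' by (simp add: simps)
    next
      fix j cj' assume "j < length ?Cs" "i \<noteq> j" "cj' \<in> Obj (?Cs ! j)"
      then have j: "j < length Cs" "\<sigma> i \<noteq> \<sigma> j" "cj' \<in> Obj (Cs ! \<sigma> j)" "i \<noteq> j"
        using nthC permutes_inj[OF assms(2)] by (auto dest: injD)
      interpret Cj: permutative "Cs ! \<sigma> j" using j by (intro perm)
      show "Cmp D (kdist ?g j (cs[i := osum (?Cs ! i) (cs ! i) c']) cj')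
          (asum D (kdist ?g i cs c') (kdist ?g i (cs[j := cj']) c'))
        = Cmp D (Cmp D (kdist ?g i (cs[j := osum (?Cs ! j) (cs ! j) cj']) c')
            (asum D (kdist ?g j cs cj') (kdist ?g j (cs[i := c']) cj')))
            (asum D (asum D (Idt D (kob ?g cs)) (sym D (kob ?g (cs[i := c'])) (kob ?g (cs[j := cj']))))
              (Idt D (kob ?g (cs[i := c', j := cj']))))"
        using f.dist_interchange[of "?p cs" "\<sigma> i" "\<sigma> j" c' cj'] cs i j c' by (simp add: simps)
    }
  next
    fix us cs es i u' c' e'
    assume us: "us \<in> hom (prod_cat ?Cs) cs es" and "i < length ?Cs" and u': "u' \<in> hom (?Cs ! i) c' e'"
    then have i: "i < length Cs" by simp
    interpret Ci: permutative "Cs ! \<sigma> i" using i by (intro perm)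
    have a: "us \<in> Arr (prod_cat ?Cs)" "cs = Dom (prod_cat ?Cs) us" "es = Cod (prod_cat ?Cs) us"
      "u' \<in> Arr (Cs ! \<sigma> i)" "c' = Dom (Cs ! \<sigma> i) u'" "e' = Cod (Cs ! \<sigma> i) u'"
      using us u' i nthC by (auto simp: hom_iff)
    have ce: "cs \<in> Obj (prod_cat ?Cs)" "es \<in> Obj (prod_cat ?Cs)" "c' \<in> Obj (Cs ! \<sigma> i)" "e' \<in> Obj (Cs ! \<sigma> i)"
      using category.dom_closed[OF P a(1)] category.cod_closed[OF P a(1)] a by simp_all
    have h: "?p us \<in> hom (prod_cat Cs) (?p cs) (?p es)" "u' \<in> hom (Cs ! \<sigma> i) c' e'"
      using a by (simp_all add: hom_iff simps)
    show "Cmp D (kar ?g (us[i := asum (?Cs ! i) (us ! i) u'])) (kdist ?g i cs c')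
        = Cmp D (kdist ?g i es e') (asum D (kar ?g us) (kar ?g (us[i := u'])))"
      using f.dist_natural[OF h(1) less[OF i] h(2)] i a(1,4) ce by (simp add: simps)
  next
    show "kob ?g \<in> extensional (Obj (prod_cat ?Cs))" "kar ?g \<in> extensional (Arr (prod_cat ?Cs))"
      by (simp_all add: klin_act_def Let_def)
  next
    show "kdist ?g i cs c' = undefined"
      if "\<not> (i < length ?Cs \<and> cs \<in> Obj (prod_cat ?Cs) \<and> c' \<in> Obj (?Cs ! i))" for i cs c'
      unfolding klin_act_def Let_def using that by (simp only: klin.simps if_False)
  qed
qed

lemma klin_eqI:
  fixes f g :: "('o, 'a) klin"
  assumes "\<And>xs. kob f xs = kob g xs" "\<And>us. kar f us = kar g us"
    "\<And>i xs x'. kdist f i xs x' = kdist g i xs x'"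
  shows "f = g"
  using assms by (intro klin.equality ext) auto

lemma permute_list_inv_compose:
  assumes "\<sigma> permutes {..<length xs}" "\<tau> permutes {..<length xs}"
  shows "permute_list (inv (\<sigma> \<circ> \<tau>)) xs = permute_list (inv \<sigma>) (permute_list (inv \<tau>) xs)"
  using assms by (simp add: o_inv_distrib permutes_bij permute_list_compose permutes_inv)

lemma klin_act_act:
  assumes "\<sigma> permutes {..<length Cs}" "\<tau> permutes {..<length Cs}"
  shows "klin_act (permute_list \<sigma> Cs) \<tau> (klin_act Cs \<sigma> f) = klin_act Cs (\<sigma> \<circ> \<tau>) f"
proof -
  let ?C1 = "permute_list \<sigma> Cs" and ?C2 = "permute_list (\<sigma> \<circ> \<tau>) Cs"
  have C2: "permute_list \<tau> ?C1 = ?C2" using assms by (simp add: permute_list_compose)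
  have \<tau>: "\<tau> permutes {..<length ?C1}" using assms by simp
  have in1: "permute_list (inv \<tau>) xs \<in> Obj (prod_cat ?C1)" if "xs \<in> Obj (prod_cat ?C2)" for xs
    using permute_prod_cat_Obj[OF \<tau>, of xs] that C2 by simp
  have in2: "permute_list (inv \<tau>) xs \<in> Arr (prod_cat ?C1)" if "xs \<in> Arr (prod_cat ?C2)" for xs
    using permute_prod_cat_Arr[OF \<tau>, of xs] that C2 by simp
  have inv: "permute_list (inv (\<sigma> \<circ> \<tau>)) xs = permute_list (inv \<sigma>) (permute_list (inv \<tau>) xs)"
    if "length xs = length Cs" for xs :: "'z list"
    using permute_list_inv_compose that assms by metis
  have \<tau>i: "\<tau> i < length Cs" if "i < length Cs" for i
    using permutes_in_image[OF assms(2), of i] that by simp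
  have nthC: "?C2 ! i = ?C1 ! \<tau> i" if "i < length Cs" for i
    using that assms \<tau> unfolding C2[symmetric] by (simp add: permute_list_nth)
  show ?thesis
  proof (rule klin_eqI)
    fix xs show "kob (klin_act ?C1 \<tau> (klin_act Cs \<sigma> f)) xs = kob (klin_act Cs (\<sigma> \<circ> \<tau>) f) xs"
      using in1[of xs] inv[of xs] prod_cat_length[of xs ?C2] by (auto simp: klin_act_def Let_def C2)
  next
    fix us show "kar (klin_act ?C1 \<tau> (klin_act Cs \<sigma> f)) us = kar (klin_act Cs (\<sigma> \<circ> \<tau>) f) us"
      using in2[of us] inv[of us] prod_cat_Arr_length[of us ?C2] by (auto simp: klin_act_def Let_def C2)
  next
    fix i xs x'
    show "kdist (klin_act ?C1 \<tau> (klin_act Cs \<sigma> f)) i xs x' = kdist (klin_act Cs (\<sigma> \<circ> \<tau>) f) i xs x'"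
      using in1[of xs] inv[of xs] prod_cat_length[of xs ?C2] \<tau>i nthC by (auto simp: klin_act_def Let_def C2)
  qed
qed

section \<open>Iterated tensor products along paths\<close>

definition klin_point :: "('o, 'a) permcat \<Rightarrow> 'o \<Rightarrow> ('o, 'a) klin" where
  "klin_point C e = \<lparr>kob = (\<lambda>cs \<in> Obj (prod_cat ([] :: ('o, 'a) permcat list)). e),
     kar = (\<lambda>us \<in> Arr (prod_cat ([] :: ('o, 'a) permcat list)). Idt C e),
     kdist = (\<lambda>i cs c'. undefined)\<rparr>"

lemma klin_point_simps [simp]:
  "kob (klin_point C e) [] = e" "kar (klin_point C e) [] = Idt C e"
  by (simp_all add: klin_point_def)

lemma klinear_point:
  assumes "permutative C" "e \<in> Obj C"
  shows "klinear [] C (klin_point C e)"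
proof -
  interpret permutative C by fact
  show ?thesis
  proof (rule klinear.intro)
    show "cfunctor (prod_cat []) C (kob (klin_point C e)) (kar (klin_point C e))"
      using assms(2) by unfold_locales (auto intro: homI)
  qed (auto simp: klin_point_def)
qed

text \<open>
  The empty word is a path at every vertex; for this reason the end points are arguments instead of
  being read off the word.
\<close>

primrec path :: "('c \<Rightarrow> 'v) \<Rightarrow> ('c \<Rightarrow> 'v) \<Rightarrow> 'v \<Rightarrow> 'c list \<Rightarrow> 'v \<Rightarrow> bool" where
  "path src tgt u [] v \<longleftrightarrow> u = v"
| "path src tgt u (c # W) v \<longleftrightarrow> src c = u \<and> path src tgt (tgt c) W v"

lemma path_append: "path src tgt u (W1 @ W2) w \<longleftrightarrow> (\<exists>v. path src tgt u W1 v \<and> path src tgt v W2 w)"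
  by (induction W1 arbitrary: u) auto

text \<open>
  Permutative categories indexed by pairs of vertices and composed by distributive pairings, that is,
  a category with objects the vertices, with the permutative categories \<open>K u v\<close> in place of its
  sets of arrows, in which composition is strictly associative and unital. With one vertex this is an
  associative category. With two vertices \<open>0 < 1\<close> it consists of associative categories \<open>K 0 0\<close> and
  \<open>K 1 1\<close> and a bimodule \<open>K 0 1\<close>: the pairings are the two tensor products and the two actions, and
  \<open>associative_T\<close> has five instances, one for each associative category, one for each action and the
  one that relates the actions. Letters name some of the categories \<open>K u v\<close>.
\<close>

locale tensor_system =
  fixes src tgt :: "'c \<Rightarrow> 'v::preorder"
    and K :: "'v \<Rightarrow> 'v \<Rightarrow> ('o, 'a) permcat"
    and T :: "'v \<Rightarrow> 'v \<Rightarrow> 'v \<Rightarrow> ('o, 'a) pairing"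
    and U :: "'v \<Rightarrow> 'o"
  assumes src_le_tgt: "src c \<le> tgt c"
    and permutative_K: "u \<le> v \<Longrightarrow> permutative (K u v)"
    and distributive_T: "u \<le> v \<Longrightarrow> v \<le> w \<Longrightarrow> distributive_pairing (K u v) (K v w) (K u w) (T u v w)"
    and associative_T: "u \<le> v \<Longrightarrow> v \<le> w \<Longrightarrow> w \<le> z
      \<Longrightarrow> associative_pairings (K u v) (K v w) (K w z) (K u z) (T u v w) (T u w z) (T v w z) (T u v z)"
    and unit_obj: "U v \<in> Obj (K v v)"
    and left_unital_T: "v \<le> w \<Longrightarrow> left_unital (K v v) (K v w) (T v v w) (U v)"
    and right_unital_T: "u \<le> v \<Longrightarrow> right_unital (K u v) (K v v) (T u v v) (U v)"
begin

abbreviation Cat :: "'c \<Rightarrow> ('o, 'a) permcat" where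
  "Cat c \<equiv> K (src c) (tgt c)"

abbreviation Obs :: "'c list \<Rightarrow> 'o list set" where
  "Obs W \<equiv> Obj (prod_cat (map Cat W))"

abbreviation Ars :: "'c list \<Rightarrow> 'a list set" where
  "Ars W \<equiv> Arr (prod_cat (map Cat W))"

abbreviation pth :: "'v \<Rightarrow> 'c list \<Rightarrow> 'v \<Rightarrow> bool" where
  "pth \<equiv> path src tgt"

text \<open>
  The iterated tensor product of a word that ends at vertex \<open>v\<close>, bracketed to the right. It ends with
  the unit of \<open>v\<close>, as \<open>tens_obs\<close> does, so that the empty word needs no separate treatment.
\<close>

primrec word :: "'v \<Rightarrow> 'c list \<Rightarrow> ('o, 'a) klin" where
  "word v [] = klin_point (K v v) (U v)"
| "word v (c # W) = klin_cons (Cat c) (map Cat W) (K (src c) v) (T (src c) (tgt c) v) (word v W)"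

lemma pth_le: "pth u W v \<Longrightarrow> u \<le> v"
proof (induction W arbitrary: u)
  case (Cons c W)
  with src_le_tgt[of c] show ?case by (auto intro: order_trans)
qed simp

lemma pairing_functor_T:
  "u \<le> v \<Longrightarrow> v \<le> w \<Longrightarrow> pairing_functor (K u v) (K v w) (K u w) (T u v w)"
  using order_trans[of u v w] by (simp add: pairing_functor_def distributive_T permutative_K)

text \<open>
  The two parts have to be proved together. Multilinearity of \<open>c # W\<close> needs that the distributivity
  maps of \<open>W\<close> become identities after tensoring with \<open>id\<^sub>0\<close>, and the proof of this for \<open>c # W\<close> needs the
  domains of the distributivity maps of \<open>W\<close>. In the second part \<open>0\<close> may lie in any \<open>K s u\<close>, because
  in the inductive step it absorbs the first letter.
\<close>

lemma multilinear_word_and_zero: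
  assumes "pth u W v"
  shows "multilinear (map Cat W) (K u v) (word v W) \<and>
    (\<forall>s i ys y'. s \<le> u \<longrightarrow> i < length W \<longrightarrow> ys \<in> Obs W \<longrightarrow> y' \<in> Obj (Cat (W ! i))
      \<longrightarrow> par (T s u v) (Idt (K s u) (zero (K s u))) (kdist (word v W) i ys y') = Idt (K s v) (zero (K s v)))"
  using assms
proof (induction W arbitrary: u)
  case Nil
  then show ?case
    by (auto simp: multilinear_def multilinear_axioms_def permutative_K unit_obj intro!: klinear_point)
next
  case (Cons c W)
  define u' where "u' = tgt c"
  have u: "src c = u" "pth u' W v" "u \<le> u'" "u' \<le> v" "u \<le> v"
    using Cons.prems src_le_tgt[of c] pth_le[of u' W v] order_trans[of u u' v] by (auto simp: u'_def)
  note IH = Cons.IH[OF u(2)]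
  interpret W: multilinear "map Cat W" "K u' v" "word v W" using IH by blast
  have zero: "par (T s u' v) (Idt (K s u') (zero (K s u'))) (kdist (word v W) i ys y') = Idt (K s v) (zero (K s v))"
    if "s \<le> u'" "i < length W" "ys \<in> Obs W" "y' \<in> Obj (Cat (W ! i))" for s i ys y'
    using IH that by blast
  interpret t: pairing_functor "K u u'" "K u' v" "K u v" "T u u' v"
    using u by (intro pairing_functor_T)
  interpret cons_setup "K u u'" "K u' v" "K u v" "T u u' v" "map Cat W" "word v W"
    using zero u by unfold_locales auto
  have m: "multilinear (map Cat (c # W)) (K u v) (word v (c # W))"
    using klinear_cons u src_le_tgt permutative_K
    by (auto simp: multilinear_def multilinear_axioms_def u'_def[symmetric])
  moreover have "par (T s u v) (Idt (K s u) (zero (K s u))) (kdist (word v (c # W)) i ys y') = Idt (K s v) (zero (K s v))"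
    if s: "s \<le> u" and i: "i < length (c # W)" and ys: "ys \<in> Obs (c # W)"
      and y': "y' \<in> Obj (Cat ((c # W) ! i))" for s i ys y'
  proof -
    have su': "s \<le> u'" using s u order_trans by blast
    have sv: "s \<le> v" using s u order_trans by blast
    interpret p: pairing_functor "K s u" "K u u'" "K s u'" "T s u u'" using s u by (intro pairing_functor_T)
    interpret q: pairing_functor "K s u'" "K u' v" "K s v" "T s u' v" using su' u by (intro pairing_functor_T)
    interpret s: pairing_functor "K s u" "K u v" "K s v" "T s u v" using s u by (intro pairing_functor_T)
    interpret asc: associative_pairings "K s u" "K u u'" "K u' v" "K s v" "T s u u'" "T s u' v" "T u u' v" "T s u v"
      using s u by (intro associative_T)
    let ?z = "zero (K s u)"
    obtain x xs where ys': "ys = x # xs" "x \<in> Obj (K u u')" "xs \<in> Obs W"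
      using ys u by (auto elim!: prod_cat_ConsE simp: u'_def)
    show ?thesis
    proof (cases i)
      case 0
      let ?B = "kob (word v W) xs"
      have y'': "y' \<in> Obj (K u u')" using y' 0 u by (simp add: u'_def)
      \<comment> \<open>With first argument \<open>0\<close>, \<open>d\<^sub>r\<close> is an identity and may be inserted. This gives one side of
        \<open>dr_dl\<close>, whose other side consists of identities.\<close>
      have "par (T s u v) (Idt (K s u) ?z) (pdl (T u u' v) x y' ?B)
        = Cmp (K s v) (par (T s u v) (Idt (K s u) ?z) (pdl (T u u' v) x y' ?B))
            (pdr (T s u v) ?z (pob (T u u' v) x ?B) (pob (T u u' v) y' ?B))"
        using ys' y'' by (simp add: s.dr_zero s.zero_left)
      also have "\<dots> = Idt (K s v) (zero (K s v))"
        using ys' y'' by (simp flip: asc.dr_dl add: p.dr_zero p.zero_left q.dl_zero q.zero_left)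
      finally show ?thesis
        using ys' y'' u by (simp add: 0 u'_def[symmetric])
    next
      case (Suc k)
      have k: "k < length W" "y' \<in> Obj (Cat (W ! k))" using i y' Suc by auto
      let ?P = "kob (word v W) xs" and ?Q = "kob (word v W) (xs[k := y'])" and ?d = "kdist (word v W) k xs y'"
      have ty: "?P \<in> Obj (K u' v)" "?Q \<in> Obj (K u' v)" "?d \<in> Arr (K u' v)"
        "Dom (K u' v) ?d = osum (K u' v) ?P ?Q"
        using ys' k by auto
      have "par (T s u v) (Idt (K s u) ?z) (kdist (word v (c # W)) i ys y')
         = Cmp (K s v) (par (T s u v) (Idt (K s u) ?z) (par (T u u' v) (Idt (K u u') x) ?d))
            (par (T s u v) (Idt (K s u) ?z) (pdr (T u u' v) x ?P ?Q))"
        using ys' k ty u by (simp add: Suc u'_def[symmetric] s.par_Cmp_right)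
      also have "par (T s u v) (Idt (K s u) ?z) (par (T u u' v) (Idt (K u u') x) ?d)
         = par (T s u' v) (Idt (K s u') (zero (K s u'))) ?d"
        using ys' ty by (simp flip: asc.ar_assoc add: p.zero_left)
      also have "\<dots> = Idt (K s v) (zero (K s v))"
        using zero su' k ys' by blast
      \<comment> \<open>Again \<open>d\<^sub>r\<close> with first argument \<open>0\<close> is inserted, now in order to apply \<open>dr_dr\<close>.\<close>
      also have "par (T s u v) (Idt (K s u) ?z) (pdr (T u u' v) x ?P ?Q)
         = Cmp (K s v) (par (T s u v) (Idt (K s u) ?z) (pdr (T u u' v) x ?P ?Q))
            (pdr (T s u v) ?z (pob (T u u' v) x ?P) (pob (T u u' v) x ?Q))"
        using ys' ty by (simp add: s.dr_zero s.zero_left)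
      also have "\<dots> = Idt (K s v) (zero (K s v))"
        using ys' ty by (simp flip: asc.dr_dr add: p.zero_left q.dr_zero q.zero_left)
      finally show ?thesis by simp
    qed
  qed
  ultimately show ?case by blast
qed

lemma multilinear_word: "pth u W v \<Longrightarrow> multilinear (map Cat W) (K u v) (word v W)"
  using multilinear_word_and_zero by blast

lemma word_append:
  assumes "pth u W1 v" "pth v W2 w"
  shows "\<lbrakk>xs \<in> Obs W1; ys \<in> Obs W2\<rbrakk>
      \<Longrightarrow> kob (word w (W1 @ W2)) (xs @ ys) = pob (T u v w) (kob (word v W1) xs) (kob (word w W2) ys)"
    and "\<lbrakk>fs \<in> Ars W1; gs \<in> Ars W2\<rbrakk>
      \<Longrightarrow> kar (word w (W1 @ W2)) (fs @ gs) = par (T u v w) (kar (word v W1) fs) (kar (word w W2) gs)"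
  using assms(1)
proof (induction W1 arbitrary: u xs fs)
  case Nil
  case 1
  have vw: "v \<le> w" using pth_le assms(2) .
  interpret W2: multilinear "map Cat W2" "K v w" "word w W2" using multilinear_word assms(2) .
  show ?case using 1 left_unital.ob_unit[OF left_unital_T[OF vw]] by simp
next
  case Nil
  case 2
  have vw: "v \<le> w" using pth_le assms(2) .
  interpret W2: multilinear "map Cat W2" "K v w" "word w W2" using multilinear_word assms(2) .
  show ?case using 2 left_unital.ar_unit[OF left_unital_T[OF vw]] by simp
next
  case (Cons c W1)
  have vert: "src c = u" "pth (tgt c) W1 v" "u \<le> tgt c" "tgt c \<le> v" "v \<le> w" if "pth u (c # W1) v" for u
    using that src_le_tgt[of c] pth_le[of "tgt c" W1 v] pth_le assms(2) by auto
  have asc: "associative_pairings (K u (tgt c)) (K (tgt c) v) (K v w) (K u w)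
      (T u (tgt c) v) (T u v w) (T (tgt c) v w) (T u (tgt c) w)" if "pth u (c # W1) v" for u
    using vert[OF that] by (intro associative_T)
  interpret W2: multilinear "map Cat W2" "K v w" "word w W2" using multilinear_word assms(2) .
  {
    case 1
    note u = vert[OF 1(3)]
    interpret W1: multilinear "map Cat W1" "K (tgt c) v" "word v W1" using multilinear_word u(2) .
    obtain z zs where zs: "xs = z # zs" "z \<in> Obj (K u (tgt c))" "zs \<in> Obs W1"
      using 1(1) u by (auto elim!: prod_cat_ConsE)
    have "zs @ ys \<in> Obs (W1 @ W2)"
      using zs(3) 1(2) unfolding prod_cat_simps map_append by (rule list_all2_appendI)
    then show ?case
      using zs 1(2) Cons.IH(1)[OF zs(3) 1(2) u(2)] u(1) by (simp add: associative_pairings.ob_assoc[OF asc[OF 1(3)]])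
  next
    case 2
    note u = vert[OF 2(3)]
    interpret W1: multilinear "map Cat W1" "K (tgt c) v" "word v W1" using multilinear_word u(2) .
    obtain z zs where zs: "fs = z # zs" "z \<in> Arr (K u (tgt c))" "zs \<in> Ars W1"
      using 2(1) u by (auto elim!: prod_cat_Arr_ConsE)
    have "zs @ gs \<in> Ars (W1 @ W2)"
      using zs(3) 2(2) unfolding prod_cat_simps map_append by (rule list_all2_appendI)
    then show ?case
      using zs 2(2) Cons.IH(2)[OF zs(3) 2(2) u(2)] u(1) by (simp add: associative_pairings.ar_assoc[OF asc[OF 2(3)]])
  }
qed

text \<open>
  For a letter in the first word of a concatenation, the second word is a single factor on the right,
  which contributes one \<open>d\<^sub>l\<close>. If the letter is the first one this is \<open>dl_dl\<close>; otherwise the induction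
  hypothesis leaves \<open>d\<^sub>l\<close> under \<open>z \<otimes> -\<close>, and \<open>dr_dl\<close> moves it out.
\<close>

lemma word_dist_append_left:
  assumes "pth u W1 v" "pth v W2 w" "i < length W1" "xs \<in> Obs W1"
    "ys \<in> Obs W2" "x' \<in> Obj (Cat (W1 ! i))"
  shows "kdist (word w (W1 @ W2)) i (xs @ ys) x'
    = Cmp (K u w) (par (T u v w) (kdist (word v W1) i xs x') (Idt (K v w) (kob (word w W2) ys)))
        (pdl (T u v w) (kob (word v W1) xs) (kob (word v W1) (xs[i := x'])) (kob (word w W2) ys))"
  using assms(1,3,4,6)
proof (induction W1 arbitrary: u i xs)
  case (Cons c W1)
  define u' where "u' = tgt c"
  have u: "src c = u" "pth u' W1 v" "u \<le> u'" "u' \<le> v" "v \<le> w"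
    using Cons.prems src_le_tgt[of c] pth_le[of u' W1 v] pth_le assms(2) by (auto simp: u'_def)
  have le: "u' \<le> w" "u \<le> v" using u order_trans by blast+
  have app: "pth u' (W1 @ W2) w" using u assms(2) by (auto simp: path_append)
  interpret asc: associative_pairings "K u u'" "K u' v" "K v w" "K u w" "T u u' v" "T u v w" "T u' v w" "T u u' w"
    using u by (intro associative_T)
  interpret p: pairing_functor "K u u'" "K u' v" "K u v" "T u u' v" using u by (intro pairing_functor_T)
  interpret q: pairing_functor "K u v" "K v w" "K u w" "T u v w" using u le by (intro pairing_functor_T)
  interpret r: pairing_functor "K u' v" "K v w" "K u' w" "T u' v w" using u by (intro pairing_functor_T)
  interpret s: pairing_functor "K u u'" "K u' w" "K u w" "T u u' w" using u le by (intro pairing_functor_T)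
  interpret W1: multilinear "map Cat W1" "K u' v" "word v W1" using multilinear_word u(2) .
  interpret W2: multilinear "map Cat W2" "K v w" "word w W2" using multilinear_word assms(2) .
  interpret W12: multilinear "map Cat (W1 @ W2)" "K u' w" "word w (W1 @ W2)" using multilinear_word app .
  obtain z zs where zs: "xs = z # zs" "z \<in> Obj (K u u')" "zs \<in> Obs W1"
    using Cons.prems(3) u by (auto elim!: prod_cat_ConsE simp: u'_def)
  have Ob: "zs @ ys \<in> Obs (W1 @ W2)"
    using zs(3) assms(5) unfolding prod_cat_simps map_append by (rule list_all2_appendI)
  note app1 = word_append(1)[OF u(2) assms(2) _ assms(5)]
  let ?A = "kob (word v W1) zs" and ?B = "kob (word w W2) ys"
  have B: "?B \<in> Obj (K v w)" using assms(5) by simp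
  show ?case
  proof (cases i)
    case 0
    have x': "x' \<in> Obj (K u u')" using Cons.prems(4) 0 u by (simp add: u'_def)
    show ?thesis
      using zs x' Ob B u(1) by (simp add: 0 u'_def[symmetric] app1[OF zs(3)] asc.dl_dl)
  next
    case (Suc k)
    have k: "k < length W1" "x' \<in> Obj (Cat (W1 ! k))" using Cons.prems Suc by auto
    have l: "length zs = length W1" using zs(3) by (auto dest: prod_cat_length)
    have zs': "zs[k := x'] \<in> Obs W1" using zs k by simp
    have upd: "(zs @ ys)[k := x'] = zs[k := x'] @ ys" using k l by (simp add: list_update_append)
    let ?A' = "kob (word v W1) (zs[k := x'])" and ?d = "kdist (word v W1) k zs x'"
    have ty: "?A \<in> Obj (K u' v)" "?A' \<in> Obj (K u' v)" "?d \<in> Arr (K u' v)"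
      "Dom (K u' v) ?d = osum (K u' v) ?A ?A'"
      using zs k by auto
    have nth: "map Cat (W1 @ W2) ! k = Cat (W1 ! k)" using k by (simp add: nth_append)
    have "kdist (word w ((c # W1) @ W2)) i (xs @ ys) x'
      = Cmp (K u w) (par (T u u' w) (Idt (K u u') z) (kdist (word w (W1 @ W2)) k (zs @ ys) x'))
          (pdr (T u u' w) z (pob (T u' v w) ?A ?B) (pob (T u' v w) ?A' ?B))"
      using zs k Ob u(1) nth by (simp add: Suc u'_def[symmetric] upd app1 zs')
    also have "kdist (word w (W1 @ W2)) k (zs @ ys) x'
       = Cmp (K u' w) (par (T u' v w) ?d (Idt (K v w) ?B)) (pdl (T u' v w) ?A ?A' ?B)"
      using Cons.IH[OF u(2) k(1) zs(3) k(2)] .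
    also have "Cmp (K u w) (par (T u u' w) (Idt (K u u') z) \<dots>)
          (pdr (T u u' w) z (pob (T u' v w) ?A ?B) (pob (T u' v w) ?A' ?B))
      = Cmp (K u w) (par (T u u' w) (Idt (K u u') z) (par (T u' v w) ?d (Idt (K v w) ?B)))
         (Cmp (K u w) (par (T u u' w) (Idt (K u u') z) (pdl (T u' v w) ?A ?A' ?B))
           (pdr (T u u' w) z (pob (T u' v w) ?A ?B) (pob (T u' v w) ?A' ?B)))"
      using ty B zs(2) by (simp add: s.par_Cmp_right)
    also have "\<dots> = Cmp (K u w) (par (T u v w) (par (T u u' v) (Idt (K u u') z) ?d) (Idt (K v w) ?B))
         (Cmp (K u w) (par (T u v w) (pdr (T u u' v) z ?A ?A') (Idt (K v w) ?B))
           (pdl (T u v w) (pob (T u u' v) z ?A) (pob (T u u' v) z ?A') ?B))"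
      using ty B zs(2) by (simp add: asc.dr_dl asc.ar_assoc)
    also have "\<dots> = Cmp (K u w) (par (T u v w)
           (Cmp (K u v) (par (T u u' v) (Idt (K u u') z) ?d) (pdr (T u u' v) z ?A ?A')) (Idt (K v w) ?B))
           (pdl (T u v w) (pob (T u u' v) z ?A) (pob (T u u' v) z ?A') ?B)"
      using ty B zs(2) by (simp add: q.par_Cmp_left)
    also have "\<dots> = Cmp (K u w) (par (T u v w) (kdist (word v (c # W1)) i xs x') (Idt (K v w) ?B))
        (pdl (T u v w) (kob (word v (c # W1)) xs) (kob (word v (c # W1)) (xs[i := x'])) ?B)"
      using zs k u(1) zs' by (simp add: Suc u'_def[symmetric])
    finally show ?thesis .
  qed
qed simp

text \<open>
  For a letter in the second word, the first word is a single factor on the left, which contributes one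
  \<open>d\<^sub>r\<close>. Prefixing one more letter to the first word is \<open>dr_dr\<close>.
\<close>

lemma word_dist_append_right:
  assumes "pth u W1 v" "pth v W2 w" "i < length W2" "xs \<in> Obs W1"
    "ys \<in> Obs W2" "y' \<in> Obj (Cat (W2 ! i))"
  shows "kdist (word w (W1 @ W2)) (length W1 + i) (xs @ ys) y'
    = Cmp (K u w) (par (T u v w) (Idt (K u v) (kob (word v W1) xs)) (kdist (word w W2) i ys y'))
        (pdr (T u v w) (kob (word v W1) xs) (kob (word w W2) ys) (kob (word w W2) (ys[i := y'])))"
  using assms(1,4)
proof (induction W1 arbitrary: u xs)
  case Nil
  have vw: "v \<le> w" using pth_le assms(2) .
  interpret W2: multilinear "map Cat W2" "K v w" "word w W2" using multilinear_word assms(2) .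
  interpret left_unital "K v v" "K v w" "T v v w" "U v" using vw by (rule left_unital_T)
  have "ys[i := y'] \<in> Obs W2" using assms by simp
  with Nil assms show ?case by (simp add: ar_unit dr_unit)
next
  case (Cons c W1)
  define u' where "u' = tgt c"
  have u: "src c = u" "pth u' W1 v" "u \<le> u'" "u' \<le> v" "v \<le> w"
    using Cons.prems src_le_tgt[of c] pth_le[of u' W1 v] pth_le assms(2) by (auto simp: u'_def)
  have le: "u' \<le> w" "u \<le> v" using u order_trans by blast+
  have app: "pth u' (W1 @ W2) w" using u assms(2) by (auto simp: path_append)
  interpret asc: associative_pairings "K u u'" "K u' v" "K v w" "K u w" "T u u' v" "T u v w" "T u' v w" "T u u' w"
    using u by (intro associative_T)
  interpret p: pairing_functor "K u u'" "K u' v" "K u v" "T u u' v" using u by (intro pairing_functor_T)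
  interpret q: pairing_functor "K u v" "K v w" "K u w" "T u v w" using u le by (intro pairing_functor_T)
  interpret r: pairing_functor "K u' v" "K v w" "K u' w" "T u' v w" using u by (intro pairing_functor_T)
  interpret s: pairing_functor "K u u'" "K u' w" "K u w" "T u u' w" using u le by (intro pairing_functor_T)
  interpret W1: multilinear "map Cat W1" "K u' v" "word v W1" using multilinear_word u(2) .
  interpret W2: multilinear "map Cat W2" "K v w" "word w W2" using multilinear_word assms(2) .
  obtain z zs where zs: "xs = z # zs" "z \<in> Obj (K u u')" "zs \<in> Obs W1"
    using Cons.prems(2) u by (auto elim!: prod_cat_ConsE simp: u'_def)
  have Ob: "zs @ ys \<in> Obs (W1 @ W2)"
    using zs(3) assms(5) unfolding prod_cat_simps map_append by (rule list_all2_appendI)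
  have l: "length zs = length W1" using zs(3) by (auto dest: prod_cat_length)
  have ys': "ys[i := y'] \<in> Obs W2" using assms by simp
  have upd: "(zs @ ys)[length W1 + i := y'] = zs @ ys[i := y']" using l by (simp add: list_update_append)
  note app1 = word_append(1)[OF u(2) assms(2) zs(3)]
  let ?A = "kob (word v W1) zs" and ?B = "kob (word w W2) ys" and ?B' = "kob (word w W2) (ys[i := y'])"
  let ?d = "kdist (word w W2) i ys y'"
  have ty: "?A \<in> Obj (K u' v)" "?B \<in> Obj (K v w)" "?B' \<in> Obj (K v w)" "?d \<in> Arr (K v w)"
      "Dom (K v w) ?d = osum (K v w) ?B ?B'"
    using zs assms ys' by auto
  have "kdist (word w ((c # W1) @ W2)) (length (c # W1) + i) (xs @ ys) y'
      = Cmp (K u w) (par (T u u' w) (Idt (K u u') z) (kdist (word w (W1 @ W2)) (length W1 + i) (zs @ ys) y'))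
          (pdr (T u u' w) z (pob (T u' v w) ?A ?B) (pob (T u' v w) ?A ?B'))"
    using zs assms Ob u(1) by (simp add: u'_def[symmetric] upd app1 ys' nth_append)
  also have "kdist (word w (W1 @ W2)) (length W1 + i) (zs @ ys) y'
       = Cmp (K u' w) (par (T u' v w) (Idt (K u' v) ?A) ?d) (pdr (T u' v w) ?A ?B ?B')"
    using Cons.IH[OF u(2) zs(3)] .
  also have "Cmp (K u w) (par (T u u' w) (Idt (K u u') z) \<dots>)
          (pdr (T u u' w) z (pob (T u' v w) ?A ?B) (pob (T u' v w) ?A ?B'))
      = Cmp (K u w) (par (T u u' w) (Idt (K u u') z) (par (T u' v w) (Idt (K u' v) ?A) ?d))
         (Cmp (K u w) (par (T u u' w) (Idt (K u u') z) (pdr (T u' v w) ?A ?B ?B'))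
           (pdr (T u u' w) z (pob (T u' v w) ?A ?B) (pob (T u' v w) ?A ?B')))"
    using ty zs(2) by (simp add: s.par_Cmp_right)
  also have "\<dots> = Cmp (K u w) (par (T u v w) (Idt (K u v) (pob (T u u' v) z ?A)) ?d)
         (pdr (T u v w) (pob (T u u' v) z ?A) ?B ?B')"
    using ty zs(2) by (simp flip: asc.ar_assoc asc.dr_dr)
  also have "\<dots> = Cmp (K u w) (par (T u v w) (Idt (K u v) (kob (word v (c # W1)) xs)) ?d)
        (pdr (T u v w) (kob (word v (c # W1)) xs) ?B ?B')"
    using zs u(1) by (simp add: u'_def[symmetric])
  finally show ?case .
qed

end

section \<open>Blocks and the composition of permutations\<close>

lemma block_pos_offset:
  assumes "j < length js" "p < js ! j"
  shows "block_pos js (sum_list (take j js) + p) = (j, p)"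
  using assms
proof (induction js arbitrary: j)
  case (Cons k js)
  then show ?case by (cases j) (auto simp: add.assoc)
qed simp

lemma block_posE:
  assumes "m < sum_list js"
  obtains j p where "block_pos js m = (j, p)" "j < length js" "p < js ! j" "m = sum_list (take j js) + p"
proof -
  have "\<exists>j p. j < length js \<and> p < js ! j \<and> m = sum_list (take j js) + p"
    using assms
  proof (induction js arbitrary: m)
    case (Cons k js)
    show ?case
    proof (cases "m < k")
      case True
      then show ?thesis by (intro exI[of _ 0] exI[of _ m]) auto
    next
      case False
      with Cons.prems have "m - k < sum_list js" by simp
      then obtain j p where "j < length js" "p < js ! j" "m - k = sum_list (take j js) + p"
        using Cons.IH by blast
      with False show ?thesis by (intro exI[of _ "Suc j"] exI[of _ p]) auto
    qed
  qed simp
  then show ?thesis using that block_pos_offset by blast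
qed

lemma offset_less:
  assumes "j < length js" "p < js ! j"
  shows "sum_list (take j js) + p < sum_list (js :: nat list)"
  using assms
proof (induction js arbitrary: j)
  case (Cons k js)
  then show ?case by (cases j) (auto simp: add.assoc)
qed simp

lemma blocks_concat: "blocks (map length xss) (concat xss) = xss"
  by (induction xss) auto

lemma concat_blocks:
  assumes "length xs = sum_list js"
  shows "concat (blocks js xs) = xs" "map length (blocks js xs) = js"
  using assms by (induction js arbitrary: xs) auto

lemma concat_nth_offset:
  assumes "j < length xss" "p < length (xss ! j)"
  shows "concat xss ! (sum_list (take j (map length xss)) + p) = xss ! j ! p"
  using assms
proof (induction xss arbitrary: j)
  case (Cons xs xss)
  then show ?case by (cases j) (auto simp: nth_append add.assoc)
qed simp

lemma concat_update_offset:
  assumes "j < length xss" "p < length (xss ! j)"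
  shows "(concat xss)[sum_list (take j (map length xss)) + p := v] = concat (xss[j := (xss ! j)[p := v]])"
  using assms
proof (induction xss arbitrary: j)
  case (Cons xs xss)
  then show ?case by (cases j) (auto simp: list_update_append add.assoc)
qed simp

lemma list_all2_blocks:
  assumes "list_all2 P (concat ass) xs"
  shows "list_all2 (list_all2 P) ass (blocks (map length ass) xs)"
  using assms
proof (induction ass arbitrary: xs)
  case (Cons as ass)
  then obtain ys zs where "xs = ys @ zs" "list_all2 P as ys" "list_all2 P (concat ass) zs"
    by (auto simp: list_all2_append1)
  moreover from this have "length as = length ys" by (auto dest: list_all2_lengthD)
  ultimately show ?case using Cons.IH[of zs] by simp
qed simp

text \<open>
  What \<open>\<Gamma>(\<sigma>; \<phi>\<^sub>1, \<dots>, \<phi>\<^sub>k)\<close> does to a list cut into blocks: \<open>\<phi>\<^sub>j\<close> acts within block \<open>j\<close>, and \<open>\<sigma>\<close> permutes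
  the blocks.
\<close>

definition rearrange :: "(nat \<Rightarrow> nat) \<Rightarrow> (nat \<Rightarrow> nat) list \<Rightarrow> 'b list list \<Rightarrow> 'b list list" where
  "rearrange \<sigma> \<phi>s xss = permute_list (inv \<sigma>) (map2 (\<lambda>\<phi>. permute_list (inv \<phi>)) \<phi>s xss)"

lemma length_rearrange [simp]: "length (rearrange \<sigma> \<phi>s xss) = min (length \<phi>s) (length xss)"
  by (simp add: rearrange_def)

lemma rearrange_nth:
  assumes "\<sigma> permutes {..<length \<phi>s}" "length xss = length \<phi>s" "i < length \<phi>s"
  shows "inv \<sigma> i < length \<phi>s"
    and "rearrange \<sigma> \<phi>s xss ! i = permute_list (inv (\<phi>s ! inv \<sigma> i)) (xss ! inv \<sigma> i)"
proof -
  show "inv \<sigma> i < length \<phi>s"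
    using permutes_in_image[OF permutes_inv[OF assms(1)], of i] assms(3) by simp
  with assms show "rearrange \<sigma> \<phi>s xss ! i = permute_list (inv (\<phi>s ! inv \<sigma> i)) (xss ! inv \<sigma> i)"
    by (simp add: rearrange_def permute_list_nth permutes_inv)
qed

lemma rearrange_nth_image:
  assumes "\<sigma> permutes {..<length \<phi>s}" "length xss = length \<phi>s" "j < length \<phi>s"
  shows "rearrange \<sigma> \<phi>s xss ! \<sigma> j = permute_list (inv (\<phi>s ! j)) (xss ! j)"
  using assms by (simp add: rearrange_def permute_list_inv_nth)

context
  fixes js :: "nat list" and \<sigma> :: "nat \<Rightarrow> nat" and \<phi>s :: "(nat \<Rightarrow> nat) list"
  assumes \<sigma>: "\<sigma> permutes {..<length js}"
    and \<phi>s: "\<And>j. j < length js \<Longrightarrow> (\<phi>s ! j) permutes {..<js ! j}"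
begin

text \<open>
  \<open>permute_list (inv \<sigma>) js\<close> lists the lengths of the blocks in their new order, so its partial sums are
  the new offsets of the blocks. This turns the sum over all \<open>i'\<close> with \<open>\<sigma>(i') < \<sigma>(j)\<close> in \<open>block_perm\<close> into
  a partial sum.
\<close>

lemma Sym_comp_offset:
  assumes "j < length js" "p < js ! j"
  shows "Sym_comp js \<sigma> \<phi>s (sum_list (take j js) + p)
    = sum_list (take (\<sigma> j) (permute_list (inv \<sigma>) js)) + (\<phi>s ! j) p"
proof -
  have p: "(\<phi>s ! j) p < js ! j" using permutes_in_image[OF \<phi>s[OF assms(1)], of p] assms(2) by simp
  have \<sigma>j: "\<sigma> j < length js" using permutes_in_image[OF \<sigma>, of j] assms(1) by simp
  have "sum_list (take (\<sigma> j) (permute_list (inv \<sigma>) js)) = (\<Sum>i<\<sigma> j. js ! inv \<sigma> i)"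
    using \<sigma>j \<sigma> by (simp add: sum_list_sum_nth atLeast0LessThan permute_list_nth permutes_inv)
  also have "\<dots> = (\<Sum>i' | i' < length js \<and> \<sigma> i' < \<sigma> j. js ! i')"
  proof (rule sum.reindex_bij_witness[of _ \<sigma> "inv \<sigma>"])
    fix i assume "i \<in> {..<\<sigma> j}"
    then show "inv \<sigma> i \<in> {i'. i' < length js \<and> \<sigma> i' < \<sigma> j}"
      using permutes_in_image[OF permutes_inv[OF \<sigma>], of i] \<sigma>j by (simp add: permutes_inverses[OF \<sigma>])
  qed (simp_all add: permutes_inverses[OF \<sigma>])
  finally show ?thesis
    using offset_less[OF assms] offset_less[OF assms(1) p] assms p
    by (simp add: Sym_comp_def perm_sum_def block_perm_def block_pos_offset)
qed

text \<open>
  The place of \<open>Sym_comp js \<sigma> \<phi>s m\<close> among the rearranged blocks is \<open>(\<sigma>(j), \<phi>\<^sub>j(p))\<close> if \<open>m\<close> is position \<open>p\<close>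
  of block \<open>j\<close>; hence it determines \<open>m\<close>.
\<close>

lemma Sym_comp_permutes: "Sym_comp js \<sigma> \<phi>s permutes {..<sum_list js}"
proof -
  let ?s = "Sym_comp js \<sigma> \<phi>s" and ?js = "permute_list (inv \<sigma>) js"
  have sum: "sum_list ?js = sum_list js"
    using mset_permute_list[of "inv \<sigma>" js] \<sigma> by (metis permutes_inv sum_mset_sum_list)
  have pos: "?s (sum_list (take j js) + p) < sum_list js \<and>
      block_pos ?js (?s (sum_list (take j js) + p)) = (\<sigma> j, (\<phi>s ! j) p)"
    if "j < length js" "p < js ! j" for j p
  proof -
    have "(\<phi>s ! j) p < js ! j" "\<sigma> j < length js"
      using permutes_in_image[OF \<phi>s[OF that(1)], of p] permutes_in_image[OF \<sigma>, of j] that by simp_all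
    moreover have "?js ! \<sigma> j = js ! j" using \<sigma> that by (simp add: permute_list_inv_nth)
    ultimately show ?thesis
      using block_pos_offset[of "\<sigma> j" ?js "(\<phi>s ! j) p"] offset_less[of "\<sigma> j" ?js "(\<phi>s ! j) p"] that
      by (simp add: Sym_comp_offset sum)
  qed
  have inj: "inj_on ?s {..<sum_list js}"
  proof (rule inj_onI)
    fix m m' assume m: "m \<in> {..<sum_list js}" "m' \<in> {..<sum_list js}" "?s m = ?s m'"
    from m(1) obtain j p where j: "j < length js" "p < js ! j" "m = sum_list (take j js) + p"
      by (auto elim: block_posE)
    from m(2) obtain j' p' where j': "j' < length js" "p' < js ! j'" "m' = sum_list (take j' js) + p'"
      by (auto elim: block_posE)
    have "(\<sigma> j, (\<phi>s ! j) p) = (\<sigma> j', (\<phi>s ! j') p')" using pos j j' m(3) by metis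
    then show "m = m'" using j j' permutes_inj[OF \<sigma>] permutes_inj[OF \<phi>s] by (auto dest!: injD)
  qed
  have "?s ` {..<sum_list js} \<subseteq> {..<sum_list js}"
    using pos by (auto elim!: block_posE)
  then have "bij_betw ?s {..<sum_list js} {..<sum_list js}"
    using inj endo_inj_surj[of "{..<sum_list js}" ?s] by (simp add: bij_betw_def)
  then show ?thesis
    by (rule bij_imp_permutes) (simp add: Sym_comp_def perm_sum_def block_perm_def)
qed

lemma permute_Sym_comp:
  assumes "map length xss = js" and that: "length \<phi>s = length js"
  shows "permute_list (inv (Sym_comp js \<sigma> \<phi>s)) (concat xss)
    = concat (rearrange \<sigma> \<phi>s xss)"
proof -
  let ?s = "Sym_comp js \<sigma> \<phi>s"
  define yss where "yss = rearrange \<sigma> \<phi>s xss"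
  have len: "length xss = length js" "length (concat xss) = sum_list js"
    unfolding assms(1)[symmetric] by (simp_all add: length_concat)
  have lens: "map length yss = permute_list (inv \<sigma>) js"
  proof (rule nth_equalityI)
    fix i assume "i < length (map length yss)"
    with that len(1) have i: "i < length \<phi>s" "length xss = length \<phi>s" by (simp_all add: yss_def)
    note r = rearrange_nth[OF _ i(2,1), of \<sigma>]
    have "js ! inv \<sigma> i = length (xss ! inv \<sigma> i)"
      using arg_cong[OF assms(1), of "\<lambda>l. l ! inv \<sigma> i"] r(1) \<sigma> that i(2) by simp
    then show "map length yss ! i = permute_list (inv \<sigma>) js ! i"
      using r \<sigma> that i by (simp add: yss_def permute_list_nth permutes_inv)
  qed (use that len(1) in \<open>simp add: yss_def\<close>)
  have sum: "length (concat yss) = sum_list js"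
    using mset_permute_list[of "inv \<sigma>" js] \<sigma> lens by (metis length_concat permutes_inv sum_mset_sum_list)
  \<comment> \<open>Comparing entries is easier after applying the permutation itself, as its inverse has no formula.\<close>
  have "concat yss = permute_list (inv ?s) (permute_list ?s (concat yss))"
    using Sym_comp_permutes sum
    by (simp add: permute_list_compose[symmetric] permutes_inv permutes_inv_o)
  also have "permute_list ?s (concat yss) = concat xss"
  proof (rule nth_equalityI)
    fix m assume "m < length (permute_list ?s (concat yss))"
    then have m: "m < sum_list js" using sum by simp
    then obtain j p where j: "j < length js" "p < js ! j" "m = sum_list (take j js) + p"
      by (auto elim: block_posE)
    have \<sigma>j: "\<sigma> j < length js" "\<sigma> j < length yss"
      using permutes_in_image[OF \<sigma>, of j] j len that by (simp_all add: yss_def)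
    have p: "(\<phi>s ! j) p < js ! j" using permutes_in_image[OF \<phi>s[OF j(1)], of p] j(2) by simp
    have nth: "yss ! \<sigma> j = permute_list (inv (\<phi>s ! j)) (xss ! j)"
      using \<sigma> len that j by (simp add: yss_def rearrange_nth_image)
    have lj: "length (xss ! j) = js ! j" using assms j(1) by auto
    have "permute_list ?s (concat yss) ! m = concat yss ! ?s m"
      using Sym_comp_permutes sum m by (simp add: permute_list_nth)
    also have "\<dots> = concat yss ! (sum_list (take (\<sigma> j) (map length yss)) + (\<phi>s ! j) p)"
      unfolding lens j(3) Sym_comp_offset[OF j(1,2)] ..
    also have "\<dots> = xss ! j ! p"
      using \<sigma>j nth p lj j(2) \<phi>s[OF j(1)] by (subst concat_nth_offset) (simp_all add: permute_list_inv_nth)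
    also have "\<dots> = concat xss ! m"
      using concat_nth_offset[of j xss p] j lj len assms by simp
    finally show "permute_list ?s (concat yss) ! m = concat xss ! m" .
  qed (use sum len in simp)
  finally show ?thesis by (simp add: yss_def)
qed

end

lemma path_concat:
  assumes "list_all2 (\<lambda>b W. path src tgt (src b) W (tgt b)) bs Ws" "path src tgt u bs v"
  shows "path src tgt u (concat Ws) v"
  using assms by (induction arbitrary: u rule: list_all2_induct) (auto simp: path_append)

section \<open>Substituting words into words\<close>

context tensor_system
begin

abbreviation words :: "'c list \<Rightarrow> 'c list list \<Rightarrow> ('o, 'a) klin list" where
  "words bs Ws \<equiv> map2 (\<lambda>b. word (tgt b)) bs Ws"

lemma word_concat:
  assumes "list_all2 (\<lambda>b W. pth (src b) W (tgt b)) bs Ws" "pth u bs v"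
    "list_all2 (\<lambda>W xs. xs \<in> Obs W) Ws xss"
  shows "kob (word v (concat Ws)) (concat xss) = kob (word v bs) (map2 kob (words bs Ws) xss)
    \<and> map2 kob (words bs Ws) xss \<in> Obs bs
    \<and> concat xss \<in> Obs (concat Ws)"
  using assms
proof (induction arbitrary: u xss rule: list_all2_induct)
  case (Cons b bs W Ws)
  then obtain xs yss where xss: "xss = xs # yss" "xs \<in> Obs W"
    "list_all2 (\<lambda>W xs. xs \<in> Obs W) Ws yss" by (auto simp: list_all2_Cons1)
  have p: "pth (src b) W (tgt b)" "pth (tgt b) (concat Ws) v" "pth (tgt b) bs v" "src b = u"
    using Cons path_concat[OF Cons.hyps(2)] by auto
  note IH = Cons.IH[OF p(3) xss(3)]
  interpret W: multilinear "map Cat W" "Cat b" "word (tgt b) W" using multilinear_word p(1) .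
  have "xs @ concat yss \<in> Obs (W @ concat Ws)"
    using xss(2) conjunct2[OF conjunct2[OF IH]] unfolding prod_cat_simps map_append by (rule list_all2_appendI)
  moreover have "kob (word (tgt b) W) xs \<in> Obj (K u (tgt b))" using W.kob_closed[OF xss(2)] p(4) by simp
  ultimately show ?case
    using IH xss word_append(1)[OF p(1,2) xss(2), of "concat yss"] by (simp add: p(4))
qed simp

lemma word_concat_Arr:
  assumes "list_all2 (\<lambda>b W. pth (src b) W (tgt b)) bs Ws" "pth u bs v"
    "list_all2 (\<lambda>W xs. xs \<in> Ars W) Ws xss"
  shows "kar (word v (concat Ws)) (concat xss) = kar (word v bs) (map2 kar (words bs Ws) xss)
    \<and> map2 kar (words bs Ws) xss \<in> Ars bs
    \<and> concat xss \<in> Ars (concat Ws)"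
  using assms
proof (induction arbitrary: u xss rule: list_all2_induct)
  case (Cons b bs W Ws)
  then obtain xs yss where xss: "xss = xs # yss" "xs \<in> Ars W"
    "list_all2 (\<lambda>W xs. xs \<in> Ars W) Ws yss" by (auto simp: list_all2_Cons1)
  have p: "pth (src b) W (tgt b)" "pth (tgt b) (concat Ws) v" "pth (tgt b) bs v" "src b = u"
    using Cons path_concat[OF Cons.hyps(2)] by auto
  note IH = Cons.IH[OF p(3) xss(3)]
  interpret W: multilinear "map Cat W" "Cat b" "word (tgt b) W" using multilinear_word p(1) .
  have "xs @ concat yss \<in> Ars (W @ concat Ws)"
    using xss(2) conjunct2[OF conjunct2[OF IH]] unfolding prod_cat_simps map_append by (rule list_all2_appendI)
  moreover have "kar (word (tgt b) W) xs \<in> Arr (K u (tgt b))" using W.kar_typing(1)[OF xss(2)] p(4) by simp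
  ultimately show ?case
    using IH xss word_append(2)[OF p(1,2) xss(2), of "concat yss"] by (simp add: p(4))
qed simp

text \<open>
  The right-hand side is the distributivity map of a multiproduct in \<open>\<^bold>P\<close>, so together with the two
  preceding lemmas this says that substituting words into a word yields their concatenation. The
  block containing the variable is reached by splitting off the blocks before it with
  \<open>word_dist_append_right\<close>; there, \<open>word_dist_append_left\<close> separates it from those behind it.
\<close>

lemma word_dist_concat:
  assumes "list_all2 (\<lambda>b W. pth (src b) W (tgt b)) bs Ws" "pth u bs v"
    "list_all2 (\<lambda>W xs. xs \<in> Obs W) Ws xss"
    "j < length bs" "p < length (Ws ! j)" "x' \<in> Obj (Cat (Ws ! j ! p))"
  defines "ap \<equiv> map2 kob (words bs Ws) xss"
  shows "kdist (word v (concat Ws)) (sum_list (take j (map length Ws)) + p) (concat xss) x'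
    = Cmp (K u v)
        (kar (word v bs) ((Idt (prod_cat (map Cat bs)) ap)[j := kdist (words bs Ws ! j) p (xss ! j) x']))
        (kdist (word v bs) j ap (kob (words bs Ws ! j) ((xss ! j)[p := x'])))"
  using assms(1-6) unfolding ap_def
proof (induction arbitrary: u xss j rule: list_all2_induct)
  case (Cons b bs W Ws)
  then obtain xs yss where xss: "xss = xs # yss" "xs \<in> Obs W"
    "list_all2 (\<lambda>W xs. xs \<in> Obs W) Ws yss" by (auto simp: list_all2_Cons1)
  have p: "pth (src b) W (tgt b)" "pth (tgt b) (concat Ws) v" "pth (tgt b) bs v" "src b = u"
    using Cons path_concat[OF Cons.hyps(2)] by auto
  have le: "u \<le> tgt b" "tgt b \<le> v" using p pth_le src_le_tgt[of b] by auto
  interpret W: multilinear "map Cat W" "Cat b" "word (tgt b) W" using multilinear_word p(1) .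
  interpret bs: multilinear "map Cat bs" "K (tgt b) v" "word v bs" using multilinear_word p(3) .
  interpret t: pairing_functor "K u (tgt b)" "K (tgt b) v" "K u v" "T u (tgt b) v" using le by (intro pairing_functor_T)
  have c: "kob (word v (concat Ws)) (concat yss) = kob (word v bs) (map2 kob (words bs Ws) yss)"
    "map2 kob (words bs Ws) yss \<in> Obs bs"
    "concat yss \<in> Obs (concat Ws)"
    using word_concat[OF Cons.hyps(2) p(3) xss(3)] by auto
  let ?ys = "map2 kob (words bs Ws) yss" and ?A = "kob (word (tgt b) W) xs"
  have A: "?A \<in> Obj (K u (tgt b))" using xss(2) p(4) by auto
  show ?case
  proof (cases j)
    case 0
    have q: "p < length W" "x' \<in> Obj (Cat (W ! p))" using Cons.prems 0 by simp_all
    have d: "kdist (word (tgt b) W) p xs x' \<in> Arr (K u (tgt b))" "kob (word (tgt b) W) (xs[p := x']) \<in> Obj (K u (tgt b))"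
      using xss(2) q W.kdist_typing(1)[of xs p x'] W.kob_closed[of "xs[p := x']"] p(4) by simp_all
    show ?thesis
      using word_dist_append_left[OF p(1,2) q(1) xss(2) c(3) q(2)] xss(1) c A d
      by (simp add: 0 p(4))
  next
    case (Suc k)
    have q: "k < length bs" "p < length (Ws ! k)" "x' \<in> Obj (Cat (Ws ! k ! p))" using Cons.prems Suc by simp_all
    have k: "k < length Ws" "k < length yss"
      using q list_all2_lengthD[OF Cons.hyps(2)] list_all2_lengthD[OF xss(3)] by simp_all
    let ?m = "sum_list (take k (map length Ws)) + p"
    have lens: "map length yss = map length Ws"
      using xss(3) by (auto intro!: nth_equalityI simp: list_all2_conv_all_nth dest!: prod_cat_length)
    have lk: "length (yss ! k) = length (Ws ! k)"
      using arg_cong[OF lens, of "\<lambda>l. l ! k"] k by simp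
    have m: "?m < length (concat Ws)" "concat Ws ! ?m = Ws ! k ! p"
      using offset_less[of k "map length Ws" p] concat_nth_offset[of k Ws p] k q by (simp_all add: length_concat)
    have pk: "pth (src (bs ! k)) (Ws ! k) (tgt (bs ! k))"
      using Cons.hyps(2) q(1) by (simp add: list_all2_conv_all_nth)
    interpret Wk: multilinear "map Cat (Ws ! k)" "Cat (bs ! k)" "word (tgt (bs ! k)) (Ws ! k)"
      using multilinear_word pk .
    let ?d = "kdist (words bs Ws ! k) p (yss ! k) x'" and ?x = "kob (words bs Ws ! k) ((yss ! k)[p := x'])"
    have ys: "yss ! k \<in> Obs (Ws ! k)"
      using xss(3) k by (simp add: list_all2_conv_all_nth)
    have x: "?x \<in> Obj (Cat (bs ! k))" using q k ys by (simp add: Wk.kob_closed)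
    have yk: "?ys ! k = kob (words bs Ws ! k) (yss ! k)" using q k by simp
    have d: "?d \<in> Arr (Cat (bs ! k))" "Dom (Cat (bs ! k)) ?d = osum (Cat (bs ! k)) (?ys ! k) ?x"
      "Cod (Cat (bs ! k)) ?d = kob (words bs Ws ! k) ((yss ! k)[p := osum (Cat (Ws ! k ! p)) (yss ! k ! p) x'])"
      unfolding yk using q k ys Wk.kdist_typing[of "yss ! k" p x'] by simp_all
    let ?I = "(Idt (prod_cat (map Cat bs)) ?ys)[k := ?d]"
    have I: "?I \<in> Ars bs"
      using c(2) d q by simp
    have DI: "Dom (prod_cat (map Cat bs)) ?I = ?ys[k := osum (Cat (bs ! k)) (?ys ! k) ?x]"
      using c(2) d q by (simp add: prod_cat_Dom_update)
    have upd: "concat (yss[k := (yss ! k)[p := x']]) = (concat yss)[?m := x']"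
      using concat_update_offset[of k yss p x'] k q lk by (simp add: lens)
    have map_upd: "map2 kob (words bs Ws) (yss[k := (yss ! k)[p := x']]) = ?ys[k := ?x]"
      using q k by (auto intro!: nth_equalityI simp: nth_list_update)
    have l2: "list_all2 (\<lambda>W xs. xs \<in> Obs W) Ws (yss[k := (yss ! k)[p := x']])"
      using xss(3) k ys q(2,3) by (auto simp: list_all2_conv_all_nth nth_list_update)
    have c': "kob (word v (concat Ws)) ((concat yss)[?m := x']) = kob (word v bs) (?ys[k := ?x])"
      using word_concat[OF Cons.hyps(2) p(3) l2] unfolding upd map_upd by blast
    have ap: "?ys[k := ?x] \<in> Obs bs" using c(2) x q by simp
    have R: "kdist (word v bs) k ?ys ?x \<in> Arr (K (tgt b) v)"
      "Cod (K (tgt b) v) (kdist (word v bs) k ?ys ?x) = kob (word v bs) (?ys[k := osum (Cat (bs ! k)) (?ys ! k) ?x])"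
      "Dom (K (tgt b) v) (kdist (word v bs) k ?ys ?x) = osum (K (tgt b) v) (kob (word v bs) ?ys) (kob (word v bs) (?ys[k := ?x]))"
      using bs.kdist_typing[OF c(2), of k ?x] q(1) x by simp_all
    have "kdist (word v (concat (W # Ws))) (sum_list (take j (map length (W # Ws))) + p) (concat xss) x'
      = kdist (word v (W @ concat Ws)) (length W + ?m) (xs @ concat yss) x'"
      using xss(1) Suc by (simp add: add.assoc)
    also have "\<dots> = Cmp (K u v) (par (T u (tgt b) v) (Idt (K u (tgt b)) ?A) (kdist (word v (concat Ws)) ?m (concat yss) x'))
        (pdr (T u (tgt b) v) ?A (kob (word v bs) ?ys) (kob (word v bs) (?ys[k := ?x])))"
      using word_dist_append_right[OF p(1,2) m(1) xss(2) c(3), of x'] q(3) m(2) p(4) c(1) c' by simp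
    also have "kdist (word v (concat Ws)) ?m (concat yss) x'
        = Cmp (K (tgt b) v) (kar (word v bs) ?I) (kdist (word v bs) k ?ys ?x)"
      using Cons.IH[OF p(3) xss(3) q] .
    also have "Cmp (K u v) (par (T u (tgt b) v) (Idt (K u (tgt b)) ?A) \<dots>)
        (pdr (T u (tgt b) v) ?A (kob (word v bs) ?ys) (kob (word v bs) (?ys[k := ?x])))
      = Cmp (K u v) (par (T u (tgt b) v) (Idt (K u (tgt b)) ?A) (kar (word v bs) ?I))
         (Cmp (K u v) (par (T u (tgt b) v) (Idt (K u (tgt b)) ?A) (kdist (word v bs) k ?ys ?x))
        (pdr (T u (tgt b) v) ?A (kob (word v bs) ?ys) (kob (word v bs) (?ys[k := ?x]))))"
      using A I DI R c(2) ap bs.kar_typing[OF I] by (simp add: t.par_Cmp_right)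
    also have "\<dots> = Cmp (K u v)
        (kar (word v (b # bs)) ((Idt (prod_cat (map Cat (b # bs))) (?A # ?ys))[Suc k := ?d]))
        (kdist (word v (b # bs)) (Suc k) (?A # ?ys) ?x)"
      using A I c(2) q x p(4) by simp
    finally show ?thesis using xss(1) k q Suc by simp
  qed
qed simp

end

section \<open>Identity cells\<close>

lemma klin_cat_simps:
  "f \<in> Obj (klin_cat Cs D) \<longleftrightarrow> klinear Cs D f"
  "u \<in> Arr (klin_cat Cs D) \<longleftrightarrow> klin_trans Cs D (fst u) (fst (snd u)) (snd (snd u))"
  "Dom (klin_cat Cs D) u = fst u" "Cod (klin_cat Cs D) u = fst (snd u)"
  "Idt (klin_cat Cs D) f = (f, f, \<lambda>cs \<in> Obj (prod_cat Cs). Idt D (kob f cs))"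
  by (auto simp: klin_cat_def case_prod_beta)

lemma (in multilinear) Idt_klin_cat:
  "Idt (klin_cat Cs D) f \<in> hom (klin_cat Cs D) f f"
  "Cmp (klin_cat Cs D) (Idt (klin_cat Cs D) f) (Idt (klin_cat Cs D) f) = Idt (klin_cat Cs D) f"
proof -
  have "klin_trans Cs D f f (\<lambda>cs \<in> Obj (prod_cat Cs). Idt D (kob f cs))"
  proof (rule klin_trans.intro)
    show "klinear Cs D f" by unfold_locales
    then show "klinear Cs D f" .
  next
    fix us cs es assume "us \<in> hom (prod_cat Cs) cs es"
    then have "us \<in> Arr (prod_cat Cs)" "cs = Dom (prod_cat Cs) us" "es = Cod (prod_cat Cs) us"
      by (auto simp: hom_iff)
    then show "Cmp D ((\<lambda>cs \<in> Obj (prod_cat Cs). Idt D (kob f cs)) es) (kar f us)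
        = Cmp D (kar f us) ((\<lambda>cs \<in> Obj (prod_cat Cs). Idt D (kob f cs)) cs)"
      by simp
  qed (auto simp: hom_iff prod_cat_nth)
  then show "Idt (klin_cat Cs D) f \<in> hom (klin_cat Cs D) f f"
    by (simp add: hom_iff klin_cat_simps)
  show "Cmp (klin_cat Cs D) (Idt (klin_cat Cs D) f) (Idt (klin_cat Cs D) f) = Idt (klin_cat Cs D) f"
    by (auto simp: klin_cat_def restrict_def)
qed

lemma kcell_act_Idt:
  assumes "\<sigma> permutes {..<length Cs}"
  shows "kcell_act Cs \<sigma> (Idt (klin_cat Cs D) f) = Idt (klin_cat (permute_list \<sigma> Cs) D) (klin_act Cs \<sigma> f)"
  using permute_prod_cat_Obj[OF assms]
  by (auto simp: klin_cat_simps kcell_act_def klin_act_simps restrict_def)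

text \<open>
  The multicategories to be mapped to \<open>\<^bold>P\<close> are discrete, so identity cells are the only ones to which a
  multifunctor has to be applied, and it is enough that the multiproduct of identities is an identity.
\<close>

lemma kcell_comp_Idt:
  assumes g: "multilinear Bs C g" and len: "length Ass = length Bs" "length fs = length Bs"
    and fs: "\<And>j. j < length Bs \<Longrightarrow> klinear (Ass ! j) (Bs ! j) (fs ! j)"
    and us: "us = map (\<lambda>j. Idt (klin_cat (Ass ! j) (Bs ! j)) (fs ! j)) [0..<length Bs]"
  shows "kcell_comp Ass Bs C (Idt (klin_cat Bs C) g) us
    = Idt (klin_cat (concat Ass) C) (klin_comp Ass Bs C g fs)"
proof -
  interpret g: multilinear Bs C g by fact
  have fst: "map fst us = fs" "map (fst \<circ> snd) us = fs"
    using len unfolding us by (auto intro!: nth_equalityI simp: klin_cat_simps)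
  have pt: "Cmp C ((\<lambda>cs \<in> Obj (prod_cat Bs). Idt C (kob g cs)) (map2 kob fs (blocks (map length Ass) xs)))
      (kar g (map2 (\<lambda>\<phi> ys. \<phi> ys) (map (snd \<circ> snd) us) (blocks (map length Ass) xs)))
      = Idt C (kob (klin_comp Ass Bs C g fs) xs)"
    if xs: "xs \<in> Obj (prod_cat (concat Ass))" for xs
  proof -
    let ?b = "blocks (map length Ass) xs"
    have b: "list_all2 (\<lambda>As ys. ys \<in> Obj (prod_cat As)) Ass ?b" using list_all2_blocks[of "\<lambda>C x. x \<in> Obj C" Ass xs] xs by (simp add: prod_cat_simps)
    have lb: "length ?b = length Bs" using list_all2_lengthD[OF b] len by simp
    have bj: "?b ! j \<in> Obj (prod_cat (Ass ! j))" if "j < length Bs" for j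
      using list_all2_nthD[OF b, of j] that len by simp
    have kob: "kob (fs ! j) (?b ! j) \<in> Obj (Bs ! j)" if "j < length Bs" for j
      using cfunctor.obj[OF klinear.functorial[OF fs[OF that]] bj[OF that]] .
    have ap: "map2 kob fs ?b \<in> Obj (prod_cat Bs)"
      using kob lb len by (simp add: prod_cat_simps list_all2_conv_all_nth)
    have "map2 (\<lambda>\<phi> ys. \<phi> ys) (map (snd \<circ> snd) us) ?b = Idt (prod_cat Bs) (map2 kob fs ?b)"
      unfolding us using kob bj lb len
      by (auto intro!: nth_equalityI simp: prod_cat_simps klin_cat_simps)
    with ap xs show ?thesis by (simp add: klin_comp_def Let_def)
  qed
  show ?thesis
    unfolding kcell_comp_def klin_cat_simps(5) Let_def prod.case fst
    by (intro arg_cong2[of _ _ _ _ Pair] refl restrict_ext pt)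
qed

section \<open>The multifunctor of a tensor system\<close>

text \<open>
  The multimorphisms common to \<open>\<Sigma>\<^sub>*\<close>, where a single loop makes every permutation admissible, and to
  \<open>\<^bold>B\<^sup>\<Sigma>\<^sup>*\<close>. They are closed under the operations of \<open>\<Sigma>\<^sub>*\<close> because substituting paths for the edges of a
  path yields a path.
\<close>

definition path_hom :: "('c \<Rightarrow> 'v) \<Rightarrow> ('c \<Rightarrow> 'v) \<Rightarrow> 'c list \<Rightarrow> 'c \<Rightarrow> (nat \<Rightarrow> nat) set" where
  "path_hom src tgt Cs c =
    {\<sigma> \<in> Sym_set (length Cs). path src tgt (src c) (permute_list (inv \<sigma>) Cs) (tgt c)}"

lemma path_homD:
  assumes "\<sigma> \<in> path_hom src tgt Cs c"
  shows "\<sigma> permutes {..<length Cs}" "path src tgt (src c) (permute_list (inv \<sigma>) Cs) (tgt c)"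
  using assms by (auto simp: path_hom_def Sym_set_def)

lemma path_hom_act:
  assumes "\<sigma> \<in> path_hom src tgt Cs c" "\<tau> permutes {..<length Cs}"
  shows "\<sigma> \<circ> \<tau> \<in> path_hom src tgt (permute_list \<tau> Cs) c"
    and "permute_list (inv (\<sigma> \<circ> \<tau>)) (permute_list \<tau> Cs) = permute_list (inv \<sigma>) Cs"
proof -
  note \<sigma> = path_homD[OF assms(1)]
  have "permute_list (inv (\<sigma> \<circ> \<tau>)) (permute_list \<tau> Cs)
      = permute_list (inv \<sigma>) (permute_list (inv \<tau>) (permute_list \<tau> Cs))"
    using \<sigma>(1) assms(2) by (intro permute_list_inv_compose) simp_all
  also have "permute_list (inv \<tau>) (permute_list \<tau> Cs) = Cs"
    using assms(2) by (simp add: permute_list_compose[symmetric] permutes_inv permutes_inv_o)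
  finally show eq: "permute_list (inv (\<sigma> \<circ> \<tau>)) (permute_list \<tau> Cs) = permute_list (inv \<sigma>) Cs" .
  show "\<sigma> \<circ> \<tau> \<in> path_hom src tgt (permute_list \<tau> Cs) c"
    using \<sigma> assms(2) by (simp add: path_hom_def Sym_set_def eq permutes_compose)
qed

lemma path_hom_id: "id \<in> path_hom src tgt [c] c"
  by (simp add: path_hom_def Sym_set_def permutes_id)

lemma path_hom_comp:
  assumes "\<sigma> \<in> path_hom src tgt bs c" "length ass = length bs" "length \<phi>s = length bs"
    and "\<And>j. j < length bs \<Longrightarrow> \<phi>s ! j \<in> path_hom src tgt (ass ! j) (bs ! j)"
  defines "js \<equiv> map length ass"
    and "bs' \<equiv> permute_list (inv \<sigma>) bs"
    and "Ws \<equiv> rearrange \<sigma> \<phi>s ass"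
  shows "list_all2 (\<lambda>b W. path src tgt (src b) W (tgt b)) bs' Ws"
    and "permute_list (inv (Sym_comp js \<sigma> \<phi>s)) (concat ass) = concat Ws"
    and "Sym_comp js \<sigma> \<phi>s \<in> path_hom src tgt (concat ass) c"
proof -
  note \<sigma> = path_homD[OF assms(1)]
  have \<phi>s: "(\<phi>s ! j) permutes {..<js ! j}" if "j < length js" for j
    using path_homD(1)[OF assms(4)] that assms(2) by (simp add: js_def)
  have \<sigma>': "\<sigma> permutes {..<length js}" using \<sigma>(1) assms(2) by (simp add: js_def)
  show paths: "list_all2 (\<lambda>b W. path src tgt (src b) W (tgt b)) bs' Ws"
    unfolding list_all2_conv_all_nth
  proof (intro conjI allI impI)
    fix i assume "i < length bs'"
    then have i: "i < length bs" by (simp add: bs'_def)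
    note r = rearrange_nth[of \<sigma> \<phi>s ass i, unfolded assms(3), OF \<sigma>(1) assms(2) i]
    show "path src tgt (src (bs' ! i)) (Ws ! i) (tgt (bs' ! i))"
      using path_homD(2)[OF assms(4)[OF r(1)]] r(2) \<sigma>(1) i
      by (simp add: bs'_def Ws_def permute_list_nth permutes_inv)
  qed (simp add: bs'_def Ws_def assms(2,3))
  show eq: "permute_list (inv (Sym_comp js \<sigma> \<phi>s)) (concat ass) = concat Ws"
    unfolding Ws_def by (rule permute_Sym_comp[OF \<sigma>' \<phi>s]) (simp_all add: js_def assms(2,3))
  have "length (concat ass) = sum_list js" by (simp add: js_def length_concat)
  then show "Sym_comp js \<sigma> \<phi>s \<in> path_hom src tgt (concat ass) c"
    using Sym_comp_permutes[OF \<sigma>' \<phi>s] path_concat[OF paths, of "src c" "tgt c"] \<sigma>(2)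
    by (simp add: path_hom_def Sym_set_def eq bs'_def)
qed

context tensor_system
begin

text \<open>
  Input \<open>i\<close> is the letter in place \<open>\<sigma>(i)\<close> of the word \<open>W\<close>.
\<close>

definition word_mor :: "'c list \<Rightarrow> 'c \<Rightarrow> (nat \<Rightarrow> nat) \<Rightarrow> ('o, 'a) klin" where
  "word_mor Cs c \<sigma> =
    (let W = permute_list (inv \<sigma>) Cs in klin_act (map Cat W) \<sigma> (word (tgt c) W))"

lemma permute_Cat:
  assumes "\<sigma> permutes {..<length Cs}"
  shows "permute_list \<sigma> (map Cat (permute_list (inv \<sigma>) Cs)) = map Cat Cs"
  using assms
  by (simp add: permute_list_map permute_list_compose[symmetric] permutes_inv_o)

lemma word_mor_simps:
  assumes "\<sigma> permutes {..<length Cs}"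
  shows "xs \<in> Obs Cs
      \<Longrightarrow> kob (word_mor Cs c \<sigma>) xs = kob (word (tgt c) (permute_list (inv \<sigma>) Cs)) (permute_list (inv \<sigma>) xs)"
    and "us \<in> Ars Cs
      \<Longrightarrow> kar (word_mor Cs c \<sigma>) us = kar (word (tgt c) (permute_list (inv \<sigma>) Cs)) (permute_list (inv \<sigma>) us)"
    and "i < length Cs \<Longrightarrow> xs \<in> Obs Cs \<Longrightarrow> x' \<in> Obj (Cat (Cs ! i))
      \<Longrightarrow> kdist (word_mor Cs c \<sigma>) i xs x'
          = kdist (word (tgt c) (permute_list (inv \<sigma>) Cs)) (\<sigma> i) (permute_list (inv \<sigma>) xs) x'"
  using permute_Cat[OF assms] by (simp_all add: word_mor_def Let_def klin_act_simps)

lemma multilinear_word_mor: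
  assumes "\<sigma> \<in> path_hom src tgt Cs c"
  shows "multilinear (map Cat Cs) (Cat c) (word_mor Cs c \<sigma>)"
proof -
  note \<sigma> = path_homD[OF assms]
  have "klinear (map Cat Cs) (Cat c) (word_mor Cs c \<sigma>)"
    using klinear_act[OF multilinear_word[OF \<sigma>(2)], of \<sigma>] \<sigma>(1) permute_Cat[OF \<sigma>(1)]
    by (simp add: word_mor_def Let_def)
  then show ?thesis
    using permutative_K src_le_tgt by (auto simp: multilinear_def multilinear_axioms_def)
qed

lemma word_mor_ext:
  "\<sigma> permutes {..<length Cs} \<Longrightarrow> xs \<notin> Obs Cs \<Longrightarrow> kob (word_mor Cs c \<sigma>) xs = undefined"
  "\<sigma> permutes {..<length Cs} \<Longrightarrow> us \<notin> Ars Cs \<Longrightarrow> kar (word_mor Cs c \<sigma>) us = undefined"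
  "\<sigma> permutes {..<length Cs} \<Longrightarrow> \<not> (i < length Cs \<and> xs \<in> Obs Cs \<and> x' \<in> Obj (Cat (Cs ! i)))
    \<Longrightarrow> kdist (word_mor Cs c \<sigma>) i xs x' = undefined"
  using permute_Cat[of \<sigma> Cs] by (auto simp: word_mor_def Let_def klin_act_def)

lemma word_mor_unit: "word_mor [c] c id = klin_id (Cat c)"
proof -
  have p: "id permutes {..<length [c]}" by (simp add: permutes_id)
  interpret C: permutative "Cat c" using permutative_K src_le_tgt .
  interpret right_unital "Cat c" "K (tgt c) (tgt c)" "T (src c) (tgt c) (tgt c)" "U (tgt c)"
    using src_le_tgt by (rule right_unital_T)
  show ?thesis
  proof (rule klin_eqI)
    fix xs show "kob (word_mor [c] c id) xs = kob (klin_id (Cat c)) xs"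
    proof (cases "xs \<in> Obs [c]")
      case True
      then obtain x where "xs = [x]" "x \<in> Obj (Cat c)" by (auto elim!: prod_cat_ConsE)
      with True word_mor_simps(1)[OF p True] show ?thesis by (simp add: klin_id_def ob_unit)
    qed (use word_mor_ext(1)[OF p] in \<open>simp add: klin_id_def\<close>)
  next
    fix us show "kar (word_mor [c] c id) us = kar (klin_id (Cat c)) us"
    proof (cases "us \<in> Ars [c]")
      case True
      then obtain u where "us = [u]" "u \<in> Arr (Cat c)" by (auto elim!: prod_cat_Arr_ConsE)
      with True word_mor_simps(2)[OF p True] show ?thesis by (simp add: klin_id_def ar_unit)
    qed (use word_mor_ext(2)[OF p] in \<open>simp add: klin_id_def\<close>)
  next
    fix i xs x' show "kdist (word_mor [c] c id) i xs x' = kdist (klin_id (Cat c)) i xs x'"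
    proof (cases "i < length [c] \<and> xs \<in> Obs [c] \<and> x' \<in> Obj (Cat ([c] ! i))")
      case True
      then obtain x where "xs = [x]" "x \<in> Obj (Cat c)" by (auto elim!: prod_cat_ConsE)
      moreover have "i = 0" "x' \<in> Obj (Cat c)" using True by auto
      ultimately show ?thesis
        using word_mor_simps(3)[OF p, of 0 "[x]" x' c] by (simp add: klin_id_def dl_unit)
    next
      case False
      then show ?thesis using word_mor_ext(3)[OF p, of i xs x' c] by (auto simp: klin_id_def)
    qed
  qed
qed

lemma word_mor_act:
  assumes "\<sigma> \<in> path_hom src tgt Cs c" "\<tau> permutes {..<length Cs}"
  shows "word_mor (permute_list \<tau> Cs) c (\<sigma> \<circ> \<tau>) = klin_act (map Cat Cs) \<tau> (word_mor Cs c \<sigma>)"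
  unfolding word_mor_def Let_def path_hom_act(2)[OF assms]
  using klin_act_act[of \<sigma> "map Cat (permute_list (inv \<sigma>) Cs)" \<tau>] permute_Cat[of \<sigma> Cs] path_homD(1)[OF assms(1)] assms(2)
  by simp

context
  fixes bs :: "'c list" and c :: 'c and ass :: "'c list list" and \<sigma> :: "nat \<Rightarrow> nat" and \<phi>s :: "(nat \<Rightarrow> nat) list"
  assumes \<sigma>: "\<sigma> \<in> path_hom src tgt bs c" and len: "length ass = length bs" "length \<phi>s = length bs"
    and \<phi>s: "\<And>j. j < length bs \<Longrightarrow> \<phi>s ! j \<in> path_hom src tgt (ass ! j) (bs ! j)"
begin

private abbreviation "js \<equiv> map length ass"
private abbreviation "\<tau> \<equiv> Sym_comp js \<sigma> \<phi>s"
private abbreviation "outer \<equiv> permute_list (inv \<sigma>) bs"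
private abbreviation "inner \<equiv> rearrange \<sigma> \<phi>s ass"
private abbreviation "fs \<equiv> map (\<lambda>j. word_mor (ass ! j) (bs ! j) (\<phi>s ! j)) [0..<length bs]"
private abbreviation "whole \<equiv> klin_comp (map (map Cat) ass) (map Cat bs) (Cat c) (word_mor bs c \<sigma>) fs"

private lemma \<sigma>D: "\<sigma> permutes {..<length bs}" "\<sigma> permutes {..<length js}" "\<sigma> permutes {..<length \<phi>s}"
    "pth (src c) outer (tgt c)"
  using path_homD[OF \<sigma>] len by simp_all

private lemma \<phi>D: "j < length bs \<Longrightarrow> (\<phi>s ! j) permutes {..<length (ass ! j)}"
  using path_homD(1)[OF \<phi>s] .

private lemma \<phi>j: "j < length js \<Longrightarrow> (\<phi>s ! j) permutes {..<js ! j}"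
  using \<phi>D len by simp

private lemmas comp = path_hom_comp[OF \<sigma> len \<phi>s]

private lemma \<tau>: "\<tau> permutes {..<length (concat ass)}"
  using path_homD(1)[OF comp(3)] .

private lemma prod_map:
  "xs \<in> Obs W \<longleftrightarrow> list_all2 (\<lambda>c x. x \<in> Obj (Cat c)) W xs"
  "us \<in> Ars W \<longleftrightarrow> list_all2 (\<lambda>c u. u \<in> Arr (Cat c)) W us"
  by (simp_all add: prod_cat_simps list.rel_map)

private lemma fs_simps:
  assumes "j < length bs"
  shows "xs \<in> Obs (ass ! j) \<Longrightarrow> kob (fs ! j) xs
      = kob (word (tgt (bs ! j)) (permute_list (inv (\<phi>s ! j)) (ass ! j))) (permute_list (inv (\<phi>s ! j)) xs)"
    and "us \<in> Ars (ass ! j) \<Longrightarrow> kar (fs ! j) us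
      = kar (word (tgt (bs ! j)) (permute_list (inv (\<phi>s ! j)) (ass ! j))) (permute_list (inv (\<phi>s ! j)) us)"
    and "multilinear (map Cat (ass ! j)) (Cat (bs ! j)) (fs ! j)"
  using word_mor_simps[OF \<phi>D[OF assms], where c = "bs ! j"] multilinear_word_mor[OF \<phi>s[OF assms]] assms by simp_all

text \<open>
  How the arguments of the two maps to be compared are related, for objects and for arrows at once: \<open>P\<close>
  is membership in the sets of objects or of arrows, and \<open>h\<close> is \<open>kob\<close> or \<open>kar\<close>. The concatenated word is
  applied to the rearranged blocks, and applying the inner words to these gives the permuted list of
  values of the inner maps.
\<close>

private lemma rearranged_arguments:
  assumes xs: "list_all2 P (concat ass) xs"
    and P: "\<And>j ys. j < length bs \<Longrightarrow> list_all2 P (ass ! j) ys \<Longrightarrow> P (bs ! j) (h (fs ! j) ys)"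
    and h: "\<And>j ys. j < length bs \<Longrightarrow> list_all2 P (ass ! j) ys \<Longrightarrow> h (fs ! j) ys =
       h (word (tgt (bs ! j)) (permute_list (inv (\<phi>s ! j)) (ass ! j))) (permute_list (inv (\<phi>s ! j)) ys)"
  defines "b \<equiv> blocks js xs"
  shows "list_all2 (list_all2 P) ass b" "concat b = xs" "map length b = js"
    "list_all2 (list_all2 P) inner (rearrange \<sigma> \<phi>s b)"
    "permute_list (inv \<tau>) xs = concat (rearrange \<sigma> \<phi>s b)"
    "map2 h (words outer inner) (rearrange \<sigma> \<phi>s b) = permute_list (inv \<sigma>) (map2 h fs b)"
    "list_all2 P bs (map2 h fs b)"
proof -
  show b: "list_all2 (list_all2 P) ass b" using list_all2_blocks[OF xs] by (simp add: b_def)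
  have bj: "list_all2 P (ass ! j) (b ! j)" if "j < length bs" for j
    using list_all2_nthD[OF b, of j] that len by simp
  have lb: "length b = length bs" using list_all2_lengthD[OF b] len by simp
  have "length xs = sum_list js" using list_all2_lengthD[OF xs] by (simp add: length_concat)
  from concat_blocks[OF this] show b': "concat b = xs" "map length b = js" by (simp_all add: b_def)
  show "permute_list (inv \<tau>) xs = concat (rearrange \<sigma> \<phi>s b)"
    using permute_Sym_comp[OF \<sigma>D(2) \<phi>j b'(2)] len b'(1) by simp
  have nth: "inv \<sigma> i < length bs" "inner ! i = permute_list (inv (\<phi>s ! inv \<sigma> i)) (ass ! inv \<sigma> i)"
    "rearrange \<sigma> \<phi>s b ! i = permute_list (inv (\<phi>s ! inv \<sigma> i)) (b ! inv \<sigma> i)" if "i < length bs" for i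
    using rearrange_nth[OF \<sigma>D(3), of _ i] that len lb by simp_all
  show "list_all2 (list_all2 P) inner (rearrange \<sigma> \<phi>s b)"
    unfolding list_all2_conv_all_nth[of "list_all2 P"]
    using nth len lb by (auto intro!: list_all2_permute bj permutes_inv \<phi>D)
  show "map2 h (words outer inner) (rearrange \<sigma> \<phi>s b) = permute_list (inv \<sigma>) (map2 h fs b)"
    using nth len lb h bj \<sigma>D(1) by (intro nth_equalityI) (simp_all add: permute_list_nth permutes_inv)
  show "list_all2 P bs (map2 h fs b)"
    using P bj lb by (intro list_all2_all_nthI) simp_all
qed

private lemma rearranged_Obj:
  assumes "xs \<in> Obs (concat ass)"
  defines "b \<equiv> blocks js xs"
  shows "list_all2 (\<lambda>W ys. ys \<in> Obs W) ass b" "concat b = xs" "map length b = js"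
    "list_all2 (\<lambda>W ys. ys \<in> Obs W) inner (rearrange \<sigma> \<phi>s b)"
    "permute_list (inv \<tau>) xs = concat (rearrange \<sigma> \<phi>s b)"
    "map2 kob (words outer inner) (rearrange \<sigma> \<phi>s b) = permute_list (inv \<sigma>) (map2 kob fs b)"
    "map2 kob fs b \<in> Obs bs"
  using rearranged_arguments[of "\<lambda>c x. x \<in> Obj (Cat c)" xs kob, folded prod_map, OF assms(1)
      multilinear.kob_closed[OF fs_simps(3)] fs_simps(1)]
  by (simp_all add: b_def prod_map)

private lemma rearranged_Arr:
  assumes "us \<in> Ars (concat ass)"
  defines "b \<equiv> blocks js us"
  shows "list_all2 (\<lambda>W ys. ys \<in> Ars W) inner (rearrange \<sigma> \<phi>s b)"
    "permute_list (inv \<tau>) us = concat (rearrange \<sigma> \<phi>s b)"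
    "map2 kar (words outer inner) (rearrange \<sigma> \<phi>s b) = permute_list (inv \<sigma>) (map2 kar fs b)"
    "map2 kar fs b \<in> Ars bs"
  using rearranged_arguments[of "\<lambda>c x. x \<in> Arr (Cat c)" us kar, folded prod_map, OF assms(1)
      multilinear.kar_typing(1)[OF fs_simps(3)] fs_simps(2)]
  by (simp_all add: b_def prod_map)

private lemma concat_Cat: "concat (map (map Cat) ass) = map Cat (concat ass)" "map length (map (map Cat) ass) = js"
  by (simp_all add: map_concat)

text \<open>
  The permutations only relabel: variable \<open>m\<close>, which is position \<open>p\<close> of block \<open>j\<close>, is position \<open>\<phi>\<^sub>j(p)\<close>
  of block \<open>\<sigma>(j)\<close> of the concatenated word. After relabelling the claim is \<open>word_dist_concat\<close>.
\<close>

private lemma dist_word_mor_comp: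
  assumes m: "m < length (concat ass)" and xs: "xs \<in> Obs (concat ass)"
    and x': "x' \<in> Obj (Cat (concat ass ! m))"
  shows "kdist (word_mor (concat ass) c \<tau>) m xs x' = kdist whole m xs x'"
proof -
  have "m < sum_list js" using m by (simp add: length_concat)
  then obtain j p where jp: "block_pos js m = (j, p)" "j < length js" "p < js ! j" "m = sum_list (take j js) + p"
    by (rule block_posE)
  define b ap where "b = blocks js xs" and "ap = map2 kob fs b"
  note R = rearranged_Obj[OF xs, folded b_def, folded ap_def]
  have j: "j < length bs" "p < length (ass ! j)" using jp len by simp_all
  have bj: "b ! j \<in> Obs (ass ! j)" "length b = length bs" "length (b ! j) = length (ass ! j)"
    using list_all2_nthD[OF R(1), of j] list_all2_lengthD[OF R(1)] j(1) len
      prod_cat_length[of "b ! j" "map Cat (ass ! j)"] by simp_all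
  have x'j: "x' \<in> Obj (Cat (ass ! j ! p))"
    using concat_nth_offset[of j ass p] jp x' by simp
  have \<sigma>j: "\<sigma> j < length bs" "inv \<sigma> (\<sigma> j) = j"
    using permutes_in_image[OF \<sigma>D(1), of j] j permutes_inverses[OF \<sigma>D(1)] by simp_all
  have pj: "(\<phi>s ! j) p < length (ass ! j)" using permutes_in_image[OF \<phi>D[OF j(1)], of p] j by simp
  have inner: "inner ! \<sigma> j = permute_list (inv (\<phi>s ! j)) (ass ! j)"
    and b'j: "rearrange \<sigma> \<phi>s b ! \<sigma> j = permute_list (inv (\<phi>s ! j)) (b ! j)"
    using rearrange_nth_image[OF \<sigma>D(3), of _ j] len j(1) bj(2) by simp_all
  have "words outer inner ! \<sigma> j = word (tgt (bs ! j)) (permute_list (inv (\<phi>s ! j)) (ass ! j))"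
    using \<sigma>j len inner \<sigma>D(1) by (simp add: permute_list_nth permutes_inv)
  note wj = this inner b'j
  have "map length inner = permute_list (inv \<sigma>) js"
    using rearrange_nth[OF \<sigma>D(3), of ass] len \<sigma>D(1)
    by (intro nth_equalityI) (simp_all add: permute_list_nth permutes_inv)
  then have \<tau>m: "\<tau> m = sum_list (take (\<sigma> j) (map length inner)) + (\<phi>s ! j) p"
    using Sym_comp_offset[OF \<sigma>D(2) \<phi>j jp(2,3)] jp(4) by simp
  let ?d = "kdist (fs ! j) p (b ! j) x'" and ?x = "kob (fs ! j) ((b ! j)[p := x'])"
  have bu: "(b ! j)[p := x'] \<in> Obs (ass ! j)" using bj x'j j by simp
  interpret fj: multilinear "map Cat (ass ! j)" "Cat (bs ! j)" "fs ! j" using fs_simps(3)[OF j(1)] .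
  interpret G: multilinear "map Cat bs" "Cat c" "word_mor bs c \<sigma>" using multilinear_word_mor \<sigma> .
  have d: "kdist (words outer inner ! \<sigma> j) ((\<phi>s ! j) p) (rearrange \<sigma> \<phi>s b ! \<sigma> j) x' = ?d"
    using word_mor_simps(3)[OF \<phi>D[OF j(1)] j(2) bj(1) x'j, of "bs ! j"] wj j(1) by simp
  have x: "kob (words outer inner ! \<sigma> j) ((rearrange \<sigma> \<phi>s b ! \<sigma> j)[(\<phi>s ! j) p := x']) = ?x"
    using fs_simps(1)[OF j(1) bu] wj \<phi>D[OF j(1)] bj j by (simp add: permute_list_update)
  have dT: "?d \<in> Arr (Cat (bs ! j))" "?x \<in> Obj (Cat (bs ! j))"
    using fj.kdist_typing(1)[OF bj(1), of p x'] x'j j(2) fj.kob_closed[OF bu] by simp_all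
  let ?I = "(Idt (prod_cat (map Cat bs)) ap)[j := ?d]"
  have IdT: "Idt (prod_cat (map Cat bs)) ap \<in> Ars bs" using R(7) by simp
  have I: "?I \<in> Ars bs" using IdT dT j by simp
  have permI: "permute_list (inv \<sigma>) ?I = (Idt (prod_cat (map Cat outer)) (permute_list (inv \<sigma>) ap))[\<sigma> j := ?d]"
    using permute_prod_cat_Idt[of \<sigma> "map Cat outer" ap] permute_Cat[OF \<sigma>D(1)] R(7) \<sigma>D(1) j
      permute_list_update[of \<sigma> "Idt (prod_cat (map Cat bs)) ap" j ?d] prod_cat_Arr_length[OF IdT] by simp
  have "kdist (word_mor (concat ass) c \<tau>) m xs x' = kdist (word (tgt c) (concat inner)) (\<tau> m) (concat (rearrange \<sigma> \<phi>s b)) x'"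
    using word_mor_simps(3)[OF \<tau> m xs x'] R(5) comp(2) by simp
  also have "\<dots> = Cmp (Cat c) (kar (word (tgt c) outer) (permute_list (inv \<sigma>) ?I))
      (kdist (word (tgt c) outer) (\<sigma> j) (permute_list (inv \<sigma>) ap) ?x)"
  proof -
    have 1: "\<sigma> j < length outer" "(\<phi>s ! j) p < length (inner ! \<sigma> j)" using \<sigma>j(1) pj inner by simp_all
    have 2: "x' \<in> Obj (Cat (inner ! \<sigma> j ! (\<phi>s ! j) p))"
      using inner x'j \<phi>D[OF j(1)] j(2) by (simp add: permute_list_inv_nth)
    show ?thesis
      using word_dist_concat[OF comp(1) \<sigma>D(4) R(4) 1 2] unfolding \<tau>m R(6) d x permI .
  qed
  also have "\<dots> = Cmp (Cat c) (kar (word_mor bs c \<sigma>) ?I) (kdist (word_mor bs c \<sigma>) j ap ?x)"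
    using word_mor_simps(2)[OF \<sigma>D(1) I] word_mor_simps(3)[OF \<sigma>D(1) j(1) R(7) dT(2)] by simp
  also have "\<dots> = kdist whole m xs x'"
  proof -
    have "xs[m := x'] = concat (b[j := (b ! j)[p := x']])"
      using concat_update_offset[of j b p x'] R(2,3) bj j jp(4) by simp
    moreover have "map length (b[j := (b ! j)[p := x']]) = js"
      using R(3) bj j len by (simp add: map_update list_update_same_conv)
    ultimately have "blocks js (xs[m := x']) = b[j := (b ! j)[p := x']]"
      using blocks_concat[of "b[j := (b ! j)[p := x']]"] by simp
    then have ap': "map2 kob fs (blocks js (xs[m := x'])) ! j = ?x" using j bj(2) by simp
    have c1: "m < length (map Cat (concat ass)) \<and> xs \<in> Obs (concat ass)
        \<and> x' \<in> Obj (map Cat (concat ass) ! m)"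
      using m xs x' by simp
    show ?thesis
      unfolding klin_comp_def Let_def klin.simps concat_Cat if_P[OF c1] jp(1) prod.case ap' b_def[symmetric]
        ap_def[symmetric] ..
  qed
  finally show ?thesis .
qed

lemma word_mor_comp: "word_mor (concat ass) c \<tau> = whole"
proof (rule klin_eqI)
  fix xs
  have "kob (word_mor (concat ass) c \<tau>) xs = kob (word_mor bs c \<sigma>) (map2 kob fs (blocks js xs))"
    if xs: "xs \<in> Obs (concat ass)"
    using word_mor_simps(1)[OF \<tau> xs] comp(2) rearranged_Obj[OF xs]
      word_concat[OF comp(1) \<sigma>D(4) rearranged_Obj(4)[OF xs]]
      word_mor_simps(1)[OF \<sigma>D(1) rearranged_Obj(7)[OF xs], of c] by simp
  then show "kob (word_mor (concat ass) c \<tau>) xs = kob whole xs"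
    using word_mor_ext(1)[OF \<tau>, of xs c] unfolding klin_comp_def Let_def klin.simps concat_Cat by simp
next
  fix us
  have "kar (word_mor (concat ass) c \<tau>) us = kar (word_mor bs c \<sigma>) (map2 kar fs (blocks js us))"
    if us: "us \<in> Ars (concat ass)"
    using word_mor_simps(2)[OF \<tau> us] comp(2) rearranged_Arr[OF us]
      word_concat_Arr[OF comp(1) \<sigma>D(4) rearranged_Arr(1)[OF us]]
      word_mor_simps(2)[OF \<sigma>D(1) rearranged_Arr(4)[OF us], of c] by simp
  then show "kar (word_mor (concat ass) c \<tau>) us = kar whole us"
    using word_mor_ext(2)[OF \<tau>, of us c] unfolding klin_comp_def Let_def klin.simps concat_Cat by simp
next
  fix m xs x'
  show "kdist (word_mor (concat ass) c \<tau>) m xs x' = kdist whole m xs x'"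
  proof (cases "m < length (concat ass) \<and> xs \<in> Obs (concat ass) \<and> x' \<in> Obj (Cat (concat ass ! m))")
    case True
    then show ?thesis using dist_word_mor_comp by blast
  next
    case False
    then have "\<not> (m < length (map Cat (concat ass)) \<and> xs \<in> Obs (concat ass)
        \<and> x' \<in> Obj (map Cat (concat ass) ! m))" by auto
    then have "kdist whole m xs x' = undefined"
      unfolding klin_comp_def Let_def klin.simps concat_Cat by (simp only: if_False)
    then show ?thesis using word_mor_ext(3)[OF \<tau> False] by simp
  qed
qed

end

definition word_mfun :: "('c, nat \<Rightarrow> nat, nat \<Rightarrow> nat, ('o, 'a) permcat, ('o, 'a) klin, ('o, 'a) kcell) mfun" where
  "word_mfun =
    \<lparr>FOb = Cat,
     FMor = (\<lambda>Cs c. \<lambda>\<sigma> \<in> path_hom src tgt Cs c. word_mor Cs c \<sigma>),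
     FCell = (\<lambda>Cs c. \<lambda>\<sigma> \<in> path_hom src tgt Cs c. Idt (klin_cat (map Cat Cs) (Cat c)) (word_mor Cs c \<sigma>))\<rparr>"

theorem multifunctor_word_mfun: "multifunctor (Sym_multicat (path_hom src tgt)) Perm word_mfun"
proof (rule multifunctor.intro)
  let ?M = "Sym_multicat (path_hom src tgt)"
  have Mhom: "Obj (MHom ?M as b) = path_hom src tgt as b" "Arr (MHom ?M as b) = path_hom src tgt as b" for as b
    by (simp_all add: Sym_multicat_def discrete_cat_def)
  note S = Sym_multicat_def Perm_def word_mfun_def
  show "FOb word_mfun x \<in> MOb Perm" for x
    using permutative_K src_le_tgt by (simp add: S)
  show "cfunctor (MHom ?M as b) (MHom Perm (map (FOb word_mfun) as) (FOb word_mfun b))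
      (FMor word_mfun as b) (FCell word_mfun as b)" for as b
  proof -
    have "multilinear (map Cat as) (Cat b) (word_mor as b \<sigma>)" if "\<sigma> \<in> path_hom src tgt as b" for \<sigma>
      using multilinear_word_mor that .
    note m = multilinear.Idt_klin_cat[OF this] this[unfolded multilinear_def]
    show ?thesis
      by unfold_locales (auto simp: S discrete_cat_def m klin_cat_simps(1))
  qed
  show "FMor word_mfun [x] x (MUnit ?M x) = MUnit Perm (FOb word_mfun x)" for x
    by (simp add: S path_hom_id word_mor_unit)
  show "FMor word_mfun (permute_list \<tau> as) b (MAct ?M as b \<tau> f)
      = MAct Perm (map (FOb word_mfun) as) (FOb word_mfun b) \<tau> (FMor word_mfun as b f)"
    if "\<tau> permutes {..<length as}" "f \<in> Obj (MHom ?M as b)" for as b \<tau> f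
    using that path_hom_act(1)[of f src tgt as b \<tau>] word_mor_act[of f as b \<tau>] unfolding Mhom by (simp add: S)
  show "FCell word_mfun (permute_list \<tau> as) b (MAct2 ?M as b \<tau> f)
      = MAct2 Perm (map (FOb word_mfun) as) (FOb word_mfun b) \<tau> (FCell word_mfun as b f)"
    if "\<tau> permutes {..<length as}" "f \<in> Arr (MHom ?M as b)" for as b \<tau> f
    using that path_hom_act(1)[of f src tgt as b \<tau>] word_mor_act[of f as b \<tau>]
      kcell_act_Idt[of \<tau> "map Cat as" "Cat b" "word_mor as b f"]
    unfolding Mhom by (simp add: S permute_list_map)
  {
    fix bs c ass \<phi>s \<sigma>
    assume len: "length ass = length bs" "length \<phi>s = length bs"
      and \<phi>s: "\<And>j. j < length bs \<Longrightarrow> \<phi>s ! j \<in> path_hom src tgt (ass ! j) (bs ! j)"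
      and \<sigma>: "\<sigma> \<in> path_hom src tgt bs c"
    let ?fs = "map (\<lambda>j. word_mor (ass ! j) (bs ! j) (\<phi>s ! j)) [0..<length bs]"
    have fs: "map (\<lambda>j. FMor word_mfun (ass ! j) (bs ! j) (\<phi>s ! j)) [0..<length bs] = ?fs"
      using \<phi>s by (simp add: word_mfun_def)
    have C1: "FMor word_mfun (concat ass) c (MComp ?M ass bs c \<sigma> \<phi>s)
      = MComp Perm (map (map (FOb word_mfun)) ass) (map (FOb word_mfun) bs) (FOb word_mfun c) (FMor word_mfun bs c \<sigma>)
          (map (\<lambda>j. FMor word_mfun (ass ! j) (bs ! j) (\<phi>s ! j)) [0..<length bs])"
      unfolding fs using word_mor_comp[OF \<sigma> len \<phi>s] path_hom_comp(3)[OF \<sigma> len \<phi>s] \<sigma> by (simp add: S)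
    have us: "map (\<lambda>j. FCell word_mfun (ass ! j) (bs ! j) (\<phi>s ! j)) [0..<length bs]
        = map (\<lambda>j. Idt (klin_cat (map (map Cat) ass ! j) (map Cat bs ! j)) (?fs ! j)) [0..<length (map Cat bs)]"
      using \<phi>s len by (simp add: word_mfun_def)
    have "klinear (map (map Cat) ass ! j) (map Cat bs ! j) (?fs ! j)" if "j < length (map Cat bs)" for j
      using multilinear_word_mor[OF \<phi>s, of j] that len by (simp add: multilinear_def)
    from kcell_comp_Idt[OF multilinear_word_mor[OF \<sigma>] _ _ this us]
    have C2: "FCell word_mfun (concat ass) c (MComp2 ?M ass bs c \<sigma> \<phi>s)
      = MComp2 Perm (map (map (FOb word_mfun)) ass) (map (FOb word_mfun) bs) (FOb word_mfun c) (FCell word_mfun bs c \<sigma>)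
          (map (\<lambda>j. FCell word_mfun (ass ! j) (bs ! j) (\<phi>s ! j)) [0..<length bs])"
      unfolding us using len word_mor_comp[OF \<sigma> len \<phi>s] path_hom_comp(3)[OF \<sigma> len \<phi>s] \<sigma>
      by (simp add: Sym_multicat_def Perm_def word_mfun_def map_concat)
    note C1 C2
  }
  note C = this
  show "FMor word_mfun (concat ass) c (MComp ?M ass bs c \<sigma> \<phi>s)
      = MComp Perm (map (map (FOb word_mfun)) ass) (map (FOb word_mfun) bs) (FOb word_mfun c) (FMor word_mfun bs c \<sigma>)
          (map (\<lambda>j. FMor word_mfun (ass ! j) (bs ! j) (\<phi>s ! j)) [0..<length bs])"
    if "length ass = length bs" "length \<phi>s = length bs"
      "\<And>j. j < length bs \<Longrightarrow> set (ass ! j) \<subseteq> MOb ?M \<and> \<phi>s ! j \<in> Obj (MHom ?M (ass ! j) (bs ! j))"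
      "\<sigma> \<in> Obj (MHom ?M bs c)" for bs c ass \<phi>s \<sigma>
    using that unfolding Mhom by (intro C(1)) auto
  show "FCell word_mfun (concat ass) c (MComp2 ?M ass bs c \<sigma> \<phi>s)
      = MComp2 Perm (map (map (FOb word_mfun)) ass) (map (FOb word_mfun) bs) (FOb word_mfun c) (FCell word_mfun bs c \<sigma>)
          (map (\<lambda>j. FCell word_mfun (ass ! j) (bs ! j) (\<phi>s ! j)) [0..<length bs])"
    if "length ass = length bs" "length \<phi>s = length bs"
      "\<And>j. j < length bs \<Longrightarrow> set (ass ! j) \<subseteq> MOb ?M \<and> \<phi>s ! j \<in> Arr (MHom ?M (ass ! j) (bs ! j))"
      "\<sigma> \<in> Arr (MHom ?M bs c)" for bs c ass \<phi>s \<sigma>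
    using that unfolding Mhom by (intro C(2)) auto
qed (auto simp: Sym_multicat_def word_mfun_def discrete_cat_def)

end

section \<open>Bilinear maps and pairings\<close>

text \<open>
  Bilinear maps and distributive pairings are the same data with the same axioms: \<open>\<delta>\<close> in the first
  variable is \<open>d\<^sub>l\<close>, and in the second variable it is \<open>d\<^sub>r\<close>.
\<close>

locale bilinear = multilinear "[X, Y]" Z f for X Y Z :: "('o, 'a) permcat" and f :: "('o, 'a) klin"
begin

sublocale X: permutative X by (rule inputs) simp
sublocale Y: permutative Y by (rule inputs) simp

lemma kob_two [simp]: "x \<in> Obj X \<Longrightarrow> y \<in> Obj Y \<Longrightarrow> kob f [x, y] \<in> Obj Z"
  by simp

lemma kar_two [simp]:
  assumes "u \<in> Arr X" "v \<in> Arr Y"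
  shows "kar f [u, v] \<in> Arr Z" "Dom Z (kar f [u, v]) = kob f [Dom X u, Dom Y v]"
    "Cod Z (kar f [u, v]) = kob f [Cod X u, Cod Y v]"
  using assms kar_typing[of "[u, v]"] by simp_all

lemma kar_Idt_two [simp]: "x \<in> Obj X \<Longrightarrow> y \<in> Obj Y \<Longrightarrow> kar f [Idt X x, Idt Y y] = Idt Z (kob f [x, y])"
  using kar_Idt[of "[x, y]"] by simp

lemma kdist_first [simp]:
  assumes "x \<in> Obj X" "y \<in> Obj Y" "x' \<in> Obj X"
  shows "kdist f 0 [x, y] x' \<in> Arr Z" "Dom Z (kdist f 0 [x, y] x') = osum Z (kob f [x, y]) (kob f [x', y])"
    "Cod Z (kdist f 0 [x, y] x') = kob f [osum X x x', y]"
  using assms kdist_typing[of "[x, y]" 0 x'] by simp_all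

lemma kdist_second [simp]:
  assumes "x \<in> Obj X" "y \<in> Obj Y" "y' \<in> Obj Y"
  shows "kdist f (Suc 0) [x, y] y' \<in> Arr Z"
    "Dom Z (kdist f (Suc 0) [x, y] y') = osum Z (kob f [x, y]) (kob f [x, y'])"
    "Cod Z (kdist f (Suc 0) [x, y] y') = kob f [x, osum Y y y']"
  using assms kdist_typing[of "[x, y]" "Suc 0" y'] by simp_all

lemma ex_zero_iff: "(\<exists>j < Suc (Suc 0). [x, y] ! j = zero ([X, Y] ! j)) \<longleftrightarrow> x = zero X \<or> y = zero Y"
  by (simp add: Ex_less_Suc2)

lemma distributive_pairing_of: "distributive_pairing X Y Z (pairing_of f)"
proof (rule distributive_pairing.intro)
  let ?t = "pairing_of f"
  show "cfunctor (pair_cat X Y) Z (\<lambda>(x, y). pob ?t x y) (\<lambda>(u, v). par ?t u v)"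
  proof
    fix u v assume "u \<in> Arr (pair_cat X Y)" "v \<in> Arr (pair_cat X Y)" "Cod (pair_cat X Y) u = Dom (pair_cat X Y) v"
    then show "(\<lambda>(u, v). par ?t u v) (Cmp (pair_cat X Y) v u)
      = Cmp Z ((\<lambda>(u, v). par ?t u v) v) ((\<lambda>(u, v). par ?t u v) u)"
      using kar_Cmp[of "[fst u, snd u]" "[fst v, snd v]"]
      by (auto simp: pair_cat_def pairing_of_def map_prod_def)
  qed (auto simp: pair_cat_def pairing_of_def hom_iff)
  show "pob ?t (zero X) y = zero Z" if "y \<in> Obj Y" for y
    using ob_zero[of "[zero X, y]" 0] that by (simp add: pairing_of_def)
  show "pob ?t x (zero Y) = zero Z" if "x \<in> Obj X" for x
    using ob_zero[of "[x, zero Y]" 1] that by (simp add: pairing_of_def)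
  show "pdl ?t x x' y \<in> hom Z (osum Z (pob ?t x y) (pob ?t x' y))
      (pob ?t (osum X x x') y)" if "x \<in> Obj X" "x' \<in> Obj X" "y \<in> Obj Y" for x x' y
    using that by (simp add: pairing_of_def hom_iff)
  show "pdr ?t x y y' \<in> hom Z (osum Z (pob ?t x y) (pob ?t x y'))
      (pob ?t x (osum Y y y'))" if "x \<in> Obj X" "y \<in> Obj Y" "y' \<in> Obj Y" for x y y'
    using that by (simp add: pairing_of_def hom_iff)
  show "Cmp Z (par ?t (asum X u u') v) (pdl ?t x x' y)
      = Cmp Z (pdl ?t w w' z) (asum Z (par ?t u v) (par ?t u' v))"
    if "u \<in> hom X x w" "u' \<in> hom X x' w'" "v \<in> hom Y y z" for u u' v x x' w w' y z
    using dist_natural[of "[u, v]" "[x, y]" "[w, z]" 0 u' x' w'] that by (simp add: pairing_of_def hom_iff)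
  show "Cmp Z (par ?t u (asum Y v v')) (pdr ?t x y y')
      = Cmp Z (pdr ?t w z z') (asum Z (par ?t u v) (par ?t u v'))"
    if "u \<in> hom X x w" "v \<in> hom Y y z" "v' \<in> hom Y y' z'" for u v v' x w y y' z z'
    using dist_natural[of "[u, v]" "[x, y]" "[w, z]" 1 v' y' z'] that by (simp add: pairing_of_def hom_iff)
  show "pdl ?t x x' y = Idt Z (pob ?t (osum X x x') y)"
    if "x \<in> Obj X" "x' \<in> Obj X" "y \<in> Obj Y" "x = zero X \<or> x' = zero X \<or> y = zero Y" for x x' y
    using dist_zero[of "[x, y]" 0 x'] that by (auto simp: pairing_of_def ex_zero_iff)
  show "pdr ?t x y y' = Idt Z (pob ?t x (osum Y y y'))"
    if "x \<in> Obj X" "y \<in> Obj Y" "y' \<in> Obj Y" "x = zero X \<or> y = zero Y \<or> y' = zero Y" for x y y'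
    using dist_zero[of "[x, y]" 1 y'] that by (auto simp: pairing_of_def ex_zero_iff)
  show "Cmp Z (pdl ?t (osum X x x') x'' y) (asum Z (pdl ?t x x' y) (Idt Z (pob ?t x'' y)))
      = Cmp Z (pdl ?t x (osum X x' x'') y) (asum Z (Idt Z (pob ?t x y)) (pdl ?t x' x'' y))"
    if "x \<in> Obj X" "x' \<in> Obj X" "x'' \<in> Obj X" "y \<in> Obj Y" for x x' x'' y
    using dist_assoc[of "[x, y]" 0 x' x''] that by (simp add: pairing_of_def)
  show "Cmp Z (pdr ?t x (osum Y y y') y'') (asum Z (pdr ?t x y y') (Idt Z (pob ?t x y'')))
      = Cmp Z (pdr ?t x y (osum Y y' y'')) (asum Z (Idt Z (pob ?t x y)) (pdr ?t x y' y''))"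
    if "x \<in> Obj X" "y \<in> Obj Y" "y' \<in> Obj Y" "y'' \<in> Obj Y" for x y y' y''
    using dist_assoc[of "[x, y]" 1 y' y''] that by (simp add: pairing_of_def)
  show "Cmp Z (par ?t (sym X x x') (Idt Y y)) (pdl ?t x x' y)
      = Cmp Z (pdl ?t x' x y) (sym Z (pob ?t x y) (pob ?t x' y))"
    if "x \<in> Obj X" "x' \<in> Obj X" "y \<in> Obj Y" for x x' y
    using dist_sym[of "[x, y]" 0 x'] that by (simp add: pairing_of_def)
  show "Cmp Z (par ?t (Idt X x) (sym Y y y')) (pdr ?t x y y')
      = Cmp Z (pdr ?t x y' y) (sym Z (pob ?t x y) (pob ?t x y'))"
    if "x \<in> Obj X" "y \<in> Obj Y" "y' \<in> Obj Y" for x y y'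
    using dist_sym[of "[x, y]" 1 y'] that by (simp add: pairing_of_def)
  show "Cmp Z (pdl ?t x x' (osum Y y y')) (asum Z (pdr ?t x y y') (pdr ?t x' y y'))
      = Cmp Z (Cmp Z (pdr ?t (osum X x x') y y') (asum Z (pdl ?t x x' y) (pdl ?t x x' y')))
          (asum Z (asum Z (Idt Z (pob ?t x y)) (sym Z (pob ?t x y') (pob ?t x' y)))
            (Idt Z (pob ?t x' y')))"
    if "x \<in> Obj X" "x' \<in> Obj X" "y \<in> Obj Y" "y' \<in> Obj Y" for x x' y y'
    using dist_interchange[of "[x, y]" 1 0 y' x'] that by (simp add: pairing_of_def)
qed

lemma pairing_ext_pairing_of: "pairing_ext X Y (pairing_of f)"
  using extensional_arb[OF ob_ext] extensional_arb[OF ar_ext] dist_ext[of 0] dist_ext[of 1]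
  by (auto simp: pairing_ext_def pairing_of_def)

end

text \<open>
  The pairing forgets the values on lists that are not of length two, and there bilinear maps are
  undefined.
\<close>

lemma bilinear_eqI:
  assumes "klinear [X, Y] Z f" "klinear [X, Y] Z g" "pairing_of f = pairing_of g"
  shows "f = g"
proof -
  have eq: "kob f [x, y] = kob g [x, y]" "kar f [u, v] = kar g [u, v]" "kdist f 0 [x, y] x' = kdist g 0 [x, y] x'"
    "kdist f (Suc 0) [x, y] y' = kdist g (Suc 0) [x, y] y'" for x y u v x' y'
    using assms(3) by (auto simp: pairing_of_def dest: fun_cong)
  show ?thesis
  proof (rule klin_eqI)
    fix xs show "kob f xs = kob g xs"
      using eq(1) klinear.ob_ext[OF assms(1)] klinear.ob_ext[OF assms(2)]
      by (cases "xs \<in> Obj (prod_cat [X, Y])") (auto simp: extensional_def elim!: prod_cat_ConsE)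
  next
    fix us show "kar f us = kar g us"
      using eq(2) klinear.ar_ext[OF assms(1)] klinear.ar_ext[OF assms(2)]
      by (cases "us \<in> Arr (prod_cat [X, Y])") (auto simp: extensional_def elim!: prod_cat_Arr_ConsE)
  next
    fix i xs x' show "kdist f i xs x' = kdist g i xs x'"
    proof (cases "i < length [X, Y] \<and> xs \<in> Obj (prod_cat [X, Y]) \<and> x' \<in> Obj ([X, Y] ! i)")
      case True
      then obtain x y where "xs = [x, y]" by (auto elim!: prod_cat_ConsE)
      moreover from True have "i = 0 \<or> i = Suc 0" by auto
      ultimately show ?thesis using eq(3,4) by auto
    next
      case False
      then show ?thesis
        using klinear.dist_ext[OF assms(1) False] klinear.dist_ext[OF assms(2) False] by simp
    qed
  qed
qed

lemma klin_id_simps [simp]: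
  "x \<in> Obj C \<Longrightarrow> kob (klin_id C) [x] = x" "u \<in> Arr C \<Longrightarrow> kar (klin_id C) [u] = u"
  "x \<in> Obj C \<Longrightarrow> x' \<in> Obj C \<Longrightarrow> kdist (klin_id C) 0 [x] x' = Idt C (osum C x x')"
  by (simp_all add: klin_id_def)

text \<open>
  The two sides of the equation are the trilinear maps \<open>x \<otimes> (y \<otimes> z)\<close> and \<open>(x \<otimes> y) \<otimes> z\<close>. Equality of
  their distributivity maps in the first, second and third variable is the agreement demanded of the
  pairings, because one of the two maps of which each \<open>\<delta>\<close> is composed is an identity whenever the
  variable lies in a block of length one.
\<close>

lemma associative_pairings_of:
  assumes "bilinear X Y V p" "bilinear V Z W q" "bilinear Y Z U r" "bilinear X U W s"
    and eq: "klin_comp [[X], [Y, Z]] [X, U] W s [klin_id X, r] = klin_comp [[X, Y], [Z]] [V, Z] W q [p, klin_id Z]"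
      (is "?l = ?r")
  shows "associative_pairings X Y Z W (pairing_of p) (pairing_of q) (pairing_of r) (pairing_of s)"
proof -
  interpret p: bilinear X Y V p by fact
  interpret q: bilinear V Z W q by fact
  interpret r: bilinear Y Z U r by fact
  interpret s: bilinear X U W s by fact
  note D = klin_comp_def Let_def pairing_of_def
  show ?thesis
  proof
    fix x y z assume "x \<in> Obj X" "y \<in> Obj Y" "z \<in> Obj Z"
    note a = this
    show "pob (pairing_of q) (pob (pairing_of p) x y) z = pob (pairing_of s) x (pob (pairing_of r) y z)"
      using arg_cong[OF eq, of "\<lambda>f. kob f [x, y, z]"] a by (simp add: D)
    show "pdl (pairing_of s) x x' (pob (pairing_of r) y z)
        = Cmp W (par (pairing_of q) (pdl (pairing_of p) x x' y) (Idt Z z))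
            (pdl (pairing_of q) (pob (pairing_of p) x y) (pob (pairing_of p) x' y) z)" if "x' \<in> Obj X" for x'
      using arg_cong[OF eq, of "\<lambda>f. kdist f 0 [x, y, z] x'"] a that by (simp add: D)
    show "pdr (pairing_of q) (pob (pairing_of p) x y) z z'
        = Cmp W (par (pairing_of s) (Idt X x) (pdr (pairing_of r) y z z'))
            (pdr (pairing_of s) x (pob (pairing_of r) y z) (pob (pairing_of r) y z'))" if "z' \<in> Obj Z" for z'
      using arg_cong[OF eq, of "\<lambda>f. kdist f (Suc (Suc 0)) [x, y, z] z'"] a that by (simp add: D)
    show "Cmp W (par (pairing_of q) (pdr (pairing_of p) x y y') (Idt Z z))
            (pdl (pairing_of q) (pob (pairing_of p) x y) (pob (pairing_of p) x y') z)
        = Cmp W (par (pairing_of s) (Idt X x) (pdl (pairing_of r) y y' z))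
            (pdr (pairing_of s) x (pob (pairing_of r) y z) (pob (pairing_of r) y' z))" if "y' \<in> Obj Y" for y'
      using arg_cong[OF eq, of "\<lambda>f. kdist f (Suc 0) [x, y, z] y'"] a that by (simp add: D)
  next
    fix u v w assume "u \<in> Arr X" "v \<in> Arr Y" "w \<in> Arr Z"
    then show "par (pairing_of q) (par (pairing_of p) u v) w = par (pairing_of s) u (par (pairing_of r) v w)"
      using arg_cong[OF eq, of "\<lambda>f. kar f [u, v, w]"] by (simp add: D)
  qed
qed

text \<open>
  Here the first block is empty: \<open>u\<close> is a multilinear map in no variables, that is, an object. The
  distributivity map of the composite is \<open>d\<^sub>r(e; y, y')\<close>, and that of \<open>klin_id Y\<close> is an identity.
\<close>

lemma left_unital_of:
  assumes "bilinear X Y Y f" "e \<in> Obj X" "kob u [] = e" "kar u [] = Idt X e"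
    and eq: "klin_comp [[], [Y]] [X, Y] Y f [u, klin_id Y] = klin_id Y"
  shows "left_unital X Y (pairing_of f) e"
proof -
  interpret f: bilinear X Y Y f by fact
  note D = klin_comp_def Let_def pairing_of_def
  have ob: "kob f [e, y] = y" if "y \<in> Obj Y" for y
    using arg_cong[OF eq, of "\<lambda>f. kob f [y]"] that assms(3) by (simp add: D)
  show ?thesis
  proof
    show "pob (pairing_of f) e y = y" if "y \<in> Obj Y" for y using ob that by (simp add: D)
    show "par (pairing_of f) (Idt X e) g = g" if "g \<in> Arr Y" for g
      using arg_cong[OF eq, of "\<lambda>f. kar f [g]"] that assms(4) by (simp add: D)
    show "pdr (pairing_of f) e y y' = Idt Y (osum Y y y')" if "y \<in> Obj Y" "y' \<in> Obj Y" for y y'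
      using arg_cong[OF eq, of "\<lambda>f. kdist f 0 [y] y'"] that assms(2,3) by (simp add: D ob)
  qed
qed

lemma right_unital_of:
  assumes "bilinear X Y X f" "e \<in> Obj Y" "kob u [] = e" "kar u [] = Idt Y e"
    and eq: "klin_comp [[X], []] [X, Y] X f [klin_id X, u] = klin_id X"
  shows "right_unital X Y (pairing_of f) e"
proof -
  interpret f: bilinear X Y X f by fact
  note D = klin_comp_def Let_def pairing_of_def
  have ob: "kob f [x, e] = x" if "x \<in> Obj X" for x
    using arg_cong[OF eq, of "\<lambda>f. kob f [x]"] that assms(3) by (simp add: D)
  show ?thesis
  proof
    show "pob (pairing_of f) x e = x" if "x \<in> Obj X" for x using ob that by (simp add: D)
    show "par (pairing_of f) g (Idt Y e) = g" if "g \<in> Arr X" for g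
      using arg_cong[OF eq, of "\<lambda>f. kar f [g]"] that assms(4) by (simp add: D)
    show "pdl (pairing_of f) x x' e = Idt X (osum X x x')" if "x \<in> Obj X" "x' \<in> Obj X" for x x'
      using arg_cong[OF eq, of "\<lambda>f. kdist f 0 [x] x'"] that assms(2,3) by (simp add: D ob)
  qed
qed

text \<open>
  The structure multifunctor restricts the tensor product to objects and arrows of \<open>A\<close>, whereas the
  tensor product in an associative category has unspecified values elsewhere. So the pairing obtained
  from a multifunctor is not equal to \<open>tens A\<close>, but it agrees with it wherever this matters.
\<close>

definition pairing_agree :: "('o, 'a) permcat \<Rightarrow> ('o, 'a) permcat \<Rightarrow> ('o, 'a) pairing \<Rightarrow> ('o, 'a) pairing \<Rightarrow> bool" where
  "pairing_agree X Y t t' \<longleftrightarrow>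
     (\<forall>x\<in>Obj X. \<forall>y\<in>Obj Y. pob t x y = pob t' x y) \<and>
     (\<forall>f\<in>Arr X. \<forall>g\<in>Arr Y. par t f g = par t' f g) \<and>
     (\<forall>x\<in>Obj X. \<forall>x'\<in>Obj X. \<forall>y\<in>Obj Y. pdl t x x' y = pdl t' x x' y) \<and>
     (\<forall>x\<in>Obj X. \<forall>y\<in>Obj Y. \<forall>y'\<in>Obj Y. pdr t x y y' = pdr t' x y y')"

lemma associative_pairings_agree:
  assumes "associative_pairings X Y Z W p q r s" "pairing_agree X Y p p'" "pairing_agree Y Z r r'"
  shows "associative_pairings X Y Z W p' q r' s"
  using assms unfolding associative_pairings_def pairing_agree_def by simp

lemma pairing_agree_refl: "pairing_agree X Y t t"
  by (simp add: pairing_agree_def)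

lemma tens_klin_two:
  assumes "associative_category A"
  shows "pairing_agree (perm A) (perm A) (pairing_of (tens_klin A 2 id)) (tens A)"
proof -
  interpret associative_category A by fact
  interpret t: pairing_functor "perm A" "perm A" "perm A" "tens A"
    using tensor permutative by (simp add: pairing_functor_def)
  interpret l: left_unital "perm A" "perm A" "tens A" "unit A" by (rule left_unital)
  interpret r: right_unital "perm A" "perm A" "tens A" "unit A" by (rule right_unital)
  have p: "permute_list id xs = xs" for xs :: "'z list" by simp
  show ?thesis
    using unit_obj
    by (auto simp: pairing_agree_def pairing_of_def tens_klin_def Let_def tens_obs_def tens_ars_def
        l.ob_unit l.ar_unit l.dr_unit r.ob_unit r.ar_unit r.dl_unit numeral_2_eq_2)
qed

lemma tens_klin_zero [simp]:
  "kob (tens_klin A 0 id) [] = unit A" "kar (tens_klin A 0 id) [] = Idt (perm A) (unit A)"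
  by (simp_all add: tens_klin_def Let_def tens_obs_def tens_ars_def)

section \<open>Multifunctors on categories of paths\<close>

lemma Sym_comp_id:
  assumes "\<And>j. j < length js \<Longrightarrow> \<phi>s ! j = id"
  shows "Sym_comp js id \<phi>s = id"
proof
  fix m show "Sym_comp js id \<phi>s m = id m"
  proof (cases "m < sum_list js")
    case True
    then obtain j p where "j < length js" "p < js ! j" "m = sum_list (take j js) + p"
      by (rule block_posE)
    then show ?thesis
      using Sym_comp_offset[of id js \<phi>s j p] assms by (simp add: permutes_id)
  qed (simp add: Sym_comp_def perm_sum_def block_perm_def)
qed

lemma path_hom_id_iff: "id \<in> path_hom src tgt W c \<longleftrightarrow> path src tgt (src c) W (tgt c)"
  by (simp add: path_hom_def Sym_set_def permutes_id)

locale path_mfun = multifunctor "Sym_multicat (path_hom src tgt)" Perm F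
  for src tgt :: "'c \<Rightarrow> 'v" and F :: "('c, nat \<Rightarrow> nat, nat \<Rightarrow> nat, ('o, 'a) permcat, ('o, 'a) klin, ('o, 'a) kcell) mfun"
begin

lemma perm_ob: "permutative (FOb F c)"
  using ob[of c] by (simp add: Sym_multicat_def Perm_def)

lemma multilinear_mor:
  assumes "\<sigma> \<in> path_hom src tgt Cs c"
  shows "multilinear (map (FOb F) Cs) (FOb F c) (FMor F Cs c \<sigma>)"
proof -
  have "klinear (map (FOb F) Cs) (FOb F c) (FMor F Cs c \<sigma>)"
    using cfunctor.obj[OF hom, of Cs c \<sigma>] assms
    by (simp add: Sym_multicat_def discrete_cat_def Perm_def klin_cat_simps(1))
  then show ?thesis using perm_ob by (auto simp: multilinear_def multilinear_axioms_def)
qed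

lemma mor_unit: "FMor F [c] c id = klin_id (FOb F c)"
  using unit[of c] by (simp add: Sym_multicat_def Perm_def)

text \<open>
  With identity permutations the multiproduct of \<open>\<Sigma>\<^sub>*\<close> is trivial, and what remains of the composition
  is concatenation of paths.
\<close>

lemma mor_comp:
  assumes "list_all2 (\<lambda>b W. path src tgt (src b) W (tgt b)) bs Ws" "path src tgt (src c) bs (tgt c)"
  shows "FMor F (concat Ws) c id = klin_comp (map (map (FOb F)) Ws) (map (FOb F) bs) (FOb F c)
    (FMor F bs c id) (map2 (\<lambda>b W. FMor F W b id) bs Ws)"
proof -
  have len: "length Ws = length bs" using list_all2_lengthD[OF assms(1)] by simp
  have W: "path src tgt (src (bs ! j)) (Ws ! j) (tgt (bs ! j))" if "j < length bs" for j
    using assms(1) that by (simp add: list_all2_conv_all_nth)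
  have "Sym_comp (map length Ws) id (replicate (length bs) id) = id"
    by (rule Sym_comp_id) (simp add: len)
  moreover have "map (\<lambda>j. FMor F (Ws ! j) (bs ! j) (replicate (length bs) id ! j)) [0..<length bs]
      = map2 (\<lambda>b W. FMor F W b id) bs Ws"
    using len by (auto intro!: nth_equalityI)
  ultimately show ?thesis
    using comp[of bs c Ws "replicate (length bs) id" id] len assms(2) W
    by (simp add: Sym_multicat_def discrete_cat_def Perm_def path_hom_id_iff)
qed

text \<open>
  Every multimorphism is a translate of the identity permutation of a path, which reduces statements
  about multifunctors to identity permutations.
\<close>

lemma mor_act:
  assumes "\<sigma> \<in> path_hom src tgt Cs c"
  shows "FMor F Cs c \<sigma>
    = klin_act (map (FOb F) (permute_list (inv \<sigma>) Cs)) \<sigma> (FMor F (permute_list (inv \<sigma>) Cs) c id)"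
proof -
  note \<sigma> = path_homD[OF assms]
  have "permute_list \<sigma> (permute_list (inv \<sigma>) Cs) = Cs"
    using \<sigma>(1) by (simp add: permute_list_compose[symmetric] permutes_inv_o)
  then show ?thesis
    using act[of "permute_list (inv \<sigma>) Cs" c \<sigma> id] \<sigma>
    by (simp add: Sym_multicat_def discrete_cat_def Perm_def path_hom_id_iff)
qed

lemma cell_eq:
  assumes "\<sigma> \<in> path_hom src tgt Cs c"
  shows "FCell F Cs c \<sigma> = Idt (klin_cat (map (FOb F) Cs) (FOb F c)) (FMor F Cs c \<sigma>)"
  using cfunctor.ident[OF hom, of Cs c \<sigma>] assms
  by (simp add: Sym_multicat_def discrete_cat_def Perm_def)

end

lemma path_mfun_eqI:
  assumes F: "path_mfun src tgt F" and G: "path_mfun src tgt G"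
    and obs: "\<And>c. FOb F c = FOb G c"
    and mors: "\<And>W c. path src tgt (src c) W (tgt c) \<Longrightarrow> FMor F W c id = FMor G W c id"
  shows "F = G"
proof -
  interpret F: path_mfun src tgt F by fact
  interpret G: path_mfun src tgt G by fact
  have o: "FOb F = FOb G" using obs by blast
  have m: "FMor F Cs c \<sigma> = FMor G Cs c \<sigma>" for Cs c \<sigma>
  proof (cases "\<sigma> \<in> path_hom src tgt Cs c")
    case True
    then show ?thesis
      using mors[OF path_homD(2)[OF True]] by (simp add: F.mor_act G.mor_act o)
  next
    case False
    then show ?thesis
      using F.mor_ext[of Cs c \<sigma>] G.mor_ext[of Cs c \<sigma>] by (simp add: Sym_multicat_def discrete_cat_def)
  qed
  have "FCell F Cs c \<sigma> = FCell G Cs c \<sigma>" for Cs c \<sigma>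
  proof (cases "\<sigma> \<in> path_hom src tgt Cs c")
    case True
    then show ?thesis by (simp add: F.cell_eq G.cell_eq o m)
  next
    case False
    then show ?thesis
      using F.cell_ext[of Cs c \<sigma>] G.cell_ext[of Cs c \<sigma>] by (simp add: Sym_multicat_def discrete_cat_def)
  qed
  then show ?thesis using o m by (intro mfun.equality ext) auto
qed

section \<open>Words in a single letter and words of length two\<close>

context tensor_system
begin

lemma word_replicate:
  assumes "src c = v" "tgt c = v" "K v v = perm A" "T v v v = tens A" "U v = unit A"
  shows "xs \<in> Obj (prod_cat (replicate k (perm A))) \<Longrightarrow> kob (word v (replicate k c)) xs = tens_obs A xs"
    and "us \<in> Arr (prod_cat (replicate k (perm A))) \<Longrightarrow> kar (word v (replicate k c)) us = tens_ars A us"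
proof (induction k arbitrary: xs us)
  case (Suc k)
  {
    case 1
    then obtain y ys where "xs = y # ys" "y \<in> Obj (perm A)" "ys \<in> Obj (prod_cat (replicate k (perm A)))"
      by (auto elim!: prod_cat_ConsE)
    then show ?case using Suc.IH(1) assms by (simp add: tens_obs_def)
  next
    case 2
    then obtain y ys where "us = y # ys" "y \<in> Arr (perm A)" "ys \<in> Arr (prod_cat (replicate k (perm A)))"
      by (auto elim!: prod_cat_Arr_ConsE)
    then show ?case using Suc.IH(2) assms by (simp add: tens_ars_def)
  }
qed (use assms in \<open>simp_all add: tens_obs_def tens_ars_def\<close>)

lemma path_replicate: "src c = v \<Longrightarrow> tgt c = v \<Longrightarrow> pth v (replicate k c) v"
  by (induction k) auto

text \<open>
  Cutting the word before letter \<open>i\<close> expresses the distributivity map by \<open>d\<^sub>l\<close> within and \<open>d\<^sub>r\<close> outside;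
  \<open>dr_dl\<close> turns this into the order of the two used in the structure multifunctor.
\<close>

lemma word_dist_replicate:
  assumes "src c = v" "tgt c = v" "K v v = perm A" "T v v v = tens A" "U v = unit A"
    and i: "i < k" and xs: "xs \<in> Obj (prod_cat (replicate k (perm A)))" and a': "a' \<in> Obj (perm A)"
  defines "x \<equiv> tens_obs A (take i xs)" and "y \<equiv> tens_obs A (drop (Suc i) xs)"
  shows "kdist (word v (replicate k c)) i xs a'
    = Cmp (perm A) (par (tens A) (pdr (tens A) x (xs ! i) a') (Idt (perm A) y))
        (pdl (tens A) (pob (tens A) x (xs ! i)) (pob (tens A) x a') y)"
proof -
  let ?m = "k - Suc i"
  interpret asc: associative_pairings "perm A" "perm A" "perm A" "perm A" "tens A" "tens A" "tens A" "tens A"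
    using associative_T[of v v v v] assms by simp
  have l: "length xs = k" using prod_cat_length[OF xs] by simp
  have nth: "xs ! j \<in> Obj (perm A)" if "j < k" for j
    using prod_cat_nth[OF xs, of j] that by simp
  have W: "replicate k c = replicate i c @ replicate (Suc ?m) c"
    using i by (simp del: replicate_Suc flip: replicate_add)
  have xs': "xs = take i xs @ xs ! i # drop (Suc i) xs"
    using i l by (simp add: id_take_nth_drop)
  have C: "map Cat (replicate n c) = replicate n (perm A)" for n using assms by simp
  have t: "take i xs \<in> Obj (prod_cat (replicate i (perm A)))" "drop (Suc i) xs \<in> Obj (prod_cat (replicate ?m (perm A)))"
    using nth i l by (simp_all add: prod_cat_simps list_all2_conv_all_nth)
  have r: "xs ! i # drop (Suc i) xs \<in> Obs (replicate (Suc ?m) c)"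
    using nth[OF i] t(2) unfolding C by simp
  interpret W1: multilinear "map Cat (replicate i c)" "K v v" "word v (replicate i c)"
    using path_replicate assms by (intro multilinear_word) auto
  interpret W2: multilinear "map Cat (replicate ?m c)" "K v v" "word v (replicate ?m c)"
    using path_replicate assms by (intro multilinear_word) auto
  have xy: "kob (word v (replicate i c)) (take i xs) = x" "kob (word v (replicate ?m c)) (drop (Suc i) xs) = y"
    using word_replicate(1)[OF assms(1-5)] t by (simp_all add: x_def y_def)
  have ob: "x \<in> Obj (perm A)" "y \<in> Obj (perm A)"
    using W1.kob_closed[of "take i xs"] W2.kob_closed[of "drop (Suc i) xs"] t xy assms unfolding C by simp_all
  have "kdist (word v (replicate k c)) i xs a'
      = kdist (word v (replicate i c @ replicate (Suc ?m) c)) (length (replicate i c) + 0) (take i xs @ xs ! i # drop (Suc i) xs) a'"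
    using W xs' by simp
  also have "\<dots> = Cmp (K v v) (par (T v v v) (Idt (K v v) (kob (word v (replicate i c)) (take i xs)))
          (kdist (word v (replicate (Suc ?m) c)) 0 (xs ! i # drop (Suc i) xs) a'))
        (pdr (T v v v) (kob (word v (replicate i c)) (take i xs))
          (kob (word v (replicate (Suc ?m) c)) (xs ! i # drop (Suc i) xs))
          (kob (word v (replicate (Suc ?m) c)) ((xs ! i # drop (Suc i) xs)[0 := a'])))"
    by (rule word_dist_append_right) (use path_replicate assms t r C in \<open>simp_all del: replicate_Suc\<close>)
  also have "\<dots> = Cmp (perm A) (par (tens A) (Idt (perm A) x) (pdl (tens A) (xs ! i) a' y))
      (pdr (tens A) x (pob (tens A) (xs ! i) y) (pob (tens A) a' y))"
    using assms(1-5) xy t(2) nth[OF i] a' C by simp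
  also have "\<dots> = Cmp (perm A) (par (tens A) (pdr (tens A) x (xs ! i) a') (Idt (perm A) y))
        (pdl (tens A) (pob (tens A) x (xs ! i)) (pob (tens A) x a') y)"
    using ob nth[OF i] a' by (simp add: asc.dr_dl)
  finally show ?thesis .
qed

lemma path_hom_replicate:
  assumes "src c = v" "tgt c = v"
  shows "path_hom src tgt (replicate k c) c = Sym_set k"
proof -
  have "permute_list (inv \<sigma>) (replicate k c) = replicate k c" if "\<sigma> permutes {..<k}" for \<sigma>
    using that permutes_in_image[OF permutes_inv[OF that]]
    by (intro nth_equalityI) (simp_all add: permute_list_nth permutes_inv)
  then show ?thesis using assms path_replicate by (auto simp: path_hom_def Sym_set_def)
qed

lemma word_mor_replicate:
  assumes "src c = v" "tgt c = v" "K v v = perm A" "T v v v = tens A" "U v = unit A"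
    and \<sigma>: "\<sigma> permutes {..<k}"
  shows "word_mor (replicate k c) c \<sigma> = tens_klin A k \<sigma>"
proof -
  let ?P = "prod_cat (replicate k (perm A))"
  have C: "map Cat (replicate n c) = replicate n (perm A)" for n using assms by simp
  have \<sigma>': "\<sigma> permutes {..<length (replicate k c)}" "\<sigma> permutes {..<length (replicate k (perm A))}"
    using \<sigma> by simp_all
  have perm: "permute_list \<tau> (replicate k z) = replicate k z" if "\<tau> permutes {..<k}" for \<tau> and z :: 'z
    using that permutes_in_image[OF that] by (intro nth_equalityI) (simp_all add: permute_list_nth)
  have inO: "permute_list (inv \<sigma>) xs \<in> Obj ?P" if "xs \<in> Obj ?P" for xs
    using permute_prod_cat_Obj[OF \<sigma>'(2), of xs] that by (simp add: perm \<sigma>)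
  have inA: "permute_list (inv \<sigma>) xs \<in> Arr ?P" if "xs \<in> Arr ?P" for xs
    using permute_prod_cat_Arr[OF \<sigma>'(2), of xs] that by (simp add: perm \<sigma>)
  note simps = word_mor_simps[OF \<sigma>'(1), where c = c, unfolded C perm[OF permutes_inv[OF \<sigma>]] assms(2)]
    and exts = word_mor_ext[OF \<sigma>'(1), where c = c, unfolded C]
    and rep = word_replicate[OF assms(1-5)]
  show ?thesis
  proof (rule klin_eqI)
    fix xs show "kob (word_mor (replicate k c) c \<sigma>) xs = kob (tens_klin A k \<sigma>) xs"
      using simps(1)[of xs] exts(1)[of xs] rep(1)[OF inO] by (auto simp: tens_klin_def Let_def)
  next
    fix us show "kar (word_mor (replicate k c) c \<sigma>) us = kar (tens_klin A k \<sigma>) us"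
      using simps(2)[of us] exts(2)[of us] rep(2)[OF inA] by (auto simp: tens_klin_def Let_def)
  next
    fix i xs a' show "kdist (word_mor (replicate k c) c \<sigma>) i xs a' = kdist (tens_klin A k \<sigma>) i xs a'"
    proof (cases "i < k \<and> xs \<in> Obj ?P \<and> a' \<in> Obj (perm A)")
      case True
      have \<sigma>i: "\<sigma> i < k" using True permutes_in_image[OF \<sigma>, of i] by simp
      have nth: "permute_list (inv \<sigma>) xs ! \<sigma> i = xs ! i"
        using True prod_cat_length[of xs "replicate k (perm A)"] \<sigma> by (simp add: permute_list_inv_nth)
      have "kdist (word_mor (replicate k c) c \<sigma>) i xs a' = kdist (word v (replicate k c)) (\<sigma> i) (permute_list (inv \<sigma>) xs) a'"
        using simps(3)[of i xs a'] True assms(1-3) by simp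
      with True show ?thesis
        using word_dist_replicate[OF assms(1-5) \<sigma>i inO, of xs a'] nth by (simp add: tens_klin_def Let_def)
    next
      case False
      then have "\<not> (i < length (replicate k c) \<and> xs \<in> Obj ?P \<and> a' \<in> Obj (Cat (replicate k c ! i)))"
        using assms(1-3) by (auto)
      from exts(3)[OF this] show ?thesis
        unfolding tens_klin_def Let_def klin.simps if_not_P[OF False] .
    qed
  qed
qed

text \<open>
  The unit at the end of a word of length two disappears by unitality, in particular because
  \<open>d\<^sub>l\<close> over the unit is an identity. The hypothesis on values outside the domains turns agreement into
  equality.
\<close>

lemma pairing_of_word:
  assumes "src c = u" "tgt c = v" "src d = v" "tgt d = w" "src e = u" "tgt e = w"
    and "pairing_ext (K u v) (K v w) (T u v w)"
  shows "pairing_of (word_mor [c, d] e id) = T u v w"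
proof -
  have p: "id permutes {..<length [c, d]}" by (simp add: permutes_id)
  have le: "u \<le> v" "v \<le> w" using src_le_tgt[of c] src_le_tgt[of d] assms by auto
  interpret t: pairing_functor "K u v" "K v w" "K u w" "T u v w" using le by (intro pairing_functor_T)
  interpret r: right_unital "K v w" "K w w" "T v w w" "U w" using le by (intro right_unital_T)
  interpret Kuv: permutative "K u v" using le by (intro permutative_K)
  have C: "map Cat [c, d] = [K u v, K v w]" using assms by simp
  note simps = word_mor_simps[OF p, unfolded C] and exts = word_mor_ext[OF p, unfolded C]
  have ob2: "[x, y] \<in> Obj (prod_cat [K u v, K v w]) \<longleftrightarrow> x \<in> Obj (K u v) \<and> y \<in> Obj (K v w)" for x y
    by simp
  note E = assms(7)[unfolded pairing_ext_def]
  show ?thesis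
  proof (rule pairing.equality)
    show "pob (pairing_of (word_mor [c, d] e id)) = pob (T u v w)"
    proof (intro ext)
      fix x y show "pob (pairing_of (word_mor [c, d] e id)) x y = pob (T u v w) x y"
        using simps(1)[of "[x, y]" e] exts(1)[of "[x, y]" e] E assms(1-6)
        by (cases "x \<in> Obj (K u v) \<and> y \<in> Obj (K v w)") (auto simp: pairing_of_def r.ob_unit)
    qed
    show "par (pairing_of (word_mor [c, d] e id)) = par (T u v w)"
    proof (intro ext)
      fix x y show "par (pairing_of (word_mor [c, d] e id)) x y = par (T u v w) x y"
        using simps(2)[of "[x, y]" e] exts(2)[of "[x, y]" e] E assms(1-6)
        by (cases "x \<in> Arr (K u v) \<and> y \<in> Arr (K v w)") (auto simp: pairing_of_def r.ar_unit)
    qed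
    show "pdl (pairing_of (word_mor [c, d] e id)) = pdl (T u v w)"
    proof (intro ext)
      fix x x' y show "pdl (pairing_of (word_mor [c, d] e id)) x x' y = pdl (T u v w) x x' y"
        using simps(3)[of 0 "[x, y]" x' e] exts(3)[of 0 "[x, y]" x' e] E assms(1-6)
        by (cases "x \<in> Obj (K u v) \<and> x' \<in> Obj (K u v) \<and> y \<in> Obj (K v w)") (auto simp: pairing_of_def r.ob_unit)
    qed
    show "pdr (pairing_of (word_mor [c, d] e id)) = pdr (T u v w)"
    proof (intro ext)
      fix x y y' show "pdr (pairing_of (word_mor [c, d] e id)) x y y' = pdr (T u v w) x y y'"
        using simps(3)[of 1 "[x, y]" y' e] exts(3)[of 1 "[x, y]" y' e] E assms(1-6)
        by (cases "x \<in> Obj (K u v) \<and> y \<in> Obj (K v w) \<and> y' \<in> Obj (K v w)")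
          (auto simp: pairing_of_def r.ob_unit r.dl_unit)
    qed
  qed simp
qed

end

section \<open>Bimodules as tensor systems on two vertices\<close>

text \<open>
  The vertices \<open>False < True\<close>, with \<open>A\<close> and \<open>B\<close> as loops and \<open>M\<close> as edge between them. The paths from
  \<open>False\<close> to \<open>True\<close> are the words \<open>A \<dots> A M B \<dots> B\<close>.
\<close>

primrec bsrc :: "bim_ob \<Rightarrow> bool" where
  "bsrc ObA = False" | "bsrc ObM = False" | "bsrc ObB = True"

primrec btgt :: "bim_ob \<Rightarrow> bool" where
  "btgt ObA = False" | "btgt ObM = True" | "btgt ObB = True"

abbreviation bpath :: "bool \<Rightarrow> bim_ob list \<Rightarrow> bool \<Rightarrow> bool" where
  "bpath \<equiv> path bsrc btgt"

lemma bpath_A: "bpath False W False \<longleftrightarrow> set W \<subseteq> {ObA}"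
proof -
  have "\<not> bpath True W False" for W
  proof (induction W)
    case (Cons c W) then show ?case by (cases c) auto
  qed simp
  then show ?thesis
  proof (induction W)
    case (Cons c W) then show ?case by (cases c) auto
  qed simp
qed

lemma bpath_B: "bpath True W True \<longleftrightarrow> set W \<subseteq> {ObB}"
proof (induction W)
  case (Cons c W) then show ?case by (cases c) auto
qed simp

lemma bpath_M:
  "bpath False W True \<longleftrightarrow> count_list W ObM = 1 \<and>
    (\<forall>i < length W. \<forall>j < length W. W ! j = ObM \<longrightarrow> (i < j \<longleftrightarrow> W ! i = ObA))"
proof (induction W)
  case (Cons c W)
  show ?case
  proof (cases c)
    case ObA
    then show ?thesis using Cons.IH by (simp add: All_less_Suc2)
  next
    case ObB
    have "\<exists>j < length W. W ! j = ObM" if "count_list W ObM = 1"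
      using that by (metis count_notin in_set_conv_nth one_neq_zero)
    then show ?thesis using ObB by (auto simp: All_less_Suc2)
  next
    case ObM
    have "set W \<subseteq> {ObB} \<longleftrightarrow> count_list W ObM = 0 \<and> (\<forall>i < length W. W ! i \<noteq> ObA)"
    proof -
      have "set W \<subseteq> {ObB} \<longleftrightarrow> ObM \<notin> set W \<and> ObA \<notin> set W"
        by auto (metis bim_ob.exhaust)
      then show ?thesis by (simp add: count_list_0_iff in_set_conv_nth)
    qed
    moreover have "W ! j \<noteq> ObM" if "count_list W ObM = 0" "j < length W" for j
      using that by (metis count_list_0_iff nth_mem)
    ultimately show ?thesis using ObM by (auto simp: All_less_Suc2 bpath_B)
  qed
qed simp

text \<open>
  For identity permutations this is the preceding description of paths; for arbitrary \<open>\<sigma>\<close> the conditions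
  are transported along the bijection \<open>i \<mapsto> \<sigma>(i)\<close>.
\<close>

lemma bim_hom_eq_path_hom: "bim_hom = path_hom bsrc btgt"
proof (intro ext set_eqI)
  fix Cs c \<sigma>
  show "\<sigma> \<in> bim_hom Cs c \<longleftrightarrow> \<sigma> \<in> path_hom bsrc btgt Cs c"
  proof (cases "\<sigma> permutes {..<length Cs}")
    case False
    then show ?thesis by (auto simp: bim_hom_def path_hom_def Sym_set_def split: if_splits)
  next
    case True
    define W where "W = permute_list (inv \<sigma>) Cs"
    have W: "set W = set Cs" "count_list W x = count_list Cs x" "length W = length Cs" for x
      using True by (simp_all add: W_def permutes_inv flip: count_mset)
    have nth: "W ! \<sigma> i = Cs ! i" if "i < length Cs" for i
      using True that by (simp add: W_def permute_list_inv_nth)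
    have \<sigma>i: "\<sigma> i < length Cs" "\<exists>i'<length Cs. i = \<sigma> i'" if "i < length Cs" for i
    proof -
      show "\<sigma> i < length Cs" using permutes_in_image[OF True, of i] that by simp
      have "inv \<sigma> i < length Cs" "\<sigma> (inv \<sigma> i) = i"
        using permutes_in_image[OF permutes_inv[OF True], of i] that permutes_inverses[OF True] by simp_all
      then show "\<exists>i'<length Cs. i = \<sigma> i'" by metis
    qed
    have M: "(\<forall>i < length W. \<forall>j < length W. W ! j = ObM \<longrightarrow> (i < j \<longleftrightarrow> W ! i = ObA))
      \<longleftrightarrow> (\<forall>i < length Cs. \<forall>j < length Cs. Cs ! j = ObM \<longrightarrow> (\<sigma> i < \<sigma> j \<longleftrightarrow> Cs ! i = ObA))"
    proof -
      have "(\<forall>i < length Cs. P i) \<longleftrightarrow> (\<forall>i < length Cs. P (\<sigma> i))" for P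
        using \<sigma>i by metis
      note all = this
      show ?thesis unfolding W(3) by (subst all, subst (2) all) (simp add: nth \<sigma>i cong: all_cong)
    qed
    show ?thesis
      using True W M by (cases c)
        (auto simp: bim_hom_def path_hom_def Sym_set_def bpath_A bpath_B bpath_M simp flip: W_def)
  qed
qed

lemma BSigma_eq: "BSigma = Sym_multicat (path_hom bsrc btgt)"
  by (simp add: BSigma_def bim_hom_eq_path_hom)

definition bim_cat :: "('o, 'a) assoccat \<Rightarrow> ('o, 'a) assoccat \<Rightarrow> ('o, 'a) permcat \<Rightarrow> bool \<Rightarrow> bool \<Rightarrow> ('o, 'a) permcat" where
  "bim_cat A B D u v = (if u then perm B else if v then D else perm A)"

definition bim_tens :: "('o, 'a) assoccat \<Rightarrow> ('o, 'a) assoccat \<Rightarrow> ('o, 'a) pairing \<Rightarrow> ('o, 'a) pairing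
    \<Rightarrow> bool \<Rightarrow> bool \<Rightarrow> bool \<Rightarrow> ('o, 'a) pairing" where
  "bim_tens A B l r u v w = (if u then tens B else if v then r else if w then l else tens A)"

definition bim_unit :: "('o, 'a) assoccat \<Rightarrow> ('o, 'a) assoccat \<Rightarrow> bool \<Rightarrow> 'o" where
  "bim_unit A B v = (if v then unit B else unit A)"

lemma tensor_system_bimodule:
  assumes A: "associative_category A" and B: "associative_category B" and D: "permutative D"
    and lr: "bimodule A B D l r"
  shows "tensor_system bsrc btgt (bim_cat A B D) (bim_tens A B l r) (bim_unit A B)"
proof -
  interpret A: associative_category A by fact
  interpret B: associative_category B by fact
  interpret lr: bimodule A B D l r by fact
  note defs = bim_cat_def bim_tens_def bim_unit_def
  show ?thesis
  proof (rule tensor_system.intro)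
    show "bsrc c \<le> btgt c" for c by (cases c) auto
    show "permutative (bim_cat A B D u v)" for u v
      using A.permutative B.permutative D by (simp add: defs)
    show "distributive_pairing (bim_cat A B D u v) (bim_cat A B D v w) (bim_cat A B D u w) (bim_tens A B l r u v w)"
      if "u \<le> v" "v \<le> w" for u v w
      using that A.tensor B.tensor lr.left_action lr.right_action by (auto simp: defs)
    show "associative_pairings (bim_cat A B D u v) (bim_cat A B D v w) (bim_cat A B D w z) (bim_cat A B D u z)
        (bim_tens A B l r u v w) (bim_tens A B l r u w z) (bim_tens A B l r v w z) (bim_tens A B l r u v z)"
      if "u \<le> v" "v \<le> w" "w \<le> z" for u v w z
      using that A.associative B.associative lr.left_associative lr.right_associative lr.bi_associative
      by (auto simp: defs)
    show "bim_unit A B v \<in> Obj (bim_cat A B D v v)" for v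
      using A.unit_obj B.unit_obj by (simp add: defs)
    show "left_unital (bim_cat A B D v v) (bim_cat A B D v w) (bim_tens A B l r v v w) (bim_unit A B v)"
      if "v \<le> w" for v w
      using that A.left_unital B.left_unital lr.left_unital by (auto simp: defs)
    show "right_unital (bim_cat A B D u v) (bim_cat A B D v v) (bim_tens A B l r u v v) (bim_unit A B v)"
      if "u \<le> v" for u v
      using that A.right_unital B.right_unital lr.right_unital by (auto simp: defs)
  qed
qed

lemma restriction_eq_structure_mfun_iff:
  "mfun_comp Sigma_op F (Sigma_incl c) = structure_mfun A \<longleftrightarrow>
     FOb F c = perm A \<and>
     (\<forall>k. \<forall>\<sigma>\<in>Sym_set k. FMor F (replicate k c) c \<sigma> = tens_klin A k \<sigma> \<and>
       FCell F (replicate k c) c \<sigma> = Idt (klin_cat (replicate k (perm A)) (perm A)) (tens_klin A k \<sigma>))"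
    (is "?l \<longleftrightarrow> ?r")
proof -
  have S: "MOb Sigma_op = UNIV" "Obj (MHom Sigma_op as b) = Sym_set (length as)" "Arr (MHom Sigma_op as b) = Sym_set (length as)"
    for as b by (simp_all add: Sigma_op_def Sym_multicat_def discrete_cat_def)
  show ?thesis
  proof
    assume l: ?l
    have "FOb F c = perm A"
      using arg_cong[OF l, of "\<lambda>G. FOb G ()"] by (simp add: mfun_comp_def S Sigma_incl_def structure_mfun_def)
    moreover have "FMor F (replicate k c) c \<sigma> = tens_klin A k \<sigma>
        \<and> FCell F (replicate k c) c \<sigma> = Idt (klin_cat (replicate k (perm A)) (perm A)) (tens_klin A k \<sigma>)"
      if "\<sigma> \<in> Sym_set k" for k \<sigma>
      using arg_cong[OF l, of "\<lambda>G. FMor G (replicate k ()) () \<sigma>"]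
        arg_cong[OF l, of "\<lambda>G. FCell G (replicate k ()) () \<sigma>"] that
      by (simp add: mfun_comp_def S Sigma_incl_def structure_mfun_def)
    ultimately show ?r by blast
  next
    assume r: ?r
    show ?l
      using r by (intro mfun.equality ext)
        (auto simp: mfun_comp_def S Sigma_incl_def structure_mfun_def map_replicate_const)
  qed
qed

lemma bimodule_mfuns_word_mfun:
  assumes "associative_category A" "associative_category B" "permutative D"
    and lr: "(l, r) \<in> bimodule_structures A B D"
  shows "\<exists>F \<in> bimodule_mfuns A B D. bimodule_of_mfun F = (l, r)"
proof -
  interpret S: tensor_system bsrc btgt "bim_cat A B D" "bim_tens A B l r" "bim_unit A B"
    using lr assms by (intro tensor_system_bimodule) (auto simp: bimodule_structures_def)
  let ?F = S.word_mfun
  note defs = bim_cat_def bim_tens_def bim_unit_def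
  have C: "bim_cat A B D (bsrc ObA) (btgt ObA) = perm A" "bim_cat A B D (bsrc ObB) (btgt ObB) = perm B"
    "bim_cat A B D (bsrc ObM) (btgt ObM) = D"
    by (simp_all add: defs)
  have "mfun_comp Sigma_op ?F (Sigma_incl ObA) = structure_mfun A"
    using S.path_hom_replicate[of ObA False] S.word_mor_replicate[of ObA False A] C(1)
    by (auto simp: restriction_eq_structure_mfun_iff S.word_mfun_def defs Sym_set_def)
  moreover have "mfun_comp Sigma_op ?F (Sigma_incl ObB) = structure_mfun B"
    using S.path_hom_replicate[of ObB True] S.word_mor_replicate[of ObB True B] C(2)
    by (auto simp: restriction_eq_structure_mfun_iff S.word_mfun_def defs Sym_set_def)
  moreover have "FOb ?F ObM = D" by (simp add: S.word_mfun_def defs)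
  ultimately have F: "?F \<in> bimodule_mfuns A B D"
    using S.multifunctor_word_mfun by (simp add: bimodule_mfuns_def BSigma_eq)
  have id: "id \<in> path_hom bsrc btgt [ObA, ObM] ObM" "id \<in> path_hom bsrc btgt [ObM, ObB] ObM"
    by (simp_all add: path_hom_id_iff)
  have "pairing_of (S.word_mor [ObA, ObM] ObM id) = l"
    using S.pairing_of_word[of ObA False False ObM True ObM] lr
    by (simp add: defs bimodule_structures_def)
  moreover have "pairing_of (S.word_mor [ObM, ObB] ObM id) = r"
    using S.pairing_of_word[of ObM False True ObB True ObM] lr
    by (simp add: defs bimodule_structures_def)
  ultimately have "bimodule_of_mfun ?F = (l, r)"
    using id by (simp add: bimodule_of_mfun_def bim_hom_AM bim_hom_MB S.word_mfun_def)
  with F show ?thesis by blast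
qed

locale bimodule_mfun =
  fixes A B :: "('o, 'a) assoccat" and D :: "('o, 'a) permcat" and F :: "('o, 'a) bim_mfun"
  assumes A: "associative_category A" and B: "associative_category B"
    and F: "F \<in> bimodule_mfuns A B D"
begin

sublocale path_mfun bsrc btgt F
  using F by (simp add: bimodule_mfuns_def BSigma_eq path_mfun_def)

lemma obs: "FOb F ObA = perm A" "FOb F ObB = perm B" "FOb F ObM = D"
  using F by (simp_all add: bimodule_mfuns_def restriction_eq_structure_mfun_iff)

lemma mor_A: "FMor F (replicate k ObA) ObA id = tens_klin A k id"
  and mor_B: "FMor F (replicate k ObB) ObB id = tens_klin B k id"
  using F by (simp_all add: bimodule_mfuns_def restriction_eq_structure_mfun_iff Sym_set_def permutes_id)

definition left_action where "left_action = FMor F [ObA, ObM] ObM id"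
definition right_action where "right_action = FMor F [ObM, ObB] ObM id"

lemma bimodule_of: "bimodule_of_mfun F = (pairing_of left_action, pairing_of right_action)"
  by (simp add: bimodule_of_mfun_def bim_hom_AM bim_hom_MB left_action_def right_action_def)

lemma bilinears:
  "bilinear (perm A) D D left_action" "bilinear D (perm B) D right_action"
  "bilinear (perm A) (perm A) (perm A) (tens_klin A 2 id)"
  "bilinear (perm B) (perm B) (perm B) (tens_klin B 2 id)"
  using multilinear_mor[of id "[ObA, ObM]" ObM] multilinear_mor[of id "[ObM, ObB]" ObM]
    multilinear_mor[of id "[ObA, ObA]" ObA] multilinear_mor[of id "[ObB, ObB]" ObB]
    mor_A[of 2] mor_B[of 2]
  by (simp_all add: path_hom_id_iff obs bilinear_def left_action_def right_action_def numeral_2_eq_2)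

lemma mor_cons_A:
  assumes "bpath False W True"
  shows "FMor F (ObA # W) ObM id
    = klin_comp [[perm A], map (FOb F) W] [perm A, D] D left_action [klin_id (perm A), FMor F W ObM id]"
  using mor_comp[of "[ObA, ObM]" "[[ObA], W]" ObM] assms mor_unit[of ObA] by (simp add: obs left_action_def)

lemma mor_append_B:
  assumes "bpath False W True"
  shows "FMor F (W @ replicate k ObB) ObM id
    = klin_comp [map (FOb F) W, replicate k (perm B)] [D, perm B] D right_action [FMor F W ObM id, tens_klin B k id]"
proof -
  have "bpath True (replicate k ObB) True" by (auto simp: bpath_B)
  then show ?thesis
    using mor_comp[of "[ObM, ObB]" "[W, replicate k ObB]" ObM] assms mor_B[of k]
    by (simp add: obs right_action_def)
qed

lemma mor_append_A:
  assumes "bpath False W True"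
  shows "FMor F (replicate k ObA @ W) ObM id
    = klin_comp [replicate k (perm A), map (FOb F) W] [perm A, D] D left_action [tens_klin A k id, FMor F W ObM id]"
proof -
  have "bpath False (replicate k ObA) False" by (auto simp: bpath_A)
  then show ?thesis
    using mor_comp[of "[ObA, ObM]" "[replicate k ObA, W]" ObM] assms mor_A[of k]
    by (simp add: obs left_action_def)
qed

lemma mor_M: "FMor F [ObM] ObM id = klin_id D"
  using mor_unit[of ObM] by (simp add: obs)

lemma tens_klin_one: "tens_klin B 1 id = klin_id (perm B)" "tens_klin A 1 id = klin_id (perm A)"
  using mor_unit[of ObB] mor_B[of 1] mor_unit[of ObA] mor_A[of 1] by (simp_all add: obs)

text \<open>
  Each of the words \<open>A A M\<close>, \<open>M B B\<close>, \<open>A M B\<close> is a concatenation of blocks in two ways, and the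
  multifunctor sends both decompositions to the same trilinear map. Similarly \<open>M\<close> can be composed with an
  empty word of \<open>A\<close> or of \<open>B\<close>.
\<close>

lemma bimodule_structure: "bimodule_of_mfun F \<in> bimodule_structures A B D"
proof -
  have Mp: "bpath False [ObM] True" "bpath False [ObA, ObM] True" "bpath False [ObM, ObB] True" by simp_all
  have AAM: "klin_comp [[perm A], [perm A, D]] [perm A, D] D left_action [klin_id (perm A), left_action]
      = klin_comp [[perm A, perm A], [D]] [perm A, D] D left_action [tens_klin A 2 id, klin_id D]"
    using mor_append_A[OF Mp(1), of 2] mor_cons_A[OF Mp(2)]
    by (simp add: obs mor_M left_action_def[symmetric] numeral_2_eq_2)
  have MBB: "klin_comp [[D], [perm B, perm B]] [D, perm B] D right_action [klin_id D, tens_klin B 2 id]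
      = klin_comp [[D, perm B], [perm B]] [D, perm B] D right_action [right_action, klin_id (perm B)]"
    using mor_append_B[OF Mp(1), of 2] mor_append_B[OF Mp(3), of 1] tens_klin_one(1)
    by (simp add: obs mor_M right_action_def[symmetric] numeral_2_eq_2)
  have AMB: "klin_comp [[perm A], [D, perm B]] [perm A, D] D left_action [klin_id (perm A), right_action]
      = klin_comp [[perm A, D], [perm B]] [D, perm B] D right_action [left_action, klin_id (perm B)]"
    using mor_cons_A[OF Mp(3)] mor_append_B[OF Mp(2), of 1] tens_klin_one(1)
    by (simp add: obs right_action_def[symmetric] left_action_def[symmetric])
  have lM: "klin_comp [[], [D]] [perm A, D] D left_action [tens_klin A 0 id, klin_id D] = klin_id D"
    using mor_append_A[OF Mp(1), of 0] by (simp add: obs mor_M)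
  have Mr: "klin_comp [[D], []] [D, perm B] D right_action [klin_id D, tens_klin B 0 id] = klin_id D"
    using mor_append_B[OF Mp(1), of 0] by (simp add: obs mor_M)
  interpret l: bilinear "perm A" D D left_action by (rule bilinears)
  interpret r: bilinear D "perm B" D right_action by (rule bilinears)
  have "bimodule A B D (pairing_of left_action) (pairing_of right_action)"
  proof (intro bimodule.intro left_module.intro right_module.intro bimodule_axioms.intro)
    show "distributive_pairing (perm A) D D (pairing_of left_action)" by (rule l.distributive_pairing_of)
    show "distributive_pairing D (perm B) D (pairing_of right_action)" by (rule r.distributive_pairing_of)
    show "associative_pairings (perm A) (perm A) D D (tens A) (pairing_of left_action) (pairing_of left_action) (pairing_of left_action)"
      using associative_pairings_of[OF bilinears(3,1,1,1) AAM]
      by (rule associative_pairings_agree) (rule tens_klin_two[OF A] pairing_agree_refl)+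
    show "associative_pairings D (perm B) (perm B) D (pairing_of right_action) (pairing_of right_action) (tens B) (pairing_of right_action)"
      using associative_pairings_of[OF bilinears(2,2,4,2) MBB]
      by (rule associative_pairings_agree) (rule tens_klin_two[OF B] pairing_agree_refl)+
    show "associative_pairings (perm A) D (perm B) D (pairing_of left_action) (pairing_of right_action) (pairing_of right_action) (pairing_of left_action)"
      by (rule associative_pairings_of[OF bilinears(1,2,2,1) AMB])
    show "left_unital (perm A) D (pairing_of left_action) (unit A)"
      by (rule left_unital_of[OF bilinears(1) _ _ _ lM])
         (use associative_category.unit_obj[OF A] in simp_all)
    show "right_unital D (perm B) (pairing_of right_action) (unit B)"
      by (rule right_unital_of[OF bilinears(2) _ _ _ Mr])
         (use associative_category.unit_obj[OF B] in simp_all)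
  qed
  then show ?thesis
    using l.pairing_ext_pairing_of r.pairing_ext_pairing_of
    by (simp add: bimodule_of bimodule_structures_def)
qed

end

text \<open>
  It suffices to compare the identity permutations of paths. Words in \<open>A\<close> or \<open>B\<close> alone are prescribed. A
  word \<open>A \<dots> A M B \<dots> B\<close> is obtained from \<open>M\<close> by attaching all letters \<open>B\<close> at once with the right
  action, and then the letters \<open>A\<close> one by one with the left action.
\<close>

lemma bimodule_of_mfun_inj:
  assumes "bimodule_mfun A B D F" "bimodule_mfun A B D G" and eq: "bimodule_of_mfun F = bimodule_of_mfun G"
  shows "F = G"
proof -
  interpret F: bimodule_mfun A B D F by fact
  interpret G: bimodule_mfun A B D G by fact
  have lm: "F.left_action = G.left_action"
    using F.bilinears(1) G.bilinears(1) eq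
    by (intro bilinear_eqI[of "perm A" D D]) (auto simp: bilinear_def multilinear_def F.bimodule_of G.bimodule_of)
  have rm: "F.right_action = G.right_action"
    using F.bilinears(2) G.bilinears(2) eq
    by (intro bilinear_eqI[of D "perm B" D]) (auto simp: bilinear_def multilinear_def F.bimodule_of G.bimodule_of)
  have obs: "FOb F c = FOb G c" for c by (cases c) (simp_all add: F.obs G.obs)
  then have o: "FOb F = FOb G" by blast
  have AB: "W = replicate (length W) c" if "set W \<subseteq> {c}" for W and c :: bim_ob
    using that by (auto intro: replicate_length_same[symmetric])
  have M: "FMor F W ObM id = FMor G W ObM id" if "bpath False W True" for W
    using that
  proof (induction W)
    case (Cons c W)
    show ?case
    proof (cases c)
      case ObA
      then have W: "bpath False W True" using Cons.prems by simp
      show ?thesis unfolding ObA F.mor_cons_A[OF W] G.mor_cons_A[OF W] lm o Cons.IH[OF W] ..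
    next
      case ObB
      with Cons show ?thesis by simp
    next
      case ObM
      then have "W = replicate (length W) ObB" using Cons.prems AB bpath_B by simp
      then obtain k where "c # W = [ObM] @ replicate k ObB" using ObM by auto
      moreover have M: "bpath False [ObM] True" by simp
      ultimately show ?thesis
        using F.mor_append_B[OF M, of k] G.mor_append_B[OF M, of k] F.mor_M G.mor_M rm o by metis
    qed
  qed simp
  show ?thesis
  proof (rule path_mfun_eqI)
    show "path_mfun bsrc btgt F" "path_mfun bsrc btgt G" by unfold_locales
    show "FOb F c = FOb G c" for c by (rule obs)
    show "FMor F W c id = FMor G W c id" if "bpath (bsrc c) W (btgt c)" for W c
    proof (cases c)
      case ObA
      then have "W = replicate (length W) ObA" using that AB bpath_A by simp
      then show ?thesis using ObA F.mor_A G.mor_A by metis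
    next
      case ObB
      then have "W = replicate (length W) ObB" using that AB bpath_B by simp
      then show ?thesis using ObB F.mor_B G.mor_B by metis
    next
      case ObM
      with M that show ?thesis by simp
    qed
  qed
qed

theorem theorem9p2p3:
  fixes A B :: "('o, 'a) assoccat" and D :: "('o, 'a) permcat"
  assumes "associative_category A" and "associative_category B" and "permutative D"
  shows "bij_betw bimodule_of_mfun (bimodule_mfuns A B D) (bimodule_structures A B D)"
proof -
  have mf: "bimodule_mfun A B D F" if "F \<in> bimodule_mfuns A B D" for F
    using assms(1,2) that by (rule bimodule_mfun.intro)
  have "inj_on bimodule_of_mfun (bimodule_mfuns A B D)"
    by (rule inj_onI) (rule bimodule_of_mfun_inj[OF mf mf])
  moreover have "bimodule_of_mfun F \<in> bimodule_structures A B D" if "F \<in> bimodule_mfuns A B D" for F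
    using bimodule_mfun.bimodule_structure[OF mf[OF that]] .
  moreover have "\<exists>F \<in> bimodule_mfuns A B D. bimodule_of_mfun F = s"
    if "s \<in> bimodule_structures A B D" for s
    using bimodule_mfuns_word_mfun[OF assms, of "fst s" "snd s"] that by simp
  ultimately show ?thesis unfolding bij_betw_def by (blast intro!: equalityI)
qed

end
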